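(* Let $A\in\mathbb{Z}^{d\times n}$ have rank $d$ with columns lying in an affine hyperplane of $\mathbb{Q}^d$ not containing the origin, let $\beta\in\mathbb{C}^d$, let $w\in\mathbb{R}^n$ be a generic weight vector, and let $v$ be a fake exponent of $H_A(\beta)$ with respect to $w$. Assume that $B$ is a $\mathbb{Z}$-basis of $L=\ker_{\mathbb{Z}}(A)$ and that $P=m(s)P_B$. Then $v$ is an exponent of $H_A(\beta)$ in the direction $w$, and $$C_v=\lambda_B(P_B^{\perp})\cong Q_v^{\perp}$$ as graded vector spaces. In particular, $$\dim_{\mathbb{C}}C_v(q)=\dim_{\mathbb{C}}(Q_v^{\perp})_q\quad\text{for all }q\geq0.$$
   Context: Notation: $\mathbb{N}=\{0,1,2,\ldots\}$, $[n]=\{1,\ldots,n\}$, $L=\ker_{\mathbb{Z}}(A)$. The toric ideal is $I_A=\langle\partial^u-\partial^{u'}\mid Au=Au',\ u,u'\in\mathbb{N}^n\rangle\subseteq\mathbb{C}[\partial_1,\ldots,\partial_n]$. $\operatorname{in}_w(I_A)$ is the ideal generated by the $w$-initial forms (sums of terms of maximal $w$-weight) of elements of $I_A$; "$w$ generic" means in particular that $\operatorname{in}_w(I_A)$ is a monomial ideal. Let $D=\mathbb{C}\langle x_1,\ldots,x_n,\partial_1,\ldots,\partial_n\rangle$ be the Weyl algebra and $\vartheta_j=x_j\partial_j$. $H_A(\beta)$ is the left ideal of $D$ generated by $I_A$ and the Euler operators $\sum_j a_{ij}\vartheta_j-\beta_i$. The fake indicial ideal is $(D\cdot\operatorname{in}_w(I_A)\cap\mathbb{C}[\vartheta])+\langle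 A\vartheta-\beta\rangle\subseteq\mathbb{C}[\vartheta]$; a zero $v\in\mathbb{C}^n$ of it is called a fake exponent of $H_A(\beta)$ with respect to $w$. $\operatorname{nsupp}(z)=\{j\in[n]\mid z_j\in\mathbb{Z}_{<0}\}$ for $z\in\mathbb{C}^n$. For $u\in L$ put $I_u=\operatorname{nsupp}(v+u)$, so $I_0=\operatorname{nsupp}(v)$. Let $\{\partial^{g_+^{(i)}}-\partial^{g_-^{(i)}}\mid i=1,\ldots,m\}$ be the reduced Gröbner basis of $I_A$ with respect to $w$, with $\partial^{g_+^{(i)}}\in\operatorname{in}_w(I_A)$; put $g^{(i)}=g_+^{(i)}-g_-^{(i)}$, $G^{(i)}=I_{-g^{(i)}}\setminus I_0$, and $C(w)=\sum_{i=1}^m\mathbb{N}g^{(i)}$. Local fake indicial ideal. Let $T=\mathbb{C}[\theta_1,\ldots,\theta_n]$ and $$Q_v=\Bigl\langle\sum_j a_{ij}\theta_j\Bigm| i=1,\ldots,d\Bigr\rangle+\Bigl\langle\prod_{j\in G^{(i)}}\theta_j\Bigm| i=1,\ldots,m\Bigr\rangle\subseteq T,$$ $Q_v^\perp=\{f\in\mathbb{C}[z_1,\ldots,z_n]\mid\phi(\partial_z)\bullet f=0\text{ for all }\phi\in Q_v\}$, graded by degree in $z$. Frobenius data. For a $\mathbb{Z}$-basis $B=\{b^{(1)},\ldots,b^{(h)}\}$ of $L$ ($h=n-d$), put $(Bs)_j=\sum_{k=1}^h b^{(k)}_js_k\in\mathbb{C}[s]=\mathbb{C}[s_1,\ldots,s_h]$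 and $(Bs)^F=\prod_{j\in F}(Bs)_j$ for $F\subseteq[n]$. Let $$\operatorname{NS}_w(v)=\{I_u\mid u\in L,\ u'\in C(w)\text{ for every }u'\in L\text{ with }I_{u'}=I_u\},$$ let $\operatorname{NS}_w^c(v)=\{I_u\mid u\in L\}\setminus\operatorname{NS}_w(v)$, and $K=\bigcap_{I\in\operatorname{NS}_w(v)}I$. Define $$P=\langle(Bs)^{(I\cup J)\setminus K}\mid I\in\operatorname{NS}_w(v),\ J\in\operatorname{NS}_w^c(v)\rangle,\quad m(s)=(Bs)^{I_0\setminus K},\quad P_B=\langle(Bs)^{G^{(i)}}\mid i=1,\ldots,m\rangle$$ (ideals, resp. an element, of $\mathbb{C}[s]$). $P_B^\perp=\{q(\partial_s)\in\mathbb{C}[\partial_{s_1},\ldots,\partial_{s_h}]\mid (q(\partial_s)\bullet f)|_{s=0}=0\text{ for all }f\in P_B\}$, graded by degree in $\partial_s$. The algebra homomorphism $\lambda_B:\mathbb{C}[\partial_{s_1},\ldots,\partial_{s_h}]\to\mathbb{C}[\log x_1,\ldots,\log x_n]$ is given by $\lambda_B(\partial_{s_k})=\sum_{j=1}^n b_j^{(k)}\log x_j$. Series solutions. $v$ is an exponent in the direction $w$ if there is a series solution with exponent $v$ in the direction $w$, i.e. a solution of $H_A(\beta)$ of the form $\phi=x^v\sum_{u\in L}g_u(\log x)x^u$ with $g_0\neq0$, where the $g_u\in\mathbb{C}[\log x_1,\ldots,\log x_n]$ have uniformly bounded degree and $\{u\mid g_u\neq0\}$ lies in a pointed rational cone on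 which $w\cdot u>0$ for $u\neq0$ (the usual convention for series in the direction $w$). $C_v$ is the vector space consisting of $0$ and all leading coefficients $g_0$ of such solutions, and $C_v(q)=C_v\cap\mathbb{C}[\log x_1,\ldots,\log x_n]_q$ is its part homogeneous of degree $q$. *)

theory Defs
  imports "HOL-Analysis.Analysis" "HOL-Library.Poly_Mapping"
begin

section \<open>Polynomials with complex coefficients\<close>

type_synonym 'v exps = "'v \<Rightarrow>\<^sub>0 nat"
type_synonym 'v cpoly = "'v exps \<Rightarrow>\<^sub>0 complex"

abbreviation unit_exp :: "'v \<Rightarrow> 'v exps" where
  "unit_exp j \<equiv> Poly_Mapping.single j 1"

definition monom :: "'v exps \<Rightarrow> 'v cpoly" where
  "monom a = Poly_Mapping.single a 1"

definition const :: "complex \<Rightarrow> 'v cpoly" where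
  "const c = Poly_Mapping.single 0 c"

definition var :: "'v \<Rightarrow> 'v cpoly" where
  "var j = monom (unit_exp j)"

text \<open>Scalar multiplication is defined for arbitrary key types because elements of the Weyl
  algebra below are finitely supported functions on pairs of exponents.\<close>

definition cscale :: "complex \<Rightarrow> ('k \<Rightarrow>\<^sub>0 complex) \<Rightarrow> ('k \<Rightarrow>\<^sub>0 complex)" where
  "cscale c p = Poly_Mapping.map ((*) c) p"

lemma lookup_cscale: "Poly_Mapping.lookup (cscale c p) a = c * Poly_Mapping.lookup p a"
  by (simp add: cscale_def Poly_Mapping.map.rep_eq when_def)

interpretation cvs: vector_space "cscale :: complex \<Rightarrow> ('k \<Rightarrow>\<^sub>0 complex) \<Rightarrow> ('k \<Rightarrow>\<^sub>0 complex)"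
  by unfold_locales
    (auto intro!: poly_mapping_eqI simp: lookup_cscale lookup_add algebra_simps)

definition exp_deg :: "'v exps \<Rightarrow> nat" where
  "exp_deg a = (\<Sum>j\<in>Poly_Mapping.keys a. Poly_Mapping.lookup a j)"

definition poly_ring :: "'v set \<Rightarrow> 'v cpoly set" where
  "poly_ring V = {p. \<forall>a\<in>Poly_Mapping.keys p. Poly_Mapping.keys a \<subseteq> V}"

definition poly_eval :: "('v \<Rightarrow> complex) \<Rightarrow> 'v cpoly \<Rightarrow> complex" where
  "poly_eval x p = (\<Sum>a\<in>Poly_Mapping.keys p.
     Poly_Mapping.lookup p a * (\<Prod>j\<in>Poly_Mapping.keys a. x j ^ Poly_Mapping.lookup a j))"

definition poly_subst :: "('v \<Rightarrow> 'u cpoly) \<Rightarrow> 'v cpoly \<Rightarrow> 'u cpoly" where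
  "poly_subst x p = (\<Sum>a\<in>Poly_Mapping.keys p.
     const (Poly_Mapping.lookup p a) * (\<Prod>j\<in>Poly_Mapping.keys a. x j ^ Poly_Mapping.lookup a j))"

definition poly_diff :: "'v \<Rightarrow> 'v cpoly \<Rightarrow> 'v cpoly" where
  "poly_diff j p = (\<Sum>a\<in>Poly_Mapping.keys p.
     Poly_Mapping.single (a - unit_exp j) (of_nat (Poly_Mapping.lookup a j) * Poly_Mapping.lookup p a))"

definition ideal_in :: "'a::comm_ring_1 set \<Rightarrow> 'a set \<Rightarrow> 'a set" where
  "ideal_in R S = {(\<Sum>p\<in>F. r p * p) |F r. finite F \<and> F \<subseteq> S \<and> (\<forall>p\<in>F. r p \<in> R)}"

abbreviation ideal_gen :: "'a::comm_ring_1 set \<Rightarrow> 'a set" where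
  "ideal_gen S \<equiv> ideal_in UNIV S"

text \<open>A polynomial evaluated at a family \<open>T\<close> of pairwise commuting operators. The fold is
  order-independent exactly because of commutativity, which holds in every use below.\<close>

definition op_monom :: "('v \<Rightarrow> 'm \<Rightarrow> 'm) \<Rightarrow> 'v exps \<Rightarrow> 'm \<Rightarrow> 'm" where
  "op_monom T a =
     Finite_Set.fold (\<lambda>j f. (T j ^^ Poly_Mapping.lookup a j) \<circ> f) id (Poly_Mapping.keys a)"

definition op_poly :: "('v \<Rightarrow> ('k \<Rightarrow>\<^sub>0 complex) \<Rightarrow> ('k \<Rightarrow>\<^sub>0 complex)) \<Rightarrow> 'v cpoly \<Rightarrow>
    ('k \<Rightarrow>\<^sub>0 complex) \<Rightarrow> ('k \<Rightarrow>\<^sub>0 complex)" where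
  "op_poly T p f = (\<Sum>a\<in>Poly_Mapping.keys p. cscale (Poly_Mapping.lookup p a) (op_monom T a f))"

definition diff_act :: "'v cpoly \<Rightarrow> 'v cpoly \<Rightarrow> 'v cpoly" where
  "diff_act p f = op_poly poly_diff p f"

section \<open>Graded vector spaces of polynomials\<close>

definition hom_comp :: "nat \<Rightarrow> 'v cpoly \<Rightarrow> 'v cpoly" where
  "hom_comp q p = (\<Sum>a\<in>{a \<in> Poly_Mapping.keys p. exp_deg a = q}.
     Poly_Mapping.single a (Poly_Mapping.lookup p a))"

definition hom_part :: "'v cpoly set \<Rightarrow> nat \<Rightarrow> 'v cpoly set" where
  "hom_part V q = {p \<in> V. \<forall>a\<in>Poly_Mapping.keys p. exp_deg a = q}"

definition graded_subspace :: "'v cpoly set \<Rightarrow> bool" where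
  "graded_subspace V \<longleftrightarrow> cvs.subspace V \<and> (\<forall>p\<in>V. \<forall>q. hom_comp q p \<in> V)"

definition graded_isomorphic :: "'v cpoly set \<Rightarrow> 'u cpoly set \<Rightarrow> bool" where
  "graded_isomorphic V W \<longleftrightarrow> graded_subspace V \<and> graded_subspace W \<and>
     (\<exists>f. (\<forall>p\<in>V. \<forall>p'\<in>V. f (p + p') = f p + f p') \<and>
          (\<forall>c. \<forall>p\<in>V. f (cscale c p) = cscale c (f p)) \<and>
          bij_betw f V W \<and> (\<forall>q. f ` hom_part V q = hom_part W q))"

section \<open>Toric ideals, initial ideals and reduced Groebner bases\<close>

definition int_vec :: "int^'n \<Rightarrow> 'a::ring_1^'n" where
  "int_vec u = (\<chi> j. of_int (u $ j))"

definition exp_vec :: "'n exps \<Rightarrow> int^'n" where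
  "exp_vec a = (\<chi> j. int (Poly_Mapping.lookup a j))"

definition int_ker :: "int^'n^'d \<Rightarrow> (int^'n) set" where
  "int_ker A = {u. A *v u = 0}"

definition toric_ideal :: "int^'n^'d \<Rightarrow> 'n cpoly set" where
  "toric_ideal A = ideal_gen {monom a - monom b |a b. A *v exp_vec a = A *v exp_vec b}"

definition exp_weight :: "real^'n \<Rightarrow> 'n exps \<Rightarrow> real" where
  "exp_weight w a = w \<bullet> int_vec (exp_vec a)"

definition init_form :: "real^'n \<Rightarrow> 'n cpoly \<Rightarrow> 'n cpoly" where
  "init_form w p = (\<Sum>a\<in>{a \<in> Poly_Mapping.keys p. \<forall>b\<in>Poly_Mapping.keys p. exp_weight w b \<le> exp_weight w a}.
     Poly_Mapping.single a (Poly_Mapping.lookup p a))"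

definition init_ideal :: "real^'n \<Rightarrow> 'n cpoly set \<Rightarrow> 'n cpoly set" where
  "init_ideal w I = ideal_gen (init_form w ` I)"

definition monomial_ideal :: "'n cpoly set \<Rightarrow> bool" where
  "monomial_ideal I \<longleftrightarrow> (\<exists>E. I = ideal_gen (monom ` E))"

text \<open>Since \<open>w\<close> may have negative entries, a trailing term of \<open>p\<close> could be a proper multiple of
  the initial monomial of \<open>p\<close> itself; hence trailing terms are required to avoid the whole
  initial ideal, which is automatic for term orders.\<close>

definition reduced_groebner_basis :: "real^'n \<Rightarrow> 'n cpoly set \<Rightarrow> 'n cpoly set \<Rightarrow> bool" where
  "reduced_groebner_basis w I G \<longleftrightarrow>
     finite G \<and> ideal_gen G = I \<and> ideal_gen (init_form w ` G) = init_ideal w I \<and>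
     (\<forall>p\<in>G. \<exists>a. init_form w p = monom a \<and>
        (\<forall>b\<in>Poly_Mapping.keys p - {a}. monom b \<notin> init_ideal w I)) \<and>
     (\<forall>p\<in>G. \<forall>b\<in>Poly_Mapping.keys p. monom b \<notin> ideal_gen (init_form w ` (G - {p})))"

section \<open>The Weyl algebra\<close>

text \<open>An element of the Weyl algebra is given by its coefficients in the basis of normally
  ordered monomials: the key \<open>(a, b)\<close> stands for \<open>x^a \<partial>^b\<close>. The maps \<open>weyl_x j\<close> and
  \<open>weyl_d j\<close> are left multiplication by \<open>x_j\<close> and \<open>\<partial>_j\<close>, the latter by
  \<open>\<partial>_j x^a \<partial>^b = x^a \<partial>^(b + e_j) + a_j x^(a - e_j) \<partial>^b\<close>.\<close>

type_synonym 'n weyl = "('n exps \<times> 'n exps) \<Rightarrow>\<^sub>0 complex"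

definition weyl_x :: "'n \<Rightarrow> 'n weyl \<Rightarrow> 'n weyl" where
  "weyl_x j P = (\<Sum>(a, b)\<in>Poly_Mapping.keys P.
     Poly_Mapping.single (a + unit_exp j, b) (Poly_Mapping.lookup P (a, b)))"

definition weyl_d :: "'n \<Rightarrow> 'n weyl \<Rightarrow> 'n weyl" where
  "weyl_d j P = (\<Sum>(a, b)\<in>Poly_Mapping.keys P.
     Poly_Mapping.single (a, b + unit_exp j) (Poly_Mapping.lookup P (a, b)) +
     Poly_Mapping.single (a - unit_exp j, b)
       (of_nat (Poly_Mapping.lookup a j) * Poly_Mapping.lookup P (a, b)))"

definition weyl_mult :: "'n weyl \<Rightarrow> 'n weyl \<Rightarrow> 'n weyl" where
  "weyl_mult P Q = (\<Sum>(a, b)\<in>Poly_Mapping.keys P.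
     cscale (Poly_Mapping.lookup P (a, b)) (op_monom weyl_x a (op_monom weyl_d b Q)))"

definition weyl_left_ideal :: "'n weyl set \<Rightarrow> 'n weyl set" where
  "weyl_left_ideal S = {(\<Sum>Q\<in>F. weyl_mult (R Q) Q) |F R. finite F \<and> F \<subseteq> S}"

definition weyl_one :: "'n weyl" where
  "weyl_one = Poly_Mapping.single (0, 0) 1"

definition weyl_theta :: "'n \<Rightarrow> 'n weyl" where
  "weyl_theta j =
     weyl_mult (Poly_Mapping.single (unit_exp j, 0) 1) (Poly_Mapping.single (0, unit_exp j) 1)"

text \<open>The embeddings of the commutative polynomial rings in the \<open>\<partial>_j\<close> and in the
  \<open>\<vartheta>_j = x_j \<partial>_j\<close>.\<close>

definition of_del_poly :: "'n cpoly \<Rightarrow> 'n weyl" where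
  "of_del_poly p = (\<Sum>b\<in>Poly_Mapping.keys p. Poly_Mapping.single (0, b) (Poly_Mapping.lookup p b))"

definition of_theta_poly :: "'n cpoly \<Rightarrow> 'n weyl" where
  "of_theta_poly p = op_poly (\<lambda>j. weyl_mult (weyl_theta j)) p weyl_one"

section \<open>Hypergeometric systems and fake exponents\<close>

definition lin_form :: "int^'n \<Rightarrow> 'n cpoly" where
  "lin_form a = (\<Sum>j\<in>UNIV. const (of_int (a $ j)) * var j)"

definition euler_polys :: "int^'n^'d \<Rightarrow> complex^'d \<Rightarrow> 'n cpoly set" where
  "euler_polys A \<beta> = {lin_form (A $ i) - const (\<beta> $ i) |i. True}"

definition hypergeometric_ideal :: "int^'n^'d \<Rightarrow> complex^'d \<Rightarrow> 'n weyl set" where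
  "hypergeometric_ideal A \<beta> =
     weyl_left_ideal (of_del_poly ` toric_ideal A \<union> of_theta_poly ` euler_polys A \<beta>)"

definition fake_indicial_ideal :: "int^'n^'d \<Rightarrow> complex^'d \<Rightarrow> real^'n \<Rightarrow> 'n cpoly set" where
  "fake_indicial_ideal A \<beta> w =
     {p + q |p q. of_theta_poly p \<in> weyl_left_ideal (of_del_poly ` init_ideal w (toric_ideal A)) \<and>
                  q \<in> ideal_gen (euler_polys A \<beta>)}"

definition fake_exponent :: "int^'n^'d \<Rightarrow> complex^'d \<Rightarrow> real^'n \<Rightarrow> complex^'n \<Rightarrow> bool" where
  "fake_exponent A \<beta> w v \<longleftrightarrow> (\<forall>p\<in>fake_indicial_ideal A \<beta> w. poly_eval (($) v) p = 0)"

section \<open>Logarithmic series\<close>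

text \<open>\<open>\<phi>\<close> represents the formal sum of the \<open>x^e \<phi>_e(log x)\<close> over \<open>e \<in> \<complex>^n\<close>, where the
  variable \<open>j\<close> of the polynomial \<open>\<phi>_e\<close> stands for \<open>log x_j\<close>; thus
  \<open>\<partial>_j (x^e g(log x)) = x^(e - e_j) (e_j g + \<partial>g/\<partial>(log x_j))\<close>.\<close>

type_synonym 'n log_series = "complex^'n \<Rightarrow> 'n cpoly"

definition series_scale :: "complex \<Rightarrow> ('n::finite) log_series \<Rightarrow> 'n log_series" where
  "series_scale c \<phi> = (\<lambda>e. cscale c (\<phi> e))"

definition series_x :: "'n::finite \<Rightarrow> 'n log_series \<Rightarrow> 'n log_series" where
  "series_x j \<phi> = (\<lambda>e. \<phi> (e - axis j 1))"

definition series_d :: "'n::finite \<Rightarrow> 'n log_series \<Rightarrow> 'n log_series" where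
  "series_d j \<phi> =
     (\<lambda>e. cscale (e $ j + 1) (\<phi> (e + axis j 1)) + poly_diff j (\<phi> (e + axis j 1)))"

definition weyl_series_act :: "('n::finite) weyl \<Rightarrow> 'n log_series \<Rightarrow> 'n log_series" where
  "weyl_series_act P \<phi> = (\<lambda>e. \<Sum>(a, b)\<in>Poly_Mapping.keys P.
     series_scale (Poly_Mapping.lookup P (a, b)) (op_monom series_x a (op_monom series_d b \<phi>)) e)"

definition hypergeometric_solution :: "int^'n^'d \<Rightarrow> complex^'d \<Rightarrow> 'n log_series \<Rightarrow> bool" where
  "hypergeometric_solution A \<beta> \<phi> \<longleftrightarrow>
     (\<forall>P\<in>hypergeometric_ideal A \<beta>. weyl_series_act P \<phi> = (\<lambda>e. 0))"

definition rational_cone :: "(real^'n) set \<Rightarrow> bool" where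
  "rational_cone \<sigma> \<longleftrightarrow>
     (\<exists>S :: (rat^'n) set. finite S \<and> \<sigma> = convex_cone hull ((\<lambda>r. \<chi> j. of_rat (r $ j)) ` S))"

definition pointed_cone :: "(real^'n) set \<Rightarrow> bool" where
  "pointed_cone \<sigma> \<longleftrightarrow> \<sigma> \<inter> uminus ` \<sigma> = {0}"

definition series_in_direction ::
    "int^'n^'d \<Rightarrow> real^'n \<Rightarrow> complex^'n \<Rightarrow> 'n log_series \<Rightarrow> bool" where
  "series_in_direction A w v \<phi> \<longleftrightarrow>
     (\<exists>\<sigma>. rational_cone \<sigma> \<and> pointed_cone \<sigma> \<and> (\<forall>u\<in>\<sigma>. u \<noteq> 0 \<longrightarrow> w \<bullet> u > 0) \<and>
        (\<forall>e. \<phi> e \<noteq> 0 \<longrightarrow> (\<exists>u\<in>int_ker A. e = v + int_vec u \<and> int_vec u \<in> \<sigma>))) \<and>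
     (\<exists>N. \<forall>e. \<forall>a\<in>Poly_Mapping.keys (\<phi> e). exp_deg a \<le> N)"

definition series_solution_with_exponent ::
    "int^'n^'d \<Rightarrow> complex^'d \<Rightarrow> real^'n \<Rightarrow> complex^'n \<Rightarrow> 'n log_series \<Rightarrow> bool" where
  "series_solution_with_exponent A \<beta> w v \<phi> \<longleftrightarrow>
     series_in_direction A w v \<phi> \<and> hypergeometric_solution A \<beta> \<phi> \<and> \<phi> v \<noteq> 0"

definition exponent_in_direction ::
    "int^'n^'d \<Rightarrow> complex^'d \<Rightarrow> real^'n \<Rightarrow> complex^'n \<Rightarrow> bool" where
  "exponent_in_direction A \<beta> w v \<longleftrightarrow> (\<exists>\<phi>. series_solution_with_exponent A \<beta> w v \<phi>)"

definition leading_coeffs ::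
    "int^'n^'d \<Rightarrow> complex^'d \<Rightarrow> real^'n \<Rightarrow> complex^'n \<Rightarrow> 'n cpoly set" where
  "leading_coeffs A \<beta> w v = insert 0 {\<phi> v |\<phi>. series_solution_with_exponent A \<beta> w v \<phi>}"

section \<open>The local fake indicial ideal\<close>

text \<open>In the remaining definitions \<open>g 1, \<dots>, g m\<close> are the exponent vectors
  \<open>g_+ - g_-\<close> of the reduced Groebner basis.\<close>

definition nsupp :: "complex^'n \<Rightarrow> 'n set" where
  "nsupp z = {j. \<exists>k::int. k < 0 \<and> z $ j = of_int k}"

definition nsupp_shift :: "complex^'n \<Rightarrow> int^'n \<Rightarrow> 'n set" where
  "nsupp_shift v u = nsupp (v + int_vec u)"

definition new_nsupp :: "complex^'n \<Rightarrow> int^'n \<Rightarrow> 'n set" where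
  "new_nsupp v g = nsupp_shift v (- g) - nsupp_shift v 0"

definition local_fake_indicial_ideal ::
    "int^'n^'d \<Rightarrow> complex^'n \<Rightarrow> nat \<Rightarrow> (nat \<Rightarrow> int^'n) \<Rightarrow> 'n cpoly set" where
  "local_fake_indicial_ideal A v m g =
     ideal_gen ({lin_form (A $ i) |i. True} \<union> {(\<Prod>j\<in>new_nsupp v (g i). var j) |i. i \<in> {1..m}})"

definition diff_perp :: "'n cpoly set \<Rightarrow> 'n cpoly set" where
  "diff_perp Q = {f. \<forall>p\<in>Q. diff_act p f = 0}"

section \<open>Frobenius data\<close>

definition int_basis :: "(int^'n) list \<Rightarrow> (int^'n) set \<Rightarrow> bool" where
  "int_basis B L \<longleftrightarrow>
     L = {(\<Sum>k<length B. c k *s B ! k) |c. True} \<and>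
     (\<forall>c. (\<Sum>k<length B. c k *s B ! k) = 0 \<longrightarrow> (\<forall>k<length B. c k = 0))"

text \<open>The ring \<open>\<complex>[s]\<close> has the variables \<open>s_k\<close> with \<open>k < length B\<close>; it is a subring of the
  polynomials in countably many variables so that the empty basis is covered.\<close>

definition s_ring :: "(int^'n) list \<Rightarrow> nat cpoly set" where
  "s_ring B = poly_ring {..<length B}"

definition Bs :: "(int^'n) list \<Rightarrow> 'n \<Rightarrow> nat cpoly" where
  "Bs B j = (\<Sum>k<length B. const (of_int (B ! k $ j)) * var k)"

definition Bs_prod :: "(int^'n) list \<Rightarrow> 'n set \<Rightarrow> nat cpoly" where
  "Bs_prod B F = (\<Prod>j\<in>F. Bs B j)"

definition C_monoid :: "nat \<Rightarrow> (nat \<Rightarrow> int^'n) \<Rightarrow> (int^'n) set" where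
  "C_monoid m g = {(\<Sum>i=1..m. int (c i) *s g i) |c. True}"

definition NS :: "int^'n^'d \<Rightarrow> complex^'n \<Rightarrow> nat \<Rightarrow> (nat \<Rightarrow> int^'n) \<Rightarrow> 'n set set" where
  "NS A v m g = {nsupp_shift v u |u. u \<in> int_ker A \<and>
     (\<forall>u'\<in>int_ker A. nsupp_shift v u' = nsupp_shift v u \<longrightarrow> u' \<in> C_monoid m g)}"

definition NS_compl :: "int^'n^'d \<Rightarrow> complex^'n \<Rightarrow> nat \<Rightarrow> (nat \<Rightarrow> int^'n) \<Rightarrow> 'n set set" where
  "NS_compl A v m g = nsupp_shift v ` int_ker A - NS A v m g"

definition K_set :: "int^'n^'d \<Rightarrow> complex^'n \<Rightarrow> nat \<Rightarrow> (nat \<Rightarrow> int^'n) \<Rightarrow> 'n set" where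
  "K_set A v m g = \<Inter> (NS A v m g)"

definition P_ideal ::
    "int^'n^'d \<Rightarrow> complex^'n \<Rightarrow> nat \<Rightarrow> (nat \<Rightarrow> int^'n) \<Rightarrow> (int^'n) list \<Rightarrow> nat cpoly set" where
  "P_ideal A v m g B = ideal_in (s_ring B)
     {Bs_prod B ((I \<union> J) - K_set A v m g) |I J. I \<in> NS A v m g \<and> J \<in> NS_compl A v m g}"

definition m_poly ::
    "int^'n^'d \<Rightarrow> complex^'n \<Rightarrow> nat \<Rightarrow> (nat \<Rightarrow> int^'n) \<Rightarrow> (int^'n) list \<Rightarrow> nat cpoly" where
  "m_poly A v m g B = Bs_prod B (nsupp_shift v 0 - K_set A v m g)"

definition PB_ideal ::
    "complex^'n \<Rightarrow> nat \<Rightarrow> (nat \<Rightarrow> int^'n) \<Rightarrow> (int^'n) list \<Rightarrow> nat cpoly set" where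
  "PB_ideal v m g B = ideal_in (s_ring B) {Bs_prod B (new_nsupp v (g i)) |i. i \<in> {1..m}}"

definition PB_perp ::
    "complex^'n \<Rightarrow> nat \<Rightarrow> (nat \<Rightarrow> int^'n) \<Rightarrow> (int^'n) list \<Rightarrow> nat cpoly set" where
  "PB_perp v m g B =
     {q \<in> s_ring B. \<forall>f\<in>PB_ideal v m g B. poly_eval (\<lambda>_. 0) (diff_act q f) = 0}"

definition lambda_B :: "(int^'n) list \<Rightarrow> nat cpoly \<Rightarrow> 'n cpoly" where
  "lambda_B B = poly_subst (\<lambda>k. lin_form (B ! k))"

end

theory Submission
  imports Defs
begin

text \<open>
  Let polynomials in \<open>\<theta>\<close> act on polynomials in \<open>z = log x\<close> by differentiation. The kernel of the forms
  \<open>A \<theta>\<close> is the image of \<open>\<lambda>\<^sub>B\<close>, and \<open>\<lambda>\<^sub>B\<close> intertwines \<open>\<theta>\<^sub>j\<close> with \<open>(B \<partial>\<^sub>s)\<^sub>j\<close>; since the pairing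
  \<open>(q(\<partial>\<^sub>s) f)(0)\<close> is symmetric, \<open>\<lambda>\<^sub>B(P\<^sub>B\<^sup>\<bottom>)\<close> and \<open>Q\<^sub>v\<^sup>\<bottom>\<close> are even equal.

  A leading coefficient lies in \<open>Q\<^sub>v\<^sup>\<bottom>\<close>: in \<open>(\<partial>^g\<^sub>+ - \<partial>^g\<^sub>-) \<phi> = 0\<close> the coefficient of \<open>x^(v - g\<^sub>+)\<close> involves
  only \<open>\<phi>\<^sub>v\<close>, and the factors \<open>c + \<theta>\<^sub>j\<close> with \<open>c \<noteq> 0\<close> act injectively.

  Conversely, given \<open>q\<^sub>0 \<in> P\<^sub>B\<^sup>\<bottom>\<close>, solve \<open>m(\<partial>\<^sub>s) q = q\<^sub>0\<close> and put \<open>f = \<lambda>\<^sub>B(q)\<close>. In Frobenius' method the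
  coefficient of \<open>x^(v + u)\<close>, \<open>I\<^sub>u \<in> NS\<^sub>w(v)\<close>, is \<open>\<Prod>\<^sub>j\<theta>\<^sub>j\<close> over \<open>j \<in> I\<^sub>u - K\<close> times an invertible operator, applied
  to \<open>f\<close>. The recursion can only fail where \<open>I\<^sub>u \<in> NS\<^sub>w(v)\<close> meets \<open>I\<^sub>u' \<in> NS\<^sub>w\<^sup>c(v)\<close>; there the defect is a
  multiple of \<open>\<theta>^((I\<^sub>u \<union> I\<^sub>u') - K) f\<close>, which vanishes because \<open>P = m(s) P\<^sub>B\<close>. The leading coefficient is
  \<open>\<theta>^(I\<^sub>0 - K) f = \<lambda>\<^sub>B(q\<^sub>0)\<close>.
\<close>

text \<open>The classical Frobenius method perturbs \<open>v\<close> to \<open>v + Bs\<close> and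
  lets \<open>s\<close> tend to 0. Here no limit occurs: the derivation \<theta>_j takes the place
  of \<open>(Bs)_j\<close>, and a series is a family of operators applied to one polynomial
  \<open>f\<close>. The Gamma quotients of the method are power series in \<theta>_j; since
  \<theta>_j is nilpotent on the polynomial \<open>f\<close>, truncations suffice, and operator
  identities are claimed only after application to \<open>f\<close>. The equation for
  \<open>q\<close> is solvable because \<open>m(s)\<close> is a product of nonzero linear forms: if
  row \<open>j\<close> of \<open>B\<close> vanished, coordinate \<open>j\<close> would be constant
  on \<open>v + L\<close>, so \<open>j\<close> in \<open>I_0\<close> would force \<open>j\<close> in
  every \<open>I_u\<close>, hence in \<open>K\<close>. Cutting the series off outside
  \<open>NS\<close> keeps its support in \<open>C(w)\<close>, hence in a cone on which
  \<open>w\<close> is positive. That \<open>I_0\<close> itself survives the cut-off is where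
  Groebner theory enters: normal forms are unique, and a fake exponent makes the relevant monomials
  standard. That \<open>v\<close> is an exponent is seen on the constant 1: every
  \<open>G^(i)\<close> is nonempty, so 1 lies in the orthogonal complement of
  \<open>Q_v\<close>.\<close>

abbreviation "lookup \<equiv> Poly_Mapping.lookup"
abbreviation "keys \<equiv> Poly_Mapping.keys"
abbreviation "single \<equiv> Poly_Mapping.single"

text \<open>\<open>unit_exp j\<close> abbreviates \<open>single j 1\<close>; rewriting
  \<open>1\<close> to \<open>Suc 0\<close> would hide it from the rules about unit
  exponents.\<close>

declare One_nat_def [simp del]

section \<open>Additive maps on finitely supported functions\<close>

lemma sum_keys_superset:
  fixes h :: "'k \<Rightarrow> complex \<Rightarrow> 'b::comm_monoid_add"
  assumes "\<And>a. h a 0 = 0" "finite S" "keys p \<subseteq> S"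
  shows "(\<Sum>a\<in>keys p. h a (lookup p a)) = (\<Sum>a\<in>S. h a (lookup p a))"
  using assms by (intro sum.mono_neutral_left) (auto simp: in_keys_iff)

text \<open>Substitution, evaluation, differentiation and the operator actions are all sums of this
  shape, so this is the common source of their additivity. Cancellation may shrink
  \<open>keys (p + q)\<close>; the union of the supports is a safe index set.\<close>

lemma sum_keys_add:
  fixes h :: "'k \<Rightarrow> complex \<Rightarrow> 'b::comm_monoid_add"
  assumes h0: "\<And>a. h a 0 = 0" and hadd: "\<And>a c d. h a (c + d) = h a c + h a d"
  shows "(\<Sum>a\<in>keys (p + q). h a (lookup (p + q) a)) =
         (\<Sum>a\<in>keys p. h a (lookup p a)) + (\<Sum>a\<in>keys q. h a (lookup q a))"
proof -
  let ?S = "keys p \<union> keys q"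
  have "(\<Sum>a\<in>keys (p + q). h a (lookup (p + q) a)) = (\<Sum>a\<in>?S. h a (lookup (p + q) a))"
    by (rule sum_keys_superset) (use h0 in \<open>auto dest: subsetD[OF keys_add]\<close>)
  also have "\<dots> = (\<Sum>a\<in>?S. h a (lookup p a)) + (\<Sum>a\<in>?S. h a (lookup q a))"
    by (simp add: lookup_add hadd sum.distrib)
  also have "(\<Sum>a\<in>?S. h a (lookup p a)) = (\<Sum>a\<in>keys p. h a (lookup p a))"
    by (rule sum_keys_superset[symmetric]) (use h0 in auto)
  also have "(\<Sum>a\<in>?S. h a (lookup q a)) = (\<Sum>a\<in>keys q. h a (lookup q a))"
    by (rule sum_keys_superset[symmetric]) (use h0 in auto)
  finally show ?thesis .
qed

lemma sum_keys_single:
  fixes h :: "'k \<Rightarrow> complex \<Rightarrow> 'b::comm_monoid_add"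
  assumes h0: "\<And>a. h a 0 = 0"
  shows "(\<Sum>b\<in>keys (single a c). h b (lookup (single a c) b)) = h a c"
  using sum_keys_superset[where h = h and p = "single a c" and S = "{a}"] h0
  by (auto simp: lookup_single)

lemma sum_keys_singles: "(\<Sum>a\<in>keys p. single a (lookup p a)) = p"
  by (rule poly_mapping_eqI) (simp add: lookup_sum lookup_single when_def in_keys_iff)

lemma pm_induct [case_names zero single add]:
  fixes p :: "'k \<Rightarrow>\<^sub>0 complex"
  assumes "P 0" "\<And>a c. P (single a c)" "\<And>p q. P p \<Longrightarrow> P q \<Longrightarrow> P (p + q)"
  shows "P p"
proof -
  have "P (\<Sum>a\<in>S. single a (lookup p a))" if "finite S" for S
    using that by (induction S rule: finite_induct) (use assms in auto)
  then show ?thesis by (metis finite_keys sum_keys_singles)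
qed

text \<open>The standard way below to prove an identity: both sides are additive in one argument, so
  single terms decide.\<close>

lemma additive_eqI:
  fixes F G :: "('k \<Rightarrow>\<^sub>0 complex) \<Rightarrow> 'b::ab_group_add"
  assumes F: "\<And>p q. F (p + q) = F p + F q" and G: "\<And>p q. G (p + q) = G p + G q"
    and FG: "\<And>a c. F (single a c) = G (single a c)"
  shows "F p = G p"
proof (induction p rule: pm_induct)
  case zero
  \<comment> \<open>The key is arbitrary, since \<open>single undefined 0\<close> is the zero
    function.\<close>
  then show ?case using FG[of undefined 0] by simp
qed (simp_all add: assms)

lemma cscale_single: "cscale c (single a d) = single a (c * d)"
  by (rule poly_mapping_eqI) (simp add: lookup_cscale lookup_single when_def)

section \<open>Polynomials\<close>

lemma lookup_monom: "lookup (monom a) b = (if a = b then 1 else 0)"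
  by (simp add: monom_def lookup_single when_def)

lemma lookup_const: "lookup (const c) a = (if a = 0 then c else 0)"
  by (auto simp: const_def lookup_single when_def)

lemma keys_monom [simp]: "keys (monom a) = {a}"
  by (simp add: monom_def)

lemma monom_mult: "monom a * monom b = monom (a + b)"
  by (simp add: monom_def mult_single)

lemma monom_0 [simp]: "monom 0 = 1"
  by (simp add: monom_def single_one)

lemma const_0 [simp]: "const 0 = 0" and const_1 [simp]: "const 1 = 1"
  by (simp_all add: const_def single_one)

lemma const_add: "const (c + d) = const c + const d"
  by (simp add: const_def single_add)

lemma const_uminus: "const (- c) = - const c"
  by (simp add: const_def single_uminus)

lemma const_mult: "const (c * d) = const c * const d"
  by (simp add: const_def mult_single)

lemma const_sum: "const (\<Sum>x\<in>S. f x) = (\<Sum>x\<in>S. const (f x))"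
  by (induction S rule: infinite_finite_induct) (simp_all add: const_add)

lemma cscale_eq_const_mult: "cscale c p = const c * p"
  by (rule additive_eqI) (simp_all add: cvs.scale_right_distrib algebra_simps cscale_single const_def mult_single)

lemma single_eq_const_mult: "single a c = const c * monom a"
  by (simp add: const_def monom_def mult_single)

text \<open>Induction on the total degree. Peeling off one variable at a time matches
  \<open>op_monom\<close>, where it means one more application of an operator.\<close>

lemma exps_induct [case_names zero add]:
  fixes a :: "'v exps"
  assumes "P 0" "\<And>j a. P a \<Longrightarrow> P (unit_exp j + a)"
  shows "P a"
proof (induction "\<Sum>j\<in>keys a. lookup a j" arbitrary: a rule: less_induct)
  case less
  show ?case
  proof (cases "a = 0")
    case False
    then obtain j where j: "j \<in> keys a" by (metis keys_eq_empty equals0I)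
    hence pos: "lookup a j > 0" by (simp add: in_keys_iff)
    define b where "b = a - unit_exp j"
    have ab: "a = unit_exp j + b"
      by (rule poly_mapping_eqI) (use pos in \<open>auto simp: b_def lookup_add lookup_minus lookup_single when_def\<close>)
    have "keys b \<subseteq> keys a"
      by (auto simp: b_def in_keys_iff lookup_minus)
    hence "(\<Sum>j\<in>keys b. lookup b j) = (\<Sum>j\<in>keys a. lookup b j)"
      by (intro sum.mono_neutral_left) (auto simp: in_keys_iff)
    also have "\<dots> < (\<Sum>j\<in>keys a. lookup a j)"
      by (rule sum_strict_mono_ex1)
         (use j pos in \<open>auto simp: b_def lookup_minus lookup_single intro!: bexI[of _ j]\<close>)
    finally show ?thesis using less assms(2) ab by metis
  qed (use assms in simp)
qed

lemma monom_unit_exp_add: "monom (unit_exp j + a) = var j * monom a"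
  by (simp add: var_def monom_mult)

lemma poly_ring_const [simp]: "const c \<in> poly_ring V"
  by (auto simp: poly_ring_def const_def)

lemma poly_ring_1 [simp]: "1 \<in> poly_ring V" and poly_ring_0 [simp]: "0 \<in> poly_ring V"
  using poly_ring_const[of 1 V] poly_ring_const[of 0 V] by simp_all

lemma poly_ring_add: "p \<in> poly_ring V \<Longrightarrow> q \<in> poly_ring V \<Longrightarrow> p + q \<in> poly_ring V"
  using keys_add[of p q] by (fastforce simp: poly_ring_def)

lemma keys_exps_add: "keys (a + b :: 'v exps) = keys a \<union> keys b"
  by (auto simp: in_keys_iff lookup_add)

lemma poly_ring_mult: "p \<in> poly_ring V \<Longrightarrow> q \<in> poly_ring V \<Longrightarrow> p * q \<in> poly_ring V"
  using keys_mult[of p q] by (force simp: poly_ring_def keys_exps_add)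

lemma poly_ring_monom: "monom a \<in> poly_ring V \<longleftrightarrow> keys a \<subseteq> V"
  by (simp add: poly_ring_def)

lemma poly_ring_var: "j \<in> V \<Longrightarrow> var j \<in> poly_ring V"
  by (simp add: var_def poly_ring_monom)

lemma poly_ring_sum: "(\<And>x. x \<in> S \<Longrightarrow> f x \<in> poly_ring V) \<Longrightarrow> (\<Sum>x\<in>S. f x) \<in> poly_ring V"
  by (induction S rule: infinite_finite_induct) (auto intro: poly_ring_add)

lemma poly_ring_UNIV [simp]: "poly_ring UNIV = UNIV"
  by (auto simp: poly_ring_def)

text \<open>The cases carry membership along, because results about \<open>s_ring B\<close> need
  \<open>k < length B\<close> for every variable that is multiplied on.\<close>

lemma poly_ring_induct [consumes 1, case_names const add var_mult]:
  assumes p: "p \<in> poly_ring V"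
    and c: "\<And>c. P (const c)"
    and a: "\<And>p q. p \<in> poly_ring V \<Longrightarrow> q \<in> poly_ring V \<Longrightarrow> P p \<Longrightarrow> P q \<Longrightarrow> P (p + q)"
    and v: "\<And>j p. j \<in> V \<Longrightarrow> p \<in> poly_ring V \<Longrightarrow> P p \<Longrightarrow> P (var j * p)"
  shows "P p"
proof -
  have m: "P (const c * monom e)" if "keys e \<subseteq> V" for e c
    using that
  proof (induction e rule: exps_induct)
    case (add j e)
    have "const c * monom e \<in> poly_ring V" using add.prems
      by (intro poly_ring_mult) (auto simp: poly_ring_monom keys_exps_add)
    with add have "P (var j * (const c * monom e))" by (intro v) (auto simp: keys_exps_add)
    then show ?case by (simp add: monom_unit_exp_add mult.left_commute)
  qed (simp add: c)
  have "(\<Sum>a\<in>S. single a (lookup p a)) \<in> poly_ring V \<and> P (\<Sum>a\<in>S. single a (lookup p a))"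
    if "finite S" "S \<subseteq> keys p" for S
    using that
  proof (induction S rule: finite_induct)
    case (insert x S)
    have "keys x \<subseteq> V" using insert.prems p by (auto simp: poly_ring_def)
    hence "single x (lookup p x) \<in> poly_ring V \<and> P (single x (lookup p x))"
      using m by (auto simp: single_eq_const_mult poly_ring_monom intro!: poly_ring_mult)
    then show ?case using insert by (auto intro!: a poly_ring_add)
  qed (use c[of 0] in auto)
  then show ?thesis by (metis finite_keys order_refl sum_keys_singles)
qed

lemma cpoly_induct [case_names const add var_mult]:
  fixes p :: "'v cpoly"
  assumes "\<And>c. P (const c)" "\<And>p q. P p \<Longrightarrow> P q \<Longrightarrow> P (p + q)" "\<And>j p. P p \<Longrightarrow> P (var j * p)"
  shows "P p"
  by (rule poly_ring_induct[of p UNIV]) (use assms in auto)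

lemma prod_keys_superset:
  fixes x :: "'v \<Rightarrow> 'b::comm_monoid_mult"
  assumes "finite S" "keys a \<subseteq> S"
  shows "(\<Prod>j\<in>keys a. x j ^ lookup a j) = (\<Prod>j\<in>S. x j ^ lookup a j)"
  using assms by (intro prod.mono_neutral_left) (auto simp: in_keys_iff)

lemma prod_keys_add:
  fixes x :: "'v \<Rightarrow> 'b::comm_monoid_mult"
  shows "(\<Prod>j\<in>keys (a + b). x j ^ lookup (a + b) j) =
         (\<Prod>j\<in>keys a. x j ^ lookup a j) * (\<Prod>j\<in>keys b. x j ^ lookup b j)"
proof -
  let ?S = "keys a \<union> keys b"
  show ?thesis
    by (simp add: prod_keys_superset[of ?S a] prod_keys_superset[of ?S b]
        prod_keys_superset[of ?S "a + b"] keys_exps_add lookup_add power_add prod.distrib)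
qed

lemma poly_subst_add: "poly_subst x (p + q) = poly_subst x p + poly_subst x q"
  unfolding poly_subst_def by (rule sum_keys_add) (simp_all add: const_add algebra_simps)

lemma poly_subst_single:
  "poly_subst x (single a c) = const c * (\<Prod>j\<in>keys a. x j ^ lookup a j)"
  unfolding poly_subst_def by (rule sum_keys_single) simp

lemma poly_subst_mult: "poly_subst x (p * q) = poly_subst x p * poly_subst x q"
proof (rule additive_eqI[where p = p])
  fix a c
  show "poly_subst x (single a c * q) = poly_subst x (single a c) * poly_subst x q"
    by (rule additive_eqI[where p = q])
       (simp_all add: poly_subst_add mult_single poly_subst_single prod_keys_add const_mult algebra_simps)
qed (simp_all add: poly_subst_add algebra_simps)

lemma poly_subst_const [simp]: "poly_subst x (const c) = const c"
  unfolding const_def by (subst poly_subst_single) (simp add: const_def)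

lemma poly_subst_0 [simp]: "poly_subst x 0 = 0" and poly_subst_1 [simp]: "poly_subst x 1 = 1"
  using poly_subst_const[of x 0] poly_subst_const[of x 1] by simp_all

lemma poly_subst_var [simp]: "poly_subst x (var j) = x j"
  unfolding var_def monom_def by (subst poly_subst_single) simp

lemma poly_subst_sum: "poly_subst x (\<Sum>i\<in>S. f i) = (\<Sum>i\<in>S. poly_subst x (f i))"
  by (induction S rule: infinite_finite_induct) (simp_all add: poly_subst_add)

lemma poly_subst_prod: "poly_subst x (\<Prod>i\<in>S. f i) = (\<Prod>i\<in>S. poly_subst x (f i))"
  by (induction S rule: infinite_finite_induct) (simp_all add: poly_subst_mult)

lemma poly_subst_cscale: "poly_subst x (cscale c p) = cscale c (poly_subst x p)"
  by (simp add: cscale_eq_const_mult poly_subst_mult)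

lemma poly_eval_add: "poly_eval x (p + q) = poly_eval x p + poly_eval x q"
  unfolding poly_eval_def by (rule sum_keys_add) (simp_all add: algebra_simps)

lemma poly_eval_single:
  "poly_eval x (single a c) = c * (\<Prod>j\<in>keys a. x j ^ lookup a j)"
  unfolding poly_eval_def by (rule sum_keys_single) simp

lemma poly_eval_mult: "poly_eval x (p * q) = poly_eval x p * poly_eval x q"
proof (rule additive_eqI[where p = p])
  fix a c
  show "poly_eval x (single a c * q) = poly_eval x (single a c) * poly_eval x q"
    by (rule additive_eqI[where p = q])
       (simp_all add: poly_eval_add mult_single poly_eval_single prod_keys_add algebra_simps)
qed (simp_all add: poly_eval_add algebra_simps)

lemma poly_eval_const [simp]: "poly_eval x (const c) = c"
  unfolding const_def by (subst poly_eval_single) simp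

lemma poly_eval_0 [simp]: "poly_eval x 0 = 0" and poly_eval_1 [simp]: "poly_eval x 1 = 1"
  using poly_eval_const[of x 0] poly_eval_const[of x 1] by simp_all

lemma poly_eval_var [simp]: "poly_eval x (var j) = x j"
  unfolding var_def monom_def by (subst poly_eval_single) simp

lemma poly_eval_diff: "poly_eval x (p - q) = poly_eval x p - poly_eval x q"
  using poly_eval_add[of x "p - q" q] by simp

lemma poly_eval_sum: "poly_eval x (\<Sum>i\<in>S. f i) = (\<Sum>i\<in>S. poly_eval x (f i))"
  by (induction S rule: infinite_finite_induct) (simp_all add: poly_eval_add)

text \<open>Turns the pairing that defines \<open>PB_perp\<close> into a constant
  coefficient.\<close>

lemma poly_eval_zero_point: "poly_eval (\<lambda>_. 0) p = lookup p 0"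
proof (rule additive_eqI[where p = p])
  fix a :: "'a exps" and c
  have "(\<Prod>j\<in>keys a. 0 ^ lookup a j) = (if a = 0 then 1 else (0::complex))"
  proof (cases "a = 0")
    case False
    then obtain j where "j \<in> keys a" by (metis keys_eq_empty equals0I)
    then show ?thesis using False by (auto simp: in_keys_iff intro!: bexI[of _ j])
  qed simp
  then show "poly_eval (\<lambda>_. 0) (single a c) = lookup (single a c) 0"
    by (simp add: poly_eval_single lookup_single)
qed (simp_all add: poly_eval_add lookup_add)

section \<open>Derivatives\<close>

lemma poly_diff_add: "poly_diff j (p + q) = poly_diff j p + poly_diff j q"
  unfolding poly_diff_def by (rule sum_keys_add) (simp_all add: single_add algebra_simps)

lemma poly_diff_single:
  "poly_diff j (single a c) = single (a - unit_exp j) (of_nat (lookup a j) * c)"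
  unfolding poly_diff_def by (rule sum_keys_single) simp

text \<open>Reading coefficients replaces the truncated subtraction \<open>a - unit_exp j\<close> by
  an addition, after which no case distinction is left.\<close>

lemma lookup_poly_diff:
  "lookup (poly_diff j p) a = of_nat (lookup a j + 1) * lookup p (a + unit_exp j)"
proof (rule additive_eqI[where p = p])
  fix b c
  show "lookup (poly_diff j (single b c)) a = of_nat (lookup a j + 1) * lookup (single b c) (a + unit_exp j)"
  proof (cases "lookup b j = 0")
    case True
    then have "b \<noteq> a + unit_exp j" by (auto simp: lookup_add)
    with True show ?thesis by (simp add: poly_diff_single lookup_single when_def)
  next
    case False
    have "b - unit_exp j = a \<longleftrightarrow> b = a + unit_exp j"
    proof
      assume "b - unit_exp j = a"
      thus "b = a + unit_exp j" using False
        by (auto intro!: poly_mapping_eqI simp: lookup_add lookup_minus lookup_single when_def)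
    qed simp
    then show ?thesis by (auto simp: poly_diff_single lookup_single when_def lookup_add)
  qed
qed (simp_all add: poly_diff_add lookup_add algebra_simps)

lemma poly_diff_cscale: "poly_diff j (cscale c p) = cscale c (poly_diff j p)"
  by (rule poly_mapping_eqI) (simp add: lookup_poly_diff lookup_cscale)

lemma poly_poly_diff_commuting_linearute: "poly_diff i (poly_diff j p) = poly_diff j (poly_diff i p)"
  by (rule poly_mapping_eqI)
     (simp add: lookup_poly_diff lookup_add lookup_single when_def ac_simps)

lemma poly_diff_const [simp]: "poly_diff j (const c) = 0"
  by (simp add: const_def poly_diff_single)

lemma poly_diff_0 [simp]: "poly_diff j 0 = 0" and poly_diff_1 [simp]: "poly_diff j 1 = 0"
  using poly_diff_const[of j 0] poly_diff_const[of j 1] by simp_all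

lemma poly_diff_sum: "poly_diff j (\<Sum>i\<in>S. f i) = (\<Sum>i\<in>S. poly_diff j (f i))"
  by (induction S rule: infinite_finite_induct) (simp_all add: poly_diff_add)

lemma poly_diff_var: "poly_diff i (var j) = (if i = j then 1 else 0)"
  by (simp add: var_def monom_def poly_diff_single lookup_single when_def single_one)

lemma poly_diff_var_mult:
  "poly_diff i (var j * p) = (if i = j then p else 0) + var j * poly_diff i p"
proof (rule additive_eqI[where p = p])
  fix a :: "'a exps" and c
  show "poly_diff i (var j * single a c) =
          (if i = j then single a c else 0) + var j * poly_diff i (single a c)"
  \<comment> \<open>Subtraction of exponents is truncated: \<open>a - unit_exp i\<close> lowers the
    exponent only if \<open>i\<close> occurs in \<open>a\<close>; otherwise the factor
    \<open>lookup a i\<close> removes the term.\<close>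
  proof (cases "lookup a i = 0")
    case True
    then show ?thesis
      by (auto simp: var_def monom_def mult_single poly_diff_single lookup_add lookup_single when_def)
  next
    case False
    have 2: "unit_exp j + (a - unit_exp i) = unit_exp j + a - unit_exp i"
      by (rule poly_mapping_eqI) (use False in \<open>auto simp: lookup_add lookup_minus lookup_single when_def\<close>)
    show ?thesis
      by (auto simp: var_def monom_def mult_single poly_diff_single 2 lookup_add lookup_single
            when_def distrib_right single_add)
  qed
qed (simp_all add: poly_diff_add algebra_simps)

lemma poly_diff_mult: "poly_diff i (p * q) = poly_diff i p * q + p * poly_diff i q"
proof (induction p rule: cpoly_induct)
  case (const c)
  then show ?case by (simp add: cscale_eq_const_mult[symmetric] poly_diff_cscale)
next
  case (add p q)
  then show ?case by (simp add: poly_diff_add algebra_simps)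
next
  case (var_mult j p)
  then show ?case by (simp add: mult.assoc poly_diff_var_mult) (simp add: algebra_simps)
qed

section \<open>Polynomials in commuting operators\<close>

definition commuting :: "('v \<Rightarrow> 'm \<Rightarrow> 'm) \<Rightarrow> bool" where
  "commuting T \<longleftrightarrow> (\<forall>i j x. T i (T j x) = T j (T i x))"

context
  fixes T :: "'v \<Rightarrow> 'm \<Rightarrow> 'm"
  assumes comm: "commuting T"
begin

lemma funpow_commute_ops: "(T i ^^ k) ((T j ^^ l) x) = (T j ^^ l) ((T i ^^ k) x)"
proof -
  have 1: "T i ((T j ^^ l) x) = (T j ^^ l) (T i x)" for x i
  proof (induction l arbitrary: x)
    case (Suc l)
    have "T i ((T j ^^ Suc l) x) = T j (T i ((T j ^^ l) x))"
      using comm by (simp add: commuting_def)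
    then show ?case using Suc by simp
  qed simp
  show ?thesis by (induction k arbitrary: x) (simp_all add: 1)
qed

lemma comp_fun_commute_ops: "comp_fun_commute (\<lambda>j f. (T j ^^ e j) \<circ> f)"
  by unfold_locales (auto simp: fun_eq_iff funpow_commute_ops)

lemma op_monom_superset:
  assumes "finite S" "keys a \<subseteq> S"
  shows "op_monom T a = Finite_Set.fold (\<lambda>j f. (T j ^^ lookup a j) \<circ> f) id S"
proof -
  interpret comp_fun_commute "\<lambda>j f. (T j ^^ lookup a j) \<circ> f" by (rule comp_fun_commute_ops)
  let ?F = "Finite_Set.fold (\<lambda>j f. (T j ^^ lookup a j) \<circ> f) id"
  have "?F (keys a \<union> S') = ?F (keys a)" if "finite S'" "S' \<inter> keys a = {}" for S'
    using that
  proof (induction S' rule: finite_induct)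
    case (insert x S')
    then have "lookup a x = 0" by (auto simp: in_keys_iff)
    with insert show ?case by (simp del: comp_apply add: id_comp[unfolded id_def])
  qed simp
  from this[of "S - keys a"] assms show ?thesis
    by (simp add: op_monom_def Un_absorb1 Diff_Int_distrib2)
qed

lemma op_monom_0: "op_monom T 0 = id"
  by (simp add: op_monom_def)

text \<open>Replaces the fold by a recursion. Away from \<open>j\<close> the two exponents agree, so
  both folds share the part over \<open>keys a - {j}\<close> and differ by one application of
  \<open>T j\<close>.\<close>

lemma op_monom_unit_exp_add: "op_monom T (unit_exp j + a) x = T j (op_monom T a x)"
proof -
  define S where "S = keys a - {j}"
  let ?F = "\<lambda>a. Finite_Set.fold (\<lambda>j f. (T j ^^ lookup a j) \<circ> f) id"
  interpret A: comp_fun_commute "\<lambda>j f. (T j ^^ lookup a j) \<circ> f" by (rule comp_fun_commute_ops)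
  interpret B: comp_fun_commute "\<lambda>i f. (T i ^^ lookup (unit_exp j + a) i) \<circ> f"
    by (rule comp_fun_commute_ops)
  have fin: "finite S" "j \<notin> S" by (auto simp: S_def)
  have eq: "?F (unit_exp j + a) S = ?F a S"
    by (rule Finite_Set.fold_cong[OF B.comp_fun_commute_on_axioms A.comp_fun_commute_on_axioms])
       (use fin in \<open>auto simp: lookup_add lookup_single when_def\<close>)
  have "op_monom T (unit_exp j + a) = ?F (unit_exp j + a) (insert j S)"
    by (rule op_monom_superset) (auto simp: S_def keys_exps_add)
  also have "\<dots> = (T j ^^ lookup (unit_exp j + a) j) \<circ> ?F (unit_exp j + a) S"
    using fin by (rule B.fold_insert)
  also have "\<dots> = (T j ^^ (1 + lookup a j)) \<circ> ?F a S"
    by (simp only: eq) (simp only: lookup_add lookup_single_eq)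
  also have "\<dots> = T j \<circ> ?F a (insert j S)"
    using fin by (simp add: comp_assoc One_nat_def)
  also have "?F a (insert j S) = op_monom T a"
    by (rule op_monom_superset[symmetric]) (auto simp: S_def)
  finally show ?thesis by simp
qed

lemma op_monom_unit_exp: "op_monom T (unit_exp j) x = T j x"
  using op_monom_unit_exp_add[of j 0] by (simp add: op_monom_0)

lemma op_monom_add: "op_monom T (a + b) x = op_monom T a (op_monom T b x)"
  by (induction a rule: exps_induct) (simp_all add: op_monom_0 op_monom_unit_exp_add add.assoc)

end

lemma op_poly_add: "op_poly T (p + q) f = op_poly T p f + op_poly T q f"
  unfolding op_poly_def by (rule sum_keys_add) (simp_all add: cvs.scale_left_distrib)

lemma op_poly_single: "op_poly T (single a c) f = cscale c (op_monom T a f)"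
  unfolding op_poly_def by (rule sum_keys_single) simp

lemma op_poly_const: "op_poly T (const c) f = cscale c f"
  unfolding const_def by (simp add: op_poly_single op_monom_def)

context
  fixes T :: "'v \<Rightarrow> ('k \<Rightarrow>\<^sub>0 complex) \<Rightarrow> ('k \<Rightarrow>\<^sub>0 complex)"
  assumes comm: "commuting T"
    and add: "\<And>j x y. T j (x + y) = T j x + T j y"
    and scale: "\<And>j c x. T j (cscale c x) = cscale c (T j x)"
begin

lemma op_monom_lin_add: "op_monom T a (x + y) = op_monom T a x + op_monom T a y"
  by (induction a rule: exps_induct) (simp_all add: op_monom_0 op_monom_unit_exp_add comm add)

lemma op_monom_lin_cscale: "op_monom T a (cscale c x) = cscale c (op_monom T a x)"
  by (induction a rule: exps_induct) (simp_all add: op_monom_0 op_monom_unit_exp_add comm scale)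

lemma op_poly_var: "op_poly T (var j) f = T j f"
  unfolding var_def monom_def by (simp only: op_poly_single op_monom_unit_exp[OF comm]) simp

lemma op_poly_arg_add: "op_poly T p (x + y) = op_poly T p x + op_poly T p y"
  by (rule additive_eqI)
     (simp_all add: op_poly_add op_poly_single op_monom_lin_add cvs.scale_right_distrib)

lemma op_poly_arg_cscale: "op_poly T p (cscale c x) = cscale c (op_poly T p x)"
  by (rule additive_eqI)
     (simp_all add: op_poly_add op_poly_single op_monom_lin_cscale cvs.scale_right_distrib ac_simps)

lemma op_poly_mult: "op_poly T (p * q) f = op_poly T p (op_poly T q f)"
proof (rule additive_eqI[where p = p])
  fix a c
  show "op_poly T (single a c * q) f = op_poly T (single a c) (op_poly T q f)"
    by (rule additive_eqI[where p = q])
       (simp_all add: op_poly_add mult_single op_poly_single op_monom_add[OF comm] op_monom_lin_add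
         op_monom_lin_cscale cvs.scale_right_distrib distrib_left)
qed (simp_all add: op_poly_add algebra_simps)

end

lemma commuting_poly_diff: "commuting poly_diff"
  by (simp add: commuting_def poly_poly_diff_commuting_linearute)

lemmas poly_diff_commuting_linear = commuting_poly_diff poly_diff_add poly_diff_cscale

lemma diff_act_add: "diff_act (p + q) f = diff_act p f + diff_act q f"
  by (simp add: diff_act_def op_poly_add)

lemma diff_act_const: "diff_act (const c) f = cscale c f"
  by (simp add: diff_act_def op_poly_const)

lemma diff_act_0 [simp]: "diff_act 0 f = 0" and diff_act_1 [simp]: "diff_act 1 f = f"
  using diff_act_const[of 0 f] diff_act_const[of 1 f] by simp_all

lemma diff_act_var: "diff_act (var j) f = poly_diff j f"
  unfolding diff_act_def by (rule op_poly_var) (simp_all add: poly_diff_commuting_linear)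

text \<open>Polynomials in log x become a module over the commutative ring of operators; later
  computations take place in that ring.\<close>

lemma diff_act_mult: "diff_act (p * q) f = diff_act p (diff_act q f)"
  unfolding diff_act_def by (rule op_poly_mult) (simp_all add: poly_diff_commuting_linear)

lemma diff_act_arg_add: "diff_act p (f + g) = diff_act p f + diff_act p g"
  unfolding diff_act_def by (rule op_poly_arg_add) (simp_all add: poly_diff_commuting_linear)

lemma diff_act_arg_cscale: "diff_act p (cscale c f) = cscale c (diff_act p f)"
  unfolding diff_act_def by (rule op_poly_arg_cscale) (simp_all add: poly_diff_commuting_linear)

lemma diff_act_arg_0 [simp]: "diff_act p 0 = 0"
  using diff_act_arg_add[of p 0 0] by simp

lemma diff_act_sum: "diff_act (\<Sum>x\<in>S. p x) f = (\<Sum>x\<in>S. diff_act (p x) f)"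
  by (induction S rule: infinite_finite_induct) (simp_all add: diff_act_add)

lemma diff_act_arg_sum: "diff_act p (\<Sum>x\<in>S. f x) = (\<Sum>x\<in>S. diff_act p (f x))"
  by (induction S rule: infinite_finite_induct) (simp_all add: diff_act_arg_add)

lemma diff_act_commute: "diff_act p (diff_act q f) = diff_act q (diff_act p f)"
  by (simp add: diff_act_mult[symmetric] mult.commute)

section \<open>Degrees\<close>

lemma exp_deg_superset: "finite S \<Longrightarrow> keys a \<subseteq> S \<Longrightarrow> exp_deg a = (\<Sum>j\<in>S. lookup a j)"
  unfolding exp_deg_def by (intro sum.mono_neutral_left) (auto simp: in_keys_iff)

lemma exp_deg_add: "exp_deg (a + b) = exp_deg a + exp_deg b"
  by (simp add: exp_deg_superset[of "keys a \<union> keys b"] keys_exps_add lookup_add sum.distrib)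

lemma exp_deg_unit_exp [simp]: "exp_deg (unit_exp j) = 1"
  by (simp add: exp_deg_def)

lemma exp_deg_0 [simp]: "exp_deg 0 = 0"
  by (simp add: exp_deg_def)

lemma exp_deg_eq_0_iff: "exp_deg a = 0 \<longleftrightarrow> a = 0"
  by (induction a rule: exps_induct) (auto simp: exp_deg_add poly_mapping_eq_iff fun_eq_iff lookup_add
      lookup_single when_def)

definition deg_le :: "nat \<Rightarrow> 'v cpoly \<Rightarrow> bool" where
  "deg_le N f \<longleftrightarrow> (\<forall>a. N < exp_deg a \<longrightarrow> lookup f a = 0)"

lemma deg_le_iff: "deg_le N f \<longleftrightarrow> (\<forall>a\<in>keys f. exp_deg a \<le> N)"
  by (metis deg_le_def in_keys_iff not_le)

lemma ex_deg_le: "\<exists>N. deg_le N f"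
  unfolding deg_le_iff by (rule exI[of _ "Max (exp_deg ` keys f)"]) simp

lemma deg_le_mono: "deg_le N f \<Longrightarrow> N \<le> M \<Longrightarrow> deg_le M f"
  by (auto simp: deg_le_def)

lemma deg_le_poly_diff_Suc: "deg_le (Suc N) f \<Longrightarrow> deg_le N (poly_diff j f)"
  by (auto simp: deg_le_def lookup_poly_diff exp_deg_add)

lemma deg_le_poly_diff: "deg_le N f \<Longrightarrow> deg_le N (poly_diff j f)"
  by (rule deg_le_poly_diff_Suc) (auto intro: deg_le_mono)

lemma deg_le_0_poly_diff: "deg_le 0 f \<Longrightarrow> poly_diff j f = 0"
  by (rule poly_mapping_eqI) (auto simp: deg_le_def lookup_poly_diff exp_deg_add)

lemma deg_le_diff_act: "deg_le N f \<Longrightarrow> deg_le N (diff_act p f)"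
proof (induction p rule: cpoly_induct)
  case (const c)
  then show ?case by (simp add: diff_act_const deg_le_def lookup_cscale)
next
  case (add p q)
  then show ?case by (auto simp: diff_act_add deg_le_def lookup_add)
next
  case (var_mult j p)
  then show ?case by (auto simp: diff_act_mult diff_act_var intro: deg_le_poly_diff)
qed

text \<open>Local nilpotence of the derivations, the reason why truncated power series act like
  genuine ones.\<close>

lemma diff_act_var_power_eq_0: "deg_le N f \<Longrightarrow> diff_act (var j ^ Suc N) f = 0"
proof (induction N arbitrary: f)
  case 0
  then show ?case by (simp add: diff_act_var deg_le_0_poly_diff)
next
  case (Suc N)
  have "diff_act (var j ^ Suc N) (poly_diff j f) = 0"
    by (rule Suc.IH) (rule deg_le_poly_diff_Suc[OF Suc.prems])
  then show ?case
    by (simp only: power_Suc2[of _ "Suc N"] diff_act_mult diff_act_var)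
qed

text \<open>A truncated geometric series: \<open>c + var j = c (1 - x)\<close> with
  \<open>x = - var j / c\<close>, and the partial sum of the powers of \<open>x\<close> inverts
  \<open>1 - x\<close> up to \<open>x ^ N\<close>.\<close>

lemma const_add_var_inverse:
  assumes "c \<noteq> 0"
  shows "\<exists>Y R. (const c + var j) * Y = 1 + R * var j ^ N"
proof -
  define x where "x = - const (1 / c) * var j"
  have "const c + var j = const c * (1 - x)"
    using assms by (simp add: x_def distrib_left mult.assoc[symmetric] const_mult[symmetric])
  hence "(const c + var j) * (const (1 / c) * (\<Sum>k<N. x ^ k)) = (const c * const (1 / c)) * ((1 - x) * (\<Sum>k<N. x ^ k))"
    by (simp only: ac_simps)
  also have "\<dots> = 1 - x ^ N"
    using assms by (simp add: const_mult[symmetric] one_diff_power_eq[symmetric])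
  also have "\<dots> = 1 + (- ((- const (1 / c)) ^ N)) * var j ^ N"
    by (simp only: x_def power_mult_distrib) simp
  finally show ?thesis by blast
qed

lemma diff_act_const_add_var_inj:
  assumes "c \<noteq> 0" "diff_act (const c + var j) f = 0"
  shows "f = 0"
proof -
  obtain N where N: "deg_le N f" using ex_deg_le by blast
  obtain Y R where "(const c + var j) * Y = 1 + R * var j ^ Suc N"
    using const_add_var_inverse[OF assms(1)] by metis
  hence "diff_act (Y * (const c + var j)) f = diff_act (1 + R * var j ^ Suc N) f"
    by (simp add: mult.commute)
  then show ?thesis
    by (simp only: diff_act_mult assms(2))
       (simp add: diff_act_mult diff_act_add diff_act_var_power_eq_0[OF N] del: power_Suc)
qed

text \<open>The constant is \<open>(b + a)! / b!\<close>. It does not depend on \<open>f\<close>,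
  and being nonzero it lets the coefficients of \<open>f\<close> be recovered from constant terms of
  its derivatives.\<close>

lemma lookup_diff_act_monom:
  "\<exists>c::nat. c > 0 \<and> (\<forall>f. lookup (diff_act (monom a) f) b = of_nat c * lookup f (b + a))"
proof (induction a rule: exps_induct)
  case zero
  show ?case by (intro exI[of _ 1]) simp
next
  case (add j a)
  then obtain c where c: "c > 0" "\<And>f. lookup (diff_act (monom a) f) b = of_nat c * lookup f (b + a)"
    by blast
  have "lookup (diff_act (monom (unit_exp j + a)) f) b =
      of_nat (c * (lookup (b + a) j + 1)) * lookup f (b + (unit_exp j + a))" for f
  proof -
    have "lookup (diff_act (monom (unit_exp j + a)) f) b = lookup (diff_act (monom a) (poly_diff j f)) b"
      unfolding monom_unit_exp_add mult.commute[of "var j"] by (simp only: diff_act_mult diff_act_var)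
    then show ?thesis by (simp add: c(2) lookup_poly_diff ac_simps)
  qed
  moreover have "c * (lookup (b + a) j + 1) > 0" using c by simp
  ultimately show ?case by blast
qed

lemma diff_act_single: "diff_act (single a c) f = cscale c (diff_act (monom a) f)"
  by (simp add: single_eq_const_mult diff_act_mult diff_act_const)

lemma diff_act_eq_sum: "diff_act p f = (\<Sum>a\<in>keys p. cscale (lookup p a) (diff_act (monom a) f))"
  by (simp add: diff_act_def op_poly_def op_poly_single monom_def)

text \<open>This is the Fischer pairing: distinct monomials are orthogonal, and the monomial with
  exponent \<open>a\<close> has square \<open>a!\<close>.\<close>

lemma diff_act_pairing_symmetric:
  fixes p q :: "'v cpoly"
  shows "lookup (diff_act p q) 0 = lookup (diff_act q p) 0"
proof (rule additive_eqI[where p = p])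
  fix a :: "'v exps" and c
  show "lookup (diff_act (single a c) q) 0 = lookup (diff_act q (single a c)) 0"
  proof (rule additive_eqI[where p = q])
    fix b :: "'v exps" and d
    obtain k :: nat where k: "\<And>f. lookup (diff_act (monom a) f) 0 = of_nat k * lookup f (0 + a)"
      using lookup_diff_act_monom[of a 0] by blast
    obtain l :: nat where l: "\<And>f. lookup (diff_act (monom b) f) 0 = of_nat l * lookup f (0 + b)"
      using lookup_diff_act_monom[of b 0] by blast
    show "lookup (diff_act (single a c) (single b d)) 0 = lookup (diff_act (single b d) (single a c)) 0"
    proof (cases "a = b")
      case True
      \<comment> \<open>The two constants come from separate existence statements; testing both on
        the same monomial identifies them.\<close>
      have "of_nat k = (of_nat l :: complex)" using k[of "monom a"] l[of "monom a"] True
        by (simp add: lookup_monom)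
      then show ?thesis using True
        by (simp add: diff_act_single lookup_cscale k l lookup_single)
    qed (simp add: diff_act_single lookup_cscale k l lookup_single)
  qed (simp_all add: diff_act_add diff_act_arg_add lookup_add)
qed (simp_all add: diff_act_add diff_act_arg_add lookup_add)

lemma diff_act_poly_ring: "f \<in> poly_ring V \<Longrightarrow> diff_act p f \<in> poly_ring V"
proof (induction p rule: cpoly_induct)
  case (const c)
  then show ?case by (simp add: diff_act_const cscale_eq_const_mult poly_ring_mult)
next
  case (add p q)
  then show ?case by (auto simp: diff_act_add intro: poly_ring_add)
next
  case (var_mult j p)
  have "keys a \<subseteq> V" if "a \<in> keys (poly_diff j (diff_act p f))" for a
  proof -
    have "a + unit_exp j \<in> keys (diff_act p f)" using that
      by (auto simp: in_keys_iff lookup_poly_diff)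
    with var_mult show ?thesis by (fastforce simp: poly_ring_def keys_exps_add)
  qed
  then show ?case by (simp add: diff_act_mult diff_act_var poly_ring_def)
qed

section \<open>Homogeneous components\<close>

definition homog :: "nat \<Rightarrow> 'v cpoly \<Rightarrow> bool" where
  "homog n p \<longleftrightarrow> (\<forall>a\<in>keys p. exp_deg a = n)"

lemma lookup_hom_comp: "lookup (hom_comp n p) a = (if exp_deg a = n then lookup p a else 0)"
proof -
  have "lookup (hom_comp n p) a = (\<Sum>b\<in>{b \<in> keys p. exp_deg b = n}. if b = a then lookup p b else 0)"
    by (simp add: hom_comp_def lookup_sum lookup_single when_def)
  also have "\<dots> = (if exp_deg a = n then lookup p a else 0)"
    by (subst sum.delta) (auto simp: in_keys_iff)
  finally show ?thesis .
qed

lemma hom_comp_add: "hom_comp n (p + q) = hom_comp n p + hom_comp n q"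
  by (rule poly_mapping_eqI) (simp add: lookup_hom_comp lookup_add)

lemma hom_comp_homog: "homog n p \<Longrightarrow> hom_comp m p = (if m = n then p else 0)"
  by (rule poly_mapping_eqI) (auto simp: lookup_hom_comp homog_def in_keys_iff)

lemma homog_hom_comp: "homog n (hom_comp n p)"
  by (auto simp: homog_def in_keys_iff lookup_hom_comp split: if_splits)

lemma hom_part_iff: "p \<in> hom_part V n \<longleftrightarrow> p \<in> V \<and> homog n p"
  by (simp add: hom_part_def homog_def)

lemma homog_0 [simp]: "homog n 0" by (simp add: homog_def)

lemma homog_1 [simp]: "homog 0 1" by (simp add: homog_def exp_deg_def flip: monom_0)

lemma homog_add: "homog n p \<Longrightarrow> homog n q \<Longrightarrow> homog n (p + q)"
  using keys_add[of p q] by (auto simp: homog_def)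

lemma homog_mult: "homog n p \<Longrightarrow> homog m q \<Longrightarrow> homog (n + m) (p * q)"
  using keys_mult[of p q] by (force simp: homog_def exp_deg_add)

lemma homog_const_mult: "homog n p \<Longrightarrow> homog n (const c * p)"
  by (auto simp: homog_def in_keys_iff lookup_cscale simp flip: cscale_eq_const_mult)

lemma homog_var: "homog 1 (var j)"
  by (simp add: homog_def var_def)

lemma homog_sum: "(\<And>x. x \<in> S \<Longrightarrow> homog n (f x)) \<Longrightarrow> homog n (\<Sum>x\<in>S. f x)"
  by (induction S rule: infinite_finite_induct) (auto intro: homog_add)

lemma homog_prod: "(\<And>x. x \<in> S \<Longrightarrow> homog (n x) (f x)) \<Longrightarrow> homog (\<Sum>x\<in>S. n x) (\<Prod>x\<in>S. f x)"
  by (induction S rule: infinite_finite_induct) (auto intro: homog_mult)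

lemma homog_power: "homog n p \<Longrightarrow> homog (k * n) (p ^ k)"
  by (induction k) (auto intro: homog_mult)

lemma homog_lin_form: "homog 1 (lin_form a)"
  unfolding lin_form_def by (intro homog_sum homog_const_mult homog_var)

lemma poly_subst_homog_single:
  assumes "\<And>j. homog 1 (x j)"
  shows "homog (exp_deg a) (poly_subst x (single a c))"
proof -
  have "homog (\<Sum>j\<in>keys a. lookup a j * 1) (\<Prod>j\<in>keys a. x j ^ lookup a j)"
    by (intro homog_prod homog_power assms)
  then show ?thesis by (simp add: poly_subst_single exp_deg_def homog_const_mult)
qed

lemma hom_comp_poly_subst:
  assumes "\<And>j. homog 1 (x j)"
  shows "hom_comp n (poly_subst x p) = poly_subst x (hom_comp n p)"
proof (rule additive_eqI[where p = p])
  fix a c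
  show "hom_comp n (poly_subst x (single a c)) = poly_subst x (hom_comp n (single a c))"
  proof -
    have "homog (exp_deg a) (single a c)" by (simp add: homog_def)
    then show ?thesis using poly_subst_homog_single[of x a c] assms by (simp add: hom_comp_homog)
  qed
qed (simp_all add: poly_subst_add hom_comp_add)

text \<open>A homogeneous operator of degree \<open>n\<close> lowers degrees by exactly
  \<open>n\<close>, so if it annihilates \<open>f\<close> it annihilates each homogeneous
  component.\<close>

lemma lookup_diff_act_hom_comp:
  assumes "homog n p"
  shows "lookup (diff_act p (hom_comp q f)) b = (if exp_deg b + n = q then lookup (diff_act p f) b else 0)"
proof -
  have "lookup p a * lookup (diff_act (monom a) (hom_comp q f)) b =
      (if exp_deg b + n = q then lookup p a * lookup (diff_act (monom a) f) b else 0)" if "a \<in> keys p" for a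
  proof -
    obtain c :: nat where c: "\<And>f. lookup (diff_act (monom a) f) b = of_nat c * lookup f (b + a)"
      using lookup_diff_act_monom[of a b] by blast
    show ?thesis using that assms by (auto simp: c lookup_hom_comp exp_deg_add homog_def)
  qed
  then show ?thesis
    by (subst (1 2) diff_act_eq_sum) (simp add: lookup_sum lookup_cscale)
qed

section \<open>The Frobenius data\<close>

lemma poly_diff_lin_form: "poly_diff i (lin_form b) = const (of_int (b $ i))"
proof -
  have "poly_diff i (lin_form b) = (\<Sum>j\<in>UNIV. if i = j then const (of_int (b $ j)) else 0)"
    by (simp add: lin_form_def poly_diff_sum poly_diff_cscale poly_diff_var
        flip: cscale_eq_const_mult) (simp add: cscale_eq_const_mult if_distrib cong: if_cong)
  then show ?thesis by simp
qed

lemma diff_act_lin_form: "diff_act (lin_form a) f = (\<Sum>j\<in>UNIV. const (of_int (a $ j)) * poly_diff j f)"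
  by (simp add: lin_form_def diff_act_sum diff_act_mult diff_act_const diff_act_var cscale_eq_const_mult)

lemma diff_act_Bs: "diff_act (Bs B j) f = (\<Sum>k<length B. const (of_int (B ! k $ j)) * poly_diff k f)"
  by (simp add: Bs_def diff_act_sum diff_act_mult diff_act_const diff_act_var cscale_eq_const_mult)

lemma diff_act_arg_diff: "diff_act p (f - g) = diff_act p f - diff_act p g"
  using diff_act_arg_add[of p "f - g" g] by simp

lemma diff_act_Bs_mult: "diff_act (Bs B j) (f * g) = diff_act (Bs B j) f * g + f * diff_act (Bs B j) g"
  by (simp add: diff_act_Bs poly_diff_mult sum_distrib_left sum_distrib_right algebra_simps
      flip: sum.distrib)

lemma diff_act_Bs_var: "k < length B \<Longrightarrow> diff_act (Bs B j) (var k) = const (of_int (B ! k $ j))"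
  by (simp add: diff_act_Bs poly_diff_var if_distrib cong: if_cong)

lemma lambda_B_simps:
  "lambda_B B (p + q) = lambda_B B p + lambda_B B q"
  "lambda_B B (p * q) = lambda_B B p * lambda_B B q"
  "lambda_B B (const c) = const c"
  "lambda_B B (var k) = lin_form (B ! k)"
  "lambda_B B 0 = 0" "lambda_B B 1 = 1"
  "lambda_B B (cscale c p) = cscale c (lambda_B B p)"
  by (simp_all add: lambda_B_def poly_subst_add poly_subst_mult poly_subst_cscale)

text \<open>The chain rule: the variable \<open>j\<close> enters \<open>lambda_B B q\<close> only
  through the forms \<open>lin_form (B ! k)\<close>, with coefficient
  \<open>B ! k $ j\<close>.\<close>

lemma poly_diff_lambda_B:
  assumes "q \<in> s_ring B"
  shows "poly_diff j (lambda_B B q) = lambda_B B (diff_act (Bs B j) q)"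
  using assms unfolding s_ring_def
proof (induction q rule: poly_ring_induct)
  case (const c)
  then show ?case by (simp add: lambda_B_simps diff_act_Bs)
next
  case (add p q)
  then show ?case by (simp add: lambda_B_simps diff_act_arg_add poly_diff_add)
next
  case (var_mult k p)
  then show ?case
    by (simp add: lambda_B_simps poly_diff_mult poly_diff_lin_form diff_act_Bs_mult diff_act_Bs_var)
qed

lemma diff_act_lambda_B:
  assumes "q \<in> s_ring B"
  shows "diff_act p (lambda_B B q) = lambda_B B (diff_act (poly_subst (Bs B) p) q)"
proof (induction p rule: cpoly_induct)
  case (const c)
  then show ?case by (simp add: diff_act_const lambda_B_simps)
next
  case (add p q)
  then show ?case by (simp add: lambda_B_simps diff_act_add poly_subst_add)
next
  case (var_mult j p)
  have "diff_act (poly_subst (Bs B) p) q \<in> s_ring B"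
    using assms by (simp add: s_ring_def diff_act_poly_ring)
  with var_mult show ?case
    by (simp add: diff_act_mult diff_act_var poly_subst_mult poly_diff_lambda_B)
qed

text \<open>Integration by parts: if \<open>\<delta> x = 1\<close> then
  \<open>x^k f = \<delta> (x^(k+1) f / (k+1)) - x^(k+1) \<delta> f / (k+1)\<close>, and \<open>\<delta>\<close> is locally nilpotent.\<close>

lemma diff_act_Bs_antiderivative:
  assumes k: "k < length B" "B ! k $ j \<noteq> 0" and f: "f \<in> s_ring B" "deg_le N f"
  shows "\<exists>g\<in>s_ring B. diff_act (Bs B j) g = f"
proof -
  let ?\<delta> = "diff_act (Bs B j)"
  define x where "x = const (1 / of_int (B ! k $ j)) * var k"
  have x: "x \<in> s_ring B" using k by (auto simp: x_def s_ring_def intro!: poly_ring_mult poly_ring_var)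
  have dx: "?\<delta> x = 1"
    using k by (simp add: x_def diff_act_arg_cscale diff_act_Bs_var flip: cscale_eq_const_mult)
       (simp add: cscale_eq_const_mult flip: const_mult)
  have dpow: "?\<delta> (x ^ Suc n) = const (of_nat (Suc n)) * x ^ n" for n
  proof (induction n)
    case (Suc n)
    have "?\<delta> (x ^ Suc (Suc n)) = x ^ Suc n + x * ?\<delta> (x ^ Suc n)"
      by (subst power_Suc) (simp only: diff_act_Bs_mult dx mult_1)
    also have "\<dots> = x ^ Suc n + const (of_nat (Suc n)) * x ^ Suc n"
      unfolding Suc by (simp add: ac_simps)
    also have "\<dots> = const (of_nat (Suc (Suc n))) * x ^ Suc n"
      by (simp only: of_nat_Suc[of "Suc n"] const_add distrib_right const_1 mult_1)
    finally show ?case .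
  qed (simp add: dx)
  have pow: "x ^ n \<in> s_ring B" for n
    using x by (induction n) (auto simp: s_ring_def intro: poly_ring_mult)
  \<comment> \<open>The power \<open>x ^ n\<close> is there for the induction: each integration by
    parts trades one order of nilpotency \<open>M\<close> for one more factor \<open>x\<close>. Only
    \<open>n = 0\<close> is wanted in the end.\<close>
  have "\<exists>g\<in>s_ring B. ?\<delta> g = x ^ n * f" if "(?\<delta> ^^ M) f = 0" for M n
    using that f(1)
  proof (induction M arbitrary: f n)
    case 0
    then show ?case by (intro bexI[of _ 0]) (auto simp: s_ring_def)
  next
    case (Suc M)
    have "?\<delta> f \<in> s_ring B" using Suc.prems by (simp add: s_ring_def diff_act_poly_ring)
    moreover have "(?\<delta> ^^ M) (?\<delta> f) = 0" using Suc.prems by (simp add: funpow_swap1)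
    ultimately obtain g where g: "g \<in> s_ring B" "?\<delta> g = x ^ Suc n * ?\<delta> f" using Suc.IH by blast
    define c where "c = (1 / of_nat (Suc n) :: complex)"
    have cc: "c * of_nat (Suc n) = 1" by (simp add: c_def del: of_nat_Suc)
    define h where "h = const c * (x ^ Suc n * f + const (- 1) * g)"
    have "?\<delta> h = const c * (?\<delta> (x ^ Suc n) * f + x ^ Suc n * ?\<delta> f - ?\<delta> g)"
      by (simp only: h_def flip: cscale_eq_const_mult)
         (simp add: diff_act_arg_cscale diff_act_arg_diff diff_act_Bs_mult del: power_Suc)
    also have "\<dots> = const (c * of_nat (Suc n)) * (x ^ n * f)"
      unfolding dpow g(2) const_mult by (simp only: ac_simps add_diff_cancel_left' add_diff_cancel_right')
    also have "\<dots> = x ^ n * f" by (simp only: cc) simp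
    finally have "?\<delta> h = x ^ n * f" .
    moreover have "h \<in> s_ring B" using g(1) Suc.prems(2) pow[of "Suc n"]
      unfolding h_def s_ring_def by (intro poly_ring_mult poly_ring_add poly_ring_const)
    ultimately show ?case by blast
  qed
  moreover have "(?\<delta> ^^ Suc N) f = 0"
  proof -
    have lower: "deg_le N' (?\<delta> f)" if "deg_le (Suc N') f" for N' f
      using deg_le_poly_diff_Suc[OF that]
      by (auto simp: diff_act_Bs deg_le_def lookup_sum lookup_cscale simp flip: cscale_eq_const_mult)
    have zero: "?\<delta> f = 0" if "deg_le 0 f" for f
      using that by (simp add: diff_act_Bs deg_le_0_poly_diff)
    show ?thesis using f(2)
    proof (induction N arbitrary: f)
      case (Suc N)
      then show ?case using Suc.IH[OF lower[OF Suc.prems]] by (simp add: funpow_swap1)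
    qed (simp add: zero)
  qed
  ultimately have "\<exists>g\<in>s_ring B. ?\<delta> g = x ^ 0 * f" by blast
  then show ?thesis by simp
qed

text \<open>Integrates one linear form at a time; a nonzero form is a surjective derivation. This is
  what solves the equation with \<open>m_poly\<close> on the left.\<close>

lemma diff_act_Bs_prod_surj:
  assumes "finite F" "\<And>j. j \<in> F \<Longrightarrow> \<exists>k<length B. B ! k $ j \<noteq> 0" "f \<in> s_ring B"
  shows "\<exists>g\<in>s_ring B. diff_act (Bs_prod B F) g = f"
  using assms
proof (induction F arbitrary: f rule: finite_induct)
  case empty
  then show ?case by (simp add: Bs_prod_def)
next
  case (insert j F)
  obtain N where "deg_le N f" using ex_deg_le by blast
  then obtain f' where f': "f' \<in> s_ring B" "diff_act (Bs B j) f' = f"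
    using insert.prems diff_act_Bs_antiderivative by blast
  moreover obtain g where "g \<in> s_ring B" "diff_act (Bs_prod B F) g = f'"
    using insert.IH[of f'] insert.prems f' by blast
  ultimately show ?case using insert.hyps by (auto simp: Bs_prod_def diff_act_mult)
qed

section \<open>The lattice of relations\<close>

text \<open>\<open>rows A\<close> is a set, so equal rows would be merged. A set of at most
  \<open>CARD('d)\<close> rows with that dimension has full cardinality, which makes the rows
  distinct as well as independent.\<close>

lemma full_row_rank_right_inverse:
  fixes A :: "'a::field^'n^'d"
  assumes "rank A = CARD('d)"
  shows "\<exists>Y. A ** Y = mat 1"
proof -
  have fin: "finite (rows A)" by (simp add: rows_def full_SetCompr_eq)
  have img: "rows A = (\<lambda>i. row i A) ` UNIV" by (auto simp: rows_def)
  have dim: "vec.dim (rows A) = CARD('d)" using assms by (simp add: row_rank_def_gen)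
  have "vec.dim (rows A) \<le> card (rows A)" by (rule vec.dim_le_card'[OF fin])
  moreover have "card (rows A) \<le> CARD('d)" unfolding img by (rule card_image_le) simp
  ultimately have card: "card (rows A) = CARD('d)" using dim by simp
  hence inj: "inj (\<lambda>i. row i A)" unfolding img by (simp add: eq_card_imp_inj_on)
  have ind: "vec.independent (rows A)"
    by (rule vec.card_le_dim_spanning[of "rows A" "rows A"])
       (auto simp: fin card dim intro: vec.span_base)
  have "\<forall>i. c i = 0" if c: "(\<Sum>i\<in>UNIV. c i *s row i A) = 0" for c
  proof
    fix i
    \<comment> \<open>Coefficients indexed by row numbers are transported to the set of
      rows.\<close>
    define c' where "c' = (\<lambda>r. c (the_inv (\<lambda>i. row i A) r))"
    have "(\<Sum>r\<in>rows A. c' r *s r) = (\<Sum>i\<in>UNIV. c i *s row i A)"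
      unfolding img by (subst sum.reindex[OF inj]) (simp add: c'_def the_inv_f_f[OF inj])
    hence "c' (row i A) = 0"
      using vec.independentD[OF ind fin order_refl, of c' "row i A"] c by (auto simp: rows_def)
    then show "c i = 0" by (simp add: c'_def the_inv_f_f[OF inj])
  qed
  then show ?thesis unfolding matrix_right_invertible_independent_rows by blast
qed

lemma common_denominator:
  fixes f :: "'a \<Rightarrow> rat"
  assumes "finite S"
  shows "\<exists>N::int. N > 0 \<and> (\<forall>a\<in>S. \<exists>z::int. of_int N * f a = of_int z)"
  using assms
proof (induction S rule: finite_induct)
  case empty
  show ?case by (intro exI[of _ 1]) simp
next
  case (insert x S)
  then obtain N :: int where N: "N > 0" "\<forall>a\<in>S. \<exists>z::int. of_int N * f a = of_int z" by blast
  obtain p q where pq: "quotient_of (f x) = (p, q)" by (rule prod.exhaust)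
  have q: "q > 0" using quotient_of_denom_pos[OF pq] .
  have fx: "f x = of_int p / of_int q" using quotient_of_div[OF pq] .
  have "\<exists>z::int. of_int (N * q) * f a = of_int z" if "a \<in> insert x S" for a
  proof (cases "a = x")
    case True
    then show ?thesis using q by (intro exI[of _ "N * p"]) (simp add: fx)
  next
    case False
    with that N(2) obtain z :: int where "of_int N * f a = of_int z" by blast
    hence "of_int q * (of_int N * f a) = of_int (q * z)" by simp
    hence "of_int (N * q) * f a = of_int (q * z)" by (simp only: of_int_mult ac_simps)
    then show ?thesis by blast
  qed
  moreover have "N * q > 0" using N(1) q by simp
  ultimately show ?case by blast
qed

lemma int_basis_mem:
  assumes "int_basis B L" "k < length B"
  shows "B ! k \<in> L"
proof -
  have "(\<Sum>l<length B. (if l = k then 1 else 0) *s B ! l) = B ! k"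
    using assms(2) by (simp add: if_distrib[of "\<lambda>c. c *s _"] cong: if_cong)
  hence "B ! k \<in> {(\<Sum>k<length B. c k *s B ! k) |c. True}"
    by (intro CollectI exI[of _ "\<lambda>l. if l = k then 1 else 0"]) simp
  then show ?thesis using assms(1) by (simp only: int_basis_def)
qed

text \<open>Up to the factor \<open>N\<close> the identity of \<open>\<int>\<^sup>n\<close> splits into a part factoring through \<open>A\<close> and a part
  factoring through the lattice spanned by \<open>B\<close>.\<close>

lemma lattice_splitting:
  fixes A :: "int^'n^'d"
  assumes rank: "rank (map_matrix of_int A :: rat^'n^'d) = CARD('d)"
    and B: "int_basis B (int_ker A)"
  obtains N :: int and Z :: "'n \<Rightarrow> 'd \<Rightarrow> int" and c :: "nat \<Rightarrow> 'n \<Rightarrow> int" where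
    "N > 0"
    "\<And>j' j. (if j' = j then N else 0) =
       (\<Sum>i\<in>UNIV. Z j' i * A $ i $ j) + (\<Sum>k<length B. c k j * B ! k $ j')"
    "\<And>k l. k < length B \<Longrightarrow> l < length B \<Longrightarrow>
       (\<Sum>j\<in>UNIV. c k j * B ! l $ j) = (if k = l then N else 0)"
proof -
  \<comment> \<open>\<open>N\<close> clears the denominators of a rational right inverse
    \<open>Y\<close>, and \<open>Z = N Y\<close> is an integer matrix with
    \<open>A Z = N\<close>.\<close>
  obtain Y :: "rat^'d^'n" where Y: "map_matrix of_int A ** Y = mat 1"
    using full_row_rank_right_inverse[OF rank] by blast
  obtain N :: int where N: "N > 0" "\<forall>a\<in>UNIV. \<exists>z::int. of_int N * (case a of (j, i) \<Rightarrow> Y $ j $ i) = of_int z"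
    using common_denominator[OF finite_class.finite_UNIV] by blast
  hence "\<forall>a. \<exists>z::int. of_int N * (case a of (j, i) \<Rightarrow> Y $ j $ i) = of_int z" by simp
  then obtain Z :: "'n \<times> 'd \<Rightarrow> int" where
    Z': "\<forall>a. of_int N * (case a of (j, i) \<Rightarrow> Y $ j $ i) = of_int (Z a)" by (rule choice[THEN exE])
  have Z: "of_int (Z (j, i)) = of_int N * Y $ j $ i" for j i using Z'[rule_format, of "(j, i)"] by simp
  have AZ: "(\<Sum>j\<in>UNIV. A $ i $ j * Z (j, i')) = (if i = i' then N else 0)" for i i'
  proof -
    have "(of_int (\<Sum>j\<in>UNIV. A $ i $ j * Z (j, i')) :: rat) = of_int N * (\<Sum>j\<in>UNIV. of_int (A $ i $ j) * Y $ j $ i')"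
      by (simp add: Z sum_distrib_left ac_simps)
    also have "(\<Sum>j\<in>UNIV. of_int (A $ i $ j) * Y $ j $ i') = (map_matrix of_int A ** Y) $ i $ i'"
      by (simp add: matrix_matrix_mult_def map_matrix_def)
    also have "\<dots> = (if i = i' then 1 else 0)" by (simp add: Y mat_def)
    finally have "(of_int (\<Sum>j\<in>UNIV. A $ i $ j * Z (j, i')) :: rat) = of_int (if i = i' then N else 0)"
      by simp
    then show ?thesis by (simp only: of_int_eq_iff)
  qed
  \<comment> \<open>Column \<open>j\<close> of \<open>N - Z A\<close>. Since \<open>A Z = N\<close>,
    the matrix \<open>A\<close> kills it, so it is an integer combination of
    \<open>B\<close>.\<close>
  define E where "E j = (\<chi> j'. (if j' = j then N else 0) - (\<Sum>i\<in>UNIV. Z (j', i) * A $ i $ j))" for j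
  have E: "E j \<in> int_ker A" for j
  proof -
    have "(A *v E j) $ i = 0" for i
    proof -
      have "(A *v E j) $ i = (\<Sum>j'\<in>UNIV. A $ i $ j' * (if j' = j then N else 0)) -
          (\<Sum>j'\<in>UNIV. \<Sum>i'\<in>UNIV. A $ i $ j' * Z (j', i') * A $ i' $ j)"
        by (simp add: matrix_vector_mult_def E_def right_diff_distrib sum_subtractf sum_distrib_left ac_simps)
      also have "(\<Sum>j'\<in>UNIV. \<Sum>i'\<in>UNIV. A $ i $ j' * Z (j', i') * A $ i' $ j) =
          (\<Sum>i'\<in>UNIV. (\<Sum>j'\<in>UNIV. A $ i $ j' * Z (j', i')) * A $ i' $ j)"
        by (subst sum.swap) (simp add: sum_distrib_right)
      also have "\<dots> = N * A $ i $ j"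
        by (simp add: AZ if_distrib[of "\<lambda>x. x * _"] cong: if_cong)
      finally show ?thesis by (simp add: if_distrib cong: if_cong)
    qed
    then show ?thesis by (simp add: int_ker_def vec_eq_iff)
  qed
  have "\<exists>c. E j = (\<Sum>k<length B. c k *s B ! k)" for j
    using E[of j] B by (auto simp: int_basis_def)
  then obtain c where c: "\<And>j. E j = (\<Sum>k<length B. c j k *s B ! k)" by metis
  have main: "(if j' = j then N else 0) =
       (\<Sum>i\<in>UNIV. Z (j', i) * A $ i $ j) + (\<Sum>k<length B. c j k * B ! k $ j')" for j' j
    using arg_cong[OF c[of j], of "\<lambda>x. x $ j'"] by (simp add: E_def)
  \<comment> \<open>The splitting applied to \<open>B ! l\<close>, which \<open>A\<close> kills,
    writes \<open>N\<close> times \<open>B ! l\<close> in terms of \<open>B\<close>; independence of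
    \<open>B\<close> leaves one choice of coefficients.\<close>
  have dual: "(\<Sum>j\<in>UNIV. c j k * B ! l $ j) = (if k = l then N else 0)"
    if kl: "k < length B" "l < length B" for k l
  proof -
    define d where "d k = (\<Sum>j\<in>UNIV. c j k * B ! l $ j)" for k
    have Al: "(\<Sum>j\<in>UNIV. A $ i $ j * B ! l $ j) = 0" for i
      using int_basis_mem[OF B kl(2)] by (auto simp: int_ker_def vec_eq_iff matrix_vector_mult_def)
    have eq: "N * B ! l $ j' = (\<Sum>k<length B. d k * B ! k $ j')" for j'
    proof -
      have "N * B ! l $ j' = (\<Sum>j\<in>UNIV. (if j' = j then N else 0) * B ! l $ j)"
        by (simp add: if_distrib[of "\<lambda>x. x * _"] cong: if_cong)
      also have "\<dots> = (\<Sum>j\<in>UNIV. \<Sum>i\<in>UNIV. Z (j', i) * A $ i $ j * B ! l $ j) +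
          (\<Sum>j\<in>UNIV. \<Sum>k<length B. c j k * B ! k $ j' * B ! l $ j)"
        unfolding main by (simp add: distrib_right sum.distrib sum_distrib_right)
      also have "(\<Sum>j\<in>UNIV. \<Sum>i\<in>UNIV. Z (j', i) * A $ i $ j * B ! l $ j) =
          (\<Sum>i\<in>UNIV. Z (j', i) * (\<Sum>j\<in>UNIV. A $ i $ j * B ! l $ j))"
        by (subst sum.swap) (simp add: sum_distrib_left ac_simps)
      also have "\<dots> = 0" by (simp add: Al)
      also have "(\<Sum>j\<in>UNIV. \<Sum>k<length B. c j k * B ! k $ j' * B ! l $ j) = (\<Sum>k<length B. d k * B ! k $ j')"
        by (subst sum.swap) (simp add: d_def sum_distrib_left sum_distrib_right ac_simps)
      finally show ?thesis by simp
    qed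
    have "(\<Sum>k<length B. (d k - (if k = l then N else 0)) *s B ! k) = 0"
    proof -
      have "(\<Sum>k<length B. (if k = l then N else 0) * B ! k $ j') = N * B ! l $ j'" for j'
        using kl(2) by (simp add: if_distrib[of "\<lambda>x. x * _"] cong: if_cong)
      then show ?thesis
        by (simp add: vec_eq_iff left_diff_distrib sum_subtractf eq)
    qed
    hence "\<forall>k<length B. d k - (if k = l then N else 0) = 0"
      using conjunct2[OF B[unfolded int_basis_def], rule_format,
          of "\<lambda>k. d k - (if k = l then N else 0)"] by simp
    hence "d k - (if k = l then N else 0) = 0" using kl(1) by blast
    then show ?thesis by (simp add: d_def)
  qed
  show ?thesis using that[of N "\<lambda>j i. Z (j, i)" "\<lambda>k j. c j k"] N(1) main dual by blast
qed

section \<open>Injectivity and image of \<open>lambda_B\<close>\<close>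

lemma poly_eval_poly_subst: "poly_eval x (poly_subst y p) = poly_eval (\<lambda>j. poly_eval x (y j)) p"
  by (induction p rule: cpoly_induct) (simp_all add: poly_subst_add poly_subst_mult poly_eval_add poly_eval_mult)

lemma lookup_lambda_B_0: "lookup (lambda_B B p) 0 = lookup p 0"
  by (simp add: lambda_B_def poly_eval_poly_subst lin_form_def poly_eval_sum poly_eval_mult
      flip: poly_eval_zero_point)

text \<open>The kernel is closed under the derivatives by the variables of \<open>s_ring B\<close>,
  and \<open>lambda_B\<close> preserves constant terms. So every derivative of a kernel element has
  constant term 0, which forces all its coefficients to vanish.\<close>

lemma lambda_B_inj:
  fixes A :: "int^'n^'d"
  assumes rank: "rank (map_matrix of_int A :: rat^'n^'d) = CARD('d)"
    and B: "int_basis B (int_ker A)"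
    and q: "q \<in> s_ring B" "lambda_B B q = 0"
  shows "q = 0"
proof (rule lattice_splitting[OF rank B])
  fix N :: int and Z :: "'n \<Rightarrow> 'd \<Rightarrow> int" and c :: "nat \<Rightarrow> 'n \<Rightarrow> int"
  assume N: "N > 0" and dual: "\<And>k l. k < length B \<Longrightarrow> l < length B \<Longrightarrow>
       (\<Sum>j\<in>UNIV. c k j * B ! l $ j) = (if k = l then N else 0)"
  have diff: "lambda_B B (poly_diff k p) = 0"
    if k: "k < length B" and p: "p \<in> s_ring B" "lambda_B B p = 0" for k p
  proof -
    \<comment> \<open>By the duality relations this form goes to \<open>N\<close> times the variable
      \<open>k\<close> under the substitution \<open>Bs B\<close>, so intertwining moves the
      derivative by \<open>k\<close> through \<open>lambda_B\<close>.\<close>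
    define r where "r = (\<Sum>j\<in>UNIV. const (of_int (c k j)) * var j)"
    have "poly_subst (Bs B) r = (\<Sum>j\<in>UNIV. \<Sum>l<length B. const (of_int (c k j)) * (const (of_int (B ! l $ j)) * var l))"
      by (simp add: r_def poly_subst_sum poly_subst_mult Bs_def sum_distrib_left)
    also have "\<dots> = (\<Sum>l<length B. const (of_int (\<Sum>j\<in>UNIV. c k j * B ! l $ j)) * var l)"
      by (subst sum.swap) (simp add: const_sum const_mult sum_distrib_right mult.assoc)
    also have "\<dots> = (\<Sum>l<length B. if k = l then const (of_int N) * var l else 0)"
      using k by (intro sum.cong) (auto simp: dual)
    also have "\<dots> = const (of_int N) * var k" using k by simp
    finally have "0 = lambda_B B (diff_act (const (of_int N) * var k) p)"
      using diff_act_lambda_B[OF p(1), of r] p(2) by simp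
    also have "\<dots> = cscale (of_int N) (lambda_B B (poly_diff k p))"
      by (simp add: diff_act_mult diff_act_const diff_act_var lambda_B_simps)
    finally show ?thesis using N by simp
  qed
  have all: "lambda_B B (diff_act (monom a) p) = 0"
    if "keys a \<subseteq> {..<length B}" "p \<in> s_ring B" "lambda_B B p = 0" for a p
    using that
  proof (induction a arbitrary: p rule: exps_induct)
    case zero
    then show ?case by simp
  next
    case (add k a)
    have "poly_diff k p \<in> s_ring B" using add.prems(2) diff_act_poly_ring[of p _ "var k"]
      by (simp add: s_ring_def diff_act_var)
    moreover have "lambda_B B (poly_diff k p) = 0" using add.prems diff by (auto simp: keys_exps_add)
    ultimately have "lambda_B B (diff_act (monom a * var k) p) = 0"
      using add.IH[of "poly_diff k p"] add.prems by (simp add: diff_act_mult diff_act_var keys_exps_add)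
    then show ?case by (simp add: monom_unit_exp_add mult.commute)
  qed
  show "q = 0"
  proof (rule poly_mapping_eqI)
    fix a
    show "lookup q a = lookup 0 a"
    proof (cases "keys a \<subseteq> {..<length B}")
      case True
      obtain m :: nat where m: "m > 0" "lookup (diff_act (monom a) q) 0 = of_nat m * lookup q (0 + a)"
        using lookup_diff_act_monom[of a 0] by blast
      have "lookup (diff_act (monom a) q) 0 = 0"
        using all[OF True q] lookup_lambda_B_0[of B "diff_act (monom a) q"] by simp
      then show ?thesis using m by simp
    next
      case False
      then show ?thesis using q(1) by (auto simp: s_ring_def poly_ring_def in_keys_iff)
    qed
  qed
qed

text \<open>Monomials are eigenvectors of the Euler operator, with their degree as
  eigenvalue.\<close>

lemma euler_operator:
  fixes f :: "('n::finite) cpoly"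
  shows "lookup (\<Sum>j\<in>UNIV. var j * poly_diff j f) a = of_nat (exp_deg a) * lookup f a"
proof (rule additive_eqI[where p = f])
  fix b :: "'n exps" and c
  have "var j * poly_diff j (single b c) = single b (of_nat (lookup b j) * c)" for j
  proof (cases "lookup b j = 0")
    case False
    have "unit_exp j + (b - unit_exp j) = b"
      by (rule poly_mapping_eqI) (use False in \<open>auto simp: lookup_add lookup_minus lookup_single when_def\<close>)
    then show ?thesis by (simp add: poly_diff_single var_def monom_def mult_single)
  qed (simp add: poly_diff_single)
  then show "lookup (\<Sum>j\<in>UNIV. var j * poly_diff j (single b c)) a = of_nat (exp_deg a) * lookup (single b c) a"
    by (auto simp: lookup_sum lookup_single when_def exp_deg_superset[of UNIV] simp flip: sum_distrib_right)
qed (simp_all add: poly_diff_add distrib_left sum.distrib lookup_add)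

lemma lambda_B_image_closed:
  assumes "f \<in> lambda_B B ` s_ring B" "g \<in> lambda_B B ` s_ring B"
  shows "f + g \<in> lambda_B B ` s_ring B" "f * g \<in> lambda_B B ` s_ring B"
  using assms by (auto simp: s_ring_def image_iff simp flip: lambda_B_simps(1,2)
      intro: poly_ring_add poly_ring_mult)

lemma lambda_B_image_const: "const c \<in> lambda_B B ` s_ring B"
  by (rule image_eqI[of _ _ "const c"]) (auto simp: lambda_B_simps s_ring_def)

lemma lambda_B_image_sum:
  "(\<And>x. x \<in> S \<Longrightarrow> f x \<in> lambda_B B ` s_ring B) \<Longrightarrow> (\<Sum>x\<in>S. f x) \<in> lambda_B B ` s_ring B"
proof (induction S rule: infinite_finite_induct)
  case (insert x F)
  then show ?case by (simp add: lambda_B_image_closed)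
qed (use lambda_B_image_const[of 0] in simp_all)

lemma lambda_B_image_lin_form: "k < length B \<Longrightarrow> lin_form (B ! k) \<in> lambda_B B ` s_ring B"
  by (rule image_eqI[of _ _ "var k"]) (auto simp: lambda_B_simps s_ring_def intro: poly_ring_var)

lemma diff_act_lin_form_var_mult:
  "diff_act (lin_form a) (var j * f) = const (of_int (a $ j)) * f + var j * diff_act (lin_form a) f"
proof -
  have "diff_act (lin_form a) (var j * f) =
      (\<Sum>i\<in>UNIV. (if i = j then const (of_int (a $ i)) * f else 0) + var j * (const (of_int (a $ i)) * poly_diff i f))"
    unfolding diff_act_lin_form by (intro sum.cong) (auto simp: poly_diff_var_mult distrib_left mult.left_commute)
  then show ?thesis by (simp add: sum.distrib sum_distrib_left diff_act_lin_form)
qed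

text \<open>Euler's formula \<open>n f = \<Sum>\<^sub>j z\<^sub>j \<partial>f/\<partial>z\<^sub>j\<close> combined with the splitting of the identity expresses \<open>f\<close>
  through the linear forms in \<open>B\<close> and derivatives of \<open>f\<close>.\<close>

lemma kernel_lin_forms_subset_lambda_B:
  fixes A :: "int^'n^'d"
  assumes rank: "rank (map_matrix of_int A :: rat^'n^'d) = CARD('d)"
    and B: "int_basis B (int_ker A)"
    and f: "\<And>i. diff_act (lin_form (A $ i)) f = 0"
  shows "f \<in> lambda_B B ` s_ring B"
proof (rule lattice_splitting[OF rank B])
  fix N :: int and Z :: "'n \<Rightarrow> 'd \<Rightarrow> int" and c :: "nat \<Rightarrow> 'n \<Rightarrow> int"
  assume N: "N > 0" and split: "\<And>j' j. (if j' = j then N else 0) =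
       (\<Sum>i\<in>UNIV. Z j' i * A $ i $ j) + (\<Sum>k<length B. c k j * B ! k $ j')"
  let ?K = "\<lambda>x. const (of_int x) :: 'n cpoly"
  let ?I = "lambda_B B ` s_ring B"
  have euler: "?K N * (\<Sum>j\<in>UNIV. var j * poly_diff j f) =
      (\<Sum>k<length B. lin_form (B ! k) * (\<Sum>j\<in>UNIV. ?K (c k j) * poly_diff j f))"
    if f: "\<And>i. diff_act (lin_form (A $ i)) f = 0" for f
  proof -
    \<comment> \<open>The matrix \<open>N\<close> times the identity is inserted between variables
      and derivatives; its part through \<open>A\<close> dies on \<open>f\<close>, its part through
      \<open>B\<close> produces the forms \<open>lin_form (B ! k)\<close>.\<close>
    have "?K N * (\<Sum>j\<in>UNIV. var j * poly_diff j f) =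
        (\<Sum>j'\<in>UNIV. \<Sum>j\<in>UNIV. ?K (if j' = j then N else 0) * (var j' * poly_diff j f))"
      by (simp add: sum_distrib_left if_distrib[of "\<lambda>x. ?K x * _"] cong: if_cong)
    also have "\<dots> = (\<Sum>j'\<in>UNIV. \<Sum>j\<in>UNIV. \<Sum>i\<in>UNIV. ?K (Z j' i) * var j' * (?K (A $ i $ j) * poly_diff j f)) +
        (\<Sum>j'\<in>UNIV. \<Sum>j\<in>UNIV. \<Sum>k<length B. (?K (B ! k $ j') * var j') * (?K (c k j) * poly_diff j f))"
      unfolding split by (simp add: const_add const_sum const_mult distrib_right sum_distrib_right
          sum.distrib) (simp only: ac_simps)
    also have "(\<Sum>j'\<in>UNIV. \<Sum>j\<in>UNIV. \<Sum>i\<in>UNIV. ?K (Z j' i) * var j' * (?K (A $ i $ j) * poly_diff j f)) =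
        (\<Sum>j'\<in>UNIV. \<Sum>i\<in>UNIV. ?K (Z j' i) * var j' * diff_act (lin_form (A $ i)) f)"
      by (rule sum.cong[OF refl], subst sum.swap) (simp add: diff_act_lin_form sum_distrib_left)
    also have "\<dots> = 0" by (simp add: f)
    also have "(\<Sum>j'\<in>UNIV. \<Sum>j\<in>UNIV. \<Sum>k<length B. (?K (B ! k $ j') * var j') * (?K (c k j) * poly_diff j f)) =
        (\<Sum>j'\<in>UNIV. \<Sum>k<length B. \<Sum>j\<in>UNIV. (?K (B ! k $ j') * var j') * (?K (c k j) * poly_diff j f))"
      by (rule sum.cong[OF refl], rule sum.swap)
    also have "\<dots> = (\<Sum>k<length B. \<Sum>j'\<in>UNIV. \<Sum>j\<in>UNIV. (?K (B ! k $ j') * var j') * (?K (c k j) * poly_diff j f))"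
      by (rule sum.swap)
    also have "\<dots> = (\<Sum>k<length B. lin_form (B ! k) * (\<Sum>j\<in>UNIV. ?K (c k j) * poly_diff j f))"
      by (simp only: lin_form_def sum_product)
    finally show ?thesis by simp
  qed
  have "f \<in> ?I" if "deg_le n f" "\<And>i. diff_act (lin_form (A $ i)) f = 0" for n f
    using that
  proof (induction n arbitrary: f)
    case 0
    have "f = const (lookup f 0)"
    proof (rule poly_mapping_eqI)
      fix a
      show "lookup f a = lookup (const (lookup f 0)) a"
        using 0 exp_deg_eq_0_iff[of a] by (auto simp: lookup_const deg_le_def)
    qed
    then show ?case using lambda_B_image_const by metis
  next
    case (Suc n)
    define \<theta> where "\<theta> = (\<Sum>j\<in>UNIV. var j * poly_diff j f)"
    have comm: "diff_act (lin_form (A $ i)) (poly_diff j f) = 0" for i j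
      using diff_act_commute[of "lin_form (A $ i)" "var j" f] Suc.prems(2) by (simp add: diff_act_var)
    have "poly_diff j f \<in> ?I" for j
      by (rule Suc.IH) (use Suc.prems comm deg_le_poly_diff_Suc in auto)
    hence "?K N * \<theta> \<in> ?I"
      unfolding \<theta>_def euler[OF Suc.prems(2)]
      by (intro lambda_B_image_sum lambda_B_image_closed lambda_B_image_lin_form lambda_B_image_const) auto
    hence "const (1 / of_int N) * (?K N * \<theta>) \<in> ?I"
      by (rule lambda_B_image_closed(2)[OF lambda_B_image_const])
    moreover have "const (1 / of_int N) * (?K N * \<theta>) = \<theta>"
      using N by (simp add: mult.assoc[symmetric] flip: const_mult)
    ultimately have \<theta>: "\<theta> \<in> ?I" by (simp only:)
    \<comment> \<open>As \<open>f\<close> need not be homogeneous, Euler's formula handles only its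
      top degree: on degree \<open>Suc n\<close> the two terms cancel, and the rest has degree at
      most \<open>n\<close>.\<close>
    define r where "r = const (of_nat (Suc n)) * f - \<theta>"
    have "deg_le n r"
      unfolding deg_le_def
    proof (intro allI impI)
      fix a :: "'n exps" assume a: "n < exp_deg a"
      have "lookup r a = (of_nat (Suc n) - of_nat (exp_deg a)) * lookup f a"
        by (simp add: r_def \<theta>_def lookup_minus euler_operator lookup_cscale left_diff_distrib
            flip: cscale_eq_const_mult)
      then show "lookup r a = 0"
        using a Suc.prems(1) by (cases "exp_deg a = Suc n") (auto simp: deg_le_def)
    qed
    moreover have "diff_act (lin_form (A $ i)) r = 0" for i
    proof -
      \<comment> \<open>The commutator of a linear form in the derivations with the Euler operator
        is the form itself.\<close>
      have "diff_act (lin_form (A $ i)) \<theta> = diff_act (lin_form (A $ i)) f"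
        unfolding \<theta>_def diff_act_arg_sum diff_act_lin_form_var_mult
        by (simp add: comm) (simp add: diff_act_lin_form)
      then show ?thesis using Suc.prems(2)[of i]
        by (simp add: r_def diff_act_arg_diff diff_act_arg_cscale flip: cscale_eq_const_mult)
    qed
    ultimately have "r \<in> ?I" by (rule Suc.IH)
    hence "const (1 / of_nat (Suc n)) * (r + \<theta>) \<in> ?I"
      using \<theta> by (intro lambda_B_image_closed lambda_B_image_const)
    moreover have "const (1 / of_nat (Suc n)) * (r + \<theta>) = f"
    proof -
      have "const (1 / of_nat (Suc n)) * const (of_nat (Suc n)) = (1 :: 'n cpoly)"
        by (simp flip: const_mult del: of_nat_Suc)
      then show ?thesis by (simp add: r_def mult.assoc[symmetric] del: of_nat_Suc)
    qed
    ultimately show ?case by simp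
  qed
  then show "f \<in> ?I" using f ex_deg_le by blast
qed

section \<open>Orthogonal complements\<close>

lemma ideal_in_superset: "1 \<in> R \<Longrightarrow> p \<in> S \<Longrightarrow> p \<in> ideal_in R S"
  unfolding ideal_in_def by (rule CollectI, rule exI[of _ "{p}"], rule exI[of _ "\<lambda>_. 1"]) simp

lemma ideal_in_mult: "r \<in> R \<Longrightarrow> p \<in> S \<Longrightarrow> r * p \<in> ideal_in R S"
  unfolding ideal_in_def by (rule CollectI, rule exI[of _ "{p}"], rule exI[of _ "\<lambda>_. r"]) simp

lemma diff_act_ideal_in_eq_0:
  "(\<And>p. p \<in> S \<Longrightarrow> diff_act p f = 0) \<Longrightarrow> p \<in> ideal_in R S \<Longrightarrow> diff_act p f = 0"
  by (auto simp: ideal_in_def diff_act_sum diff_act_mult subset_iff intro!: sum.neutral)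

lemma diff_perp_ideal_gen: "f \<in> diff_perp (ideal_gen S) \<longleftrightarrow> (\<forall>p\<in>S. diff_act p f = 0)"
  unfolding diff_perp_def using diff_act_ideal_in_eq_0 ideal_in_superset by blast

text \<open>The pairing sees only a constant term, but an ideal absorbs monomials: pairing
  \<open>q\<close> with \<open>monom a * p\<close> reads off coefficient \<open>a\<close> of the
  derivative of \<open>q\<close> by \<open>p\<close>, up to a positive factor. Hence orthogonality
  to the ideal is annihilation by its generators.\<close>

lemma PB_perp_iff:
  "q \<in> PB_perp v m g B \<longleftrightarrow>
     q \<in> s_ring B \<and> (\<forall>i\<in>{1..m}. diff_act (Bs_prod B (new_nsupp v (g i))) q = 0)"
proof (intro iffI conjI ballI)
  assume q: "q \<in> PB_perp v m g B"
  then show s: "q \<in> s_ring B" by (simp add: PB_perp_def)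
  fix i assume i: "i \<in> {1..m}"
  let ?p = "Bs_prod B (new_nsupp v (g i))"
  show "diff_act ?p q = 0"
  proof (rule poly_mapping_eqI)
    fix a
    show "lookup (diff_act ?p q) a = lookup 0 a"
    proof (cases "keys a \<subseteq> {..<length B}")
      case True
      obtain c :: nat where c: "c > 0"
        "lookup (diff_act (monom a) (diff_act ?p q)) 0 = of_nat c * lookup (diff_act ?p q) (0 + a)"
        using lookup_diff_act_monom[of a 0] by blast
      have "monom a * ?p \<in> PB_ideal v m g B"
        unfolding PB_ideal_def
        by (rule ideal_in_mult) (use True i in \<open>auto simp: s_ring_def poly_ring_monom\<close>)
      hence "lookup (diff_act q (monom a * ?p)) 0 = 0"
        using q by (auto simp: PB_perp_def poly_eval_zero_point)
      hence "lookup (diff_act (monom a) (diff_act ?p q)) 0 = 0"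
        by (simp add: diff_act_pairing_symmetric[of q] diff_act_mult)
      then show ?thesis using c by simp
    next
      case False
      have "diff_act ?p q \<in> s_ring B" using s by (simp add: s_ring_def diff_act_poly_ring)
      then show ?thesis using False by (auto simp: s_ring_def poly_ring_def in_keys_iff)
    qed
  qed
next
  assume q: "q \<in> s_ring B \<and> (\<forall>i\<in>{1..m}. diff_act (Bs_prod B (new_nsupp v (g i))) q = 0)"
  have "diff_act p q = 0" if "p \<in> PB_ideal v m g B" for p
    by (rule diff_act_ideal_in_eq_0[OF _ that[unfolded PB_ideal_def]]) (use q in auto)
  then show "q \<in> PB_perp v m g B"
    using q by (simp add: PB_perp_def poly_eval_zero_point diff_act_pairing_symmetric[of q])
qed

lemma diff_act_PB_ideal_perp:
  "q \<in> PB_perp v m g B \<Longrightarrow> p \<in> PB_ideal v m g B \<Longrightarrow> diff_act p q = 0"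
  unfolding PB_ideal_def by (erule diff_act_ideal_in_eq_0[rotated]) (auto simp: PB_perp_iff)

text \<open>The members of \<open>B\<close> lie in the kernel of \<open>A\<close>, so every image of
  \<open>lambda_B\<close> is killed by the forms \<open>A \<theta>\<close>.\<close>

lemma poly_subst_Bs_lin_form:
  assumes "int_basis B (int_ker A)"
  shows "poly_subst (Bs B) (lin_form (A $ i)) = 0"
proof -
  have Al: "(\<Sum>j\<in>UNIV. A $ i $ j * B ! l $ j) = 0" if "l < length B" for l
    using int_basis_mem[OF assms that] by (auto simp: int_ker_def vec_eq_iff matrix_vector_mult_def)
  have "poly_subst (Bs B) (lin_form (A $ i)) =
      (\<Sum>j\<in>UNIV. \<Sum>l<length B. const (of_int (A $ i $ j)) * (const (of_int (B ! l $ j)) * var l))"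
    by (simp add: lin_form_def poly_subst_sum poly_subst_mult Bs_def sum_distrib_left)
  also have "\<dots> = (\<Sum>l<length B. const (of_int (\<Sum>j\<in>UNIV. A $ i $ j * B ! l $ j)) * var l)"
    by (subst sum.swap) (simp add: const_sum const_mult sum_distrib_right mult.assoc)
  also have "\<dots> = 0" by (simp add: Al)
  finally show ?thesis .
qed

lemma poly_subst_Bs_prod: "poly_subst (Bs B) (\<Prod>j\<in>F. var j) = Bs_prod B F"
  by (simp add: poly_subst_prod Bs_prod_def)

lemma local_fake_indicial_perp_iff:
  "f \<in> diff_perp (local_fake_indicial_ideal A v m g) \<longleftrightarrow>
     (\<forall>i. diff_act (lin_form (A $ i)) f = 0) \<and>
     (\<forall>i\<in>{1..m}. diff_act (\<Prod>j\<in>new_nsupp v (g i). var j) f = 0)"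
  unfolding local_fake_indicial_ideal_def diff_perp_ideal_gen by blast

text \<open>Intertwining gives one inclusion. For the other, the Euler forms provide a preimage
  \<open>q\<close>, and injectivity of \<open>lambda_B\<close> pulls the remaining equations back to
  \<open>q\<close>.\<close>

lemma lambda_B_PB_perp:
  fixes A :: "int^'n^'d"
  assumes rank: "rank (map_matrix of_int A :: rat^'n^'d) = CARD('d)"
    and B: "int_basis B (int_ker A)"
  shows "lambda_B B ` PB_perp v m g B = diff_perp (local_fake_indicial_ideal A v m g)"
proof (intro equalityI subsetI)
  fix f assume "f \<in> lambda_B B ` PB_perp v m g B"
  then obtain q where q: "q \<in> PB_perp v m g B" "f = lambda_B B q" by blast
  then have "q \<in> s_ring B" by (simp add: PB_perp_iff)
  then show "f \<in> diff_perp (local_fake_indicial_ideal A v m g)"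
    using q by (auto simp: local_fake_indicial_perp_iff diff_act_lambda_B poly_subst_Bs_lin_form[OF B]
        poly_subst_Bs_prod lambda_B_simps PB_perp_iff)
next
  fix f assume f: "f \<in> diff_perp (local_fake_indicial_ideal A v m g)"
  then obtain q where q: "q \<in> s_ring B" "f = lambda_B B q"
    using kernel_lin_forms_subset_lambda_B[OF rank B, of f] by (auto simp: local_fake_indicial_perp_iff)
  have "diff_act (Bs_prod B (new_nsupp v (g i))) q = 0" if i: "i \<in> {1..m}" for i
  proof (rule lambda_B_inj[OF rank B])
    show "diff_act (Bs_prod B (new_nsupp v (g i))) q \<in> s_ring B"
      using q by (simp add: s_ring_def diff_act_poly_ring)
    show "lambda_B B (diff_act (Bs_prod B (new_nsupp v (g i))) q) = 0"
      using f i q by (auto simp: local_fake_indicial_perp_iff diff_act_lambda_B poly_subst_Bs_prod)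
  qed
  then show "f \<in> lambda_B B ` PB_perp v m g B" using q by (auto simp: PB_perp_iff)
qed

text \<open>The generators of \<open>PB_ideal\<close> are products of linear forms, hence
  homogeneous, so annihilation passes to components.\<close>

lemma hom_comp_PB_perp:
  assumes "q \<in> PB_perp v m g B"
  shows "hom_comp n q \<in> PB_perp v m g B"
proof -
  have homog: "homog (card F) (Bs_prod B F)" if "finite F" for F
  proof -
    have "homog 1 (Bs B j)" for j
      unfolding Bs_def by (intro homog_sum homog_const_mult homog_var)
    hence "homog (\<Sum>j\<in>F. 1) (Bs_prod B F)" unfolding Bs_prod_def by (intro homog_prod)
    then show ?thesis by simp
  qed
  have "diff_act (Bs_prod B (new_nsupp v (g i))) (hom_comp n q) = 0" if "i \<in> {1..m}" for i
    using assms that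
    by (intro poly_mapping_eqI) (simp add: lookup_diff_act_hom_comp[OF homog] PB_perp_iff)
  moreover have "hom_comp n q \<in> s_ring B"
    using assms by (auto simp: PB_perp_iff s_ring_def poly_ring_def in_keys_iff lookup_hom_comp split: if_splits)
  ultimately show ?thesis by (simp add: PB_perp_iff)
qed

lemma hom_comp_lambda_B: "hom_comp n (lambda_B B q) = lambda_B B (hom_comp n q)"
  unfolding lambda_B_def by (rule hom_comp_poly_subst) (rule homog_lin_form)

lemma hom_part_lambda_B_PB_perp:
  "hom_part (lambda_B B ` PB_perp v m g B) n = lambda_B B ` hom_part (PB_perp v m g B) n"
proof (intro equalityI subsetI)
  fix f assume "f \<in> hom_part (lambda_B B ` PB_perp v m g B) n"
  then obtain q where q: "q \<in> PB_perp v m g B" "f = lambda_B B q" "homog n f"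
    by (auto simp: hom_part_iff)
  have "f = hom_comp n f" using q(3) by (simp add: hom_comp_homog)
  hence "f = lambda_B B (hom_comp n q)" using q(2) by (simp add: hom_comp_lambda_B)
  moreover have "hom_comp n q \<in> hom_part (PB_perp v m g B) n"
    using q(1) by (simp add: hom_part_iff hom_comp_PB_perp homog_hom_comp)
  ultimately show "f \<in> lambda_B B ` hom_part (PB_perp v m g B) n" by blast
next
  fix f assume "f \<in> lambda_B B ` hom_part (PB_perp v m g B) n"
  then obtain q where q: "q \<in> PB_perp v m g B" "f = lambda_B B q" "homog n q"
    by (auto simp: hom_part_iff)
  have "q = hom_comp n q" using q(3) by (simp add: hom_comp_homog)
  hence "f = hom_comp n f" using q(2) by (metis hom_comp_lambda_B)
  hence "homog n f" by (metis homog_hom_comp)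
  then show "f \<in> hom_part (lambda_B B ` PB_perp v m g B) n" using q by (auto simp: hom_part_iff)
qed

lemma graded_subspace_lambda_B_PB_perp: "graded_subspace (lambda_B B ` PB_perp v m g B)"
  unfolding graded_subspace_def
proof (intro conjI ballI allI)
  have closed: "p + q \<in> PB_perp v m g B" "cscale c p \<in> PB_perp v m g B" "0 \<in> PB_perp v m g B"
    if "p \<in> PB_perp v m g B" "q \<in> PB_perp v m g B" for p q c
    using that by (auto simp: PB_perp_iff diff_act_arg_add diff_act_arg_cscale s_ring_def
        cscale_eq_const_mult[of c p] intro: poly_ring_add poly_ring_mult)
       (simp add: diff_act_arg_cscale flip: cscale_eq_const_mult)
  have zero: "0 \<in> PB_perp v m g B" by (simp add: PB_perp_iff s_ring_def)
  show "cvs.subspace (lambda_B B ` PB_perp v m g B)"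
    unfolding cvs.subspace_def
  proof (intro conjI ballI allI)
    show "0 \<in> lambda_B B ` PB_perp v m g B"
      using zero by (metis image_eqI lambda_B_simps(5))
  next
    fix x y assume "x \<in> lambda_B B ` PB_perp v m g B" "y \<in> lambda_B B ` PB_perp v m g B"
    then show "x + y \<in> lambda_B B ` PB_perp v m g B"
      using closed(1) by (auto simp flip: lambda_B_simps(1))
  next
    fix c x assume "x \<in> lambda_B B ` PB_perp v m g B"
    then show "cscale c x \<in> lambda_B B ` PB_perp v m g B"
      using closed(2) by (auto simp flip: lambda_B_simps(7))
  qed
  fix p n assume "p \<in> lambda_B B ` PB_perp v m g B"
  then show "hom_comp n p \<in> lambda_B B ` PB_perp v m g B"
    by (auto simp: hom_comp_lambda_B intro: hom_comp_PB_perp)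
qed

lemma graded_isomorphic_refl: "graded_subspace V \<Longrightarrow> graded_isomorphic V V"
  unfolding graded_isomorphic_def by (auto intro!: exI[of _ "\<lambda>p. p"] simp: bij_betw_def)

section \<open>Operators on logarithmic series\<close>

lemma commuting_series_x: "commuting series_x"
  by (auto simp: commuting_def series_x_def fun_eq_iff algebra_simps)

lemma commuting_series_d: "commuting series_d"
  unfolding commuting_def
proof (intro allI)
  fix i j :: "'n::finite" and \<phi> :: "'n log_series"
  show "series_d i (series_d j \<phi>) = series_d j (series_d i \<phi>)"
  proof (cases "i = j")
    case False
    show ?thesis
    proof
      fix e :: "complex^'n"
      have e: "e + axis j 1 + axis i 1 = e + axis i 1 + axis j 1" by (simp add: algebra_simps)
      show "series_d i (series_d j \<phi>) e = series_d j (series_d i \<phi>) e"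
        using False by (simp add: series_d_def e axis_def poly_diff_add poly_diff_cscale
            cvs.scale_right_distrib poly_poly_diff_commuting_linearute[of i j] ac_simps)
    qed
  qed simp
qed

text \<open>The term of exponent \<open>e\<close> in the derivative stems from exponent
  \<open>e + axis j 1\<close>, whose coordinate \<open>j\<close> is
  \<open>e $ j + 1\<close>.\<close>

lemma series_d_eq_diff_act: "series_d j \<phi> e = diff_act (const (e $ j + 1) + var j) (\<phi> (e + axis j 1))"
  by (simp add: series_d_def diff_act_add diff_act_const diff_act_var)

lemma exp_vec_add: "exp_vec (a + b) = exp_vec a + exp_vec b"
  by (simp add: exp_vec_def vec_eq_iff lookup_add)

lemma int_vec_add: "int_vec (u + u') = int_vec u + int_vec u'"
  by (simp add: int_vec_def vec_eq_iff)

lemma int_vec_uminus: "int_vec (- u) = - int_vec u"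
  by (simp add: int_vec_def vec_eq_iff)

lemma int_vec_diff: "int_vec (u - u') = int_vec u - int_vec u'"
  by (simp add: int_vec_def vec_eq_iff)

lemma int_vec_0 [simp]: "int_vec 0 = 0"
  by (simp add: int_vec_def vec_eq_iff)

lemma exp_vec_0 [simp]: "exp_vec 0 = 0"
  by (simp add: exp_vec_def vec_eq_iff)

lemma int_vec_nth: "int_vec u $ j = of_int (u $ j)"
  by (simp add: int_vec_def)

lemma exp_vec_nth: "exp_vec a $ j = int (lookup a j)"
  by (simp add: exp_vec_def)

lemma int_vec_unit_exp: "int_vec (exp_vec (unit_exp j)) = axis j 1"
  by (simp add: int_vec_def exp_vec_def axis_def vec_eq_iff lookup_single when_def)

text \<open>The Pochhammer symbol of \<open>c + 1 + \<theta>_j\<close> with \<open>k\<close>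
  factors: the effect of \<open>k\<close> derivatives by \<open>x_j\<close> on a coefficient that
  ends up at exponent \<open>c\<close>.\<close>

definition rising :: "'n \<Rightarrow> complex \<Rightarrow> nat \<Rightarrow> 'n cpoly" where
  "rising j c k = (\<Prod>l<k. const (c + of_nat (Suc l)) + var j)"

text \<open>The operator carrying the coefficient at \<open>e + a\<close> of a series to the
  coefficient at \<open>e\<close> of its derivative of multi-order \<open>a\<close>.\<close>

definition shift_poly :: "complex^'n \<Rightarrow> 'n exps \<Rightarrow> 'n cpoly" where
  "shift_poly e a = (\<Prod>j\<in>UNIV. rising j (e $ j) (lookup a j))"

lemma rising_Suc: "rising j c (Suc k) = (const (c + 1) + var j) * rising j (c + 1) k"
  unfolding rising_def prod.lessThan_Suc_shift by (simp add: add.assoc)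

lemma shift_poly_unit_exp_add:
  "shift_poly e (unit_exp j + a) = (const (e $ j + 1) + var j) * shift_poly (e + axis j 1) a"
proof -
  let ?R = "\<Prod>i\<in>UNIV - {j}. rising i (e $ i) (lookup a i)"
  have "shift_poly e (unit_exp j + a) = rising j (e $ j) (1 + lookup a j) * ?R"
    unfolding shift_poly_def
    by (subst prod.remove[of _ j]) (auto simp: lookup_add lookup_single intro!: prod.cong)
  moreover have "shift_poly (e + axis j 1) a = rising j (e $ j + 1) (lookup a j) * ?R"
    unfolding shift_poly_def
    by (subst prod.remove[of _ j]) (auto simp: axis_def intro!: prod.cong)
  ultimately show ?thesis by (simp add: rising_Suc mult.assoc flip: Suc_eq_plus1_left)
qed

lemma op_monom_series_d:
  "op_monom series_d a \<phi> e = diff_act (shift_poly e a) (\<phi> (e + int_vec (exp_vec a)))"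
proof (induction a arbitrary: e rule: exps_induct)
  case zero
  show ?case by (simp add: op_monom_0[OF commuting_series_d] shift_poly_def rising_def)
next
  case (add j a)
  have "op_monom series_d (unit_exp j + a) \<phi> e = series_d j (op_monom series_d a \<phi>) e"
    by (simp only: op_monom_unit_exp_add[OF commuting_series_d])
  also have "\<dots> = diff_act (const (e $ j + 1) + var j) (op_monom series_d a \<phi> (e + axis j 1))"
    by (rule series_d_eq_diff_act)
  finally show ?case
    by (simp add: add shift_poly_unit_exp_add diff_act_mult exp_vec_add
        int_vec_add int_vec_unit_exp add.assoc)
qed

lemma op_monom_series_x: "op_monom series_x a \<phi> e = \<phi> (e - int_vec (exp_vec a))"
proof (induction a arbitrary: e rule: exps_induct)
  case zero
  show ?case by (simp add: op_monom_0[OF commuting_series_x])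
next
  case (add j a)
  have "op_monom series_x (unit_exp j + a) \<phi> e = series_x j (op_monom series_x a \<phi>) e"
    by (simp only: op_monom_unit_exp_add[OF commuting_series_x])
  also have "\<dots> = op_monom series_x a \<phi> (e - axis j 1)"
    by (simp only: series_x_def)
  finally show ?case
    by (simp add: add exp_vec_add int_vec_add int_vec_unit_exp diff_diff_eq)
qed

text \<open>The Weyl relation on series, in the shape of the definition of \<open>weyl_d\<close>; it
  is what makes normally ordered elements act compatibly with multiplication.\<close>

lemma series_d_op_monom_series_x:
  "series_d j (op_monom series_x a \<phi>) e =
     op_monom series_x a (series_d j \<phi>) e + cscale (of_nat (lookup a j)) (op_monom series_x (a - unit_exp j) \<phi> e)"
proof -
  have shift: "e + axis j 1 - int_vec (exp_vec a) = e - int_vec (exp_vec a) + axis j 1"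
    by (simp add: algebra_simps)
  have a: "e - int_vec (exp_vec (a - unit_exp j)) = e - int_vec (exp_vec a) + axis j 1" if "lookup a j \<noteq> 0"
  proof -
    have "unit_exp j + (a - unit_exp j) = a"
      by (rule poly_mapping_eqI) (use that in \<open>auto simp: lookup_add lookup_minus lookup_single when_def\<close>)
    hence "int_vec (exp_vec a) = axis j 1 + (int_vec (exp_vec (a - unit_exp j)) :: complex^'a)"
      by (metis exp_vec_add int_vec_add int_vec_unit_exp)
    then show ?thesis by simp
  qed
  show ?thesis
    by (cases "lookup a j = 0")
       (simp_all add: op_monom_series_x series_d_def shift a int_vec_nth exp_vec_nth cvs.scale_left_distrib
         cvs.scale_left_diff_distrib)
qed

section \<open>The Weyl algebra\<close>

lemma weyl_x_add: "weyl_x j (P + Q) = weyl_x j P + weyl_x j Q"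
  unfolding weyl_x_def case_prod_unfold prod.collapse
  by (rule sum_keys_add[where h = "\<lambda>ab c. single (fst ab + unit_exp j, snd ab) c"]) (simp_all add: single_add)

lemma weyl_x_single: "weyl_x j (single (a, b) c) = single (a + unit_exp j, b) c"
  unfolding weyl_x_def case_prod_unfold prod.collapse
  by (subst sum_keys_single[where h = "\<lambda>ab c. single (fst ab + unit_exp j, snd ab) c"]) simp_all

lemma weyl_d_add: "weyl_d j (P + Q) = weyl_d j P + weyl_d j Q"
  unfolding weyl_d_def case_prod_unfold prod.collapse
  by (rule sum_keys_add[where h = "\<lambda>ab c. single (fst ab, snd ab + unit_exp j) c +
      single (fst ab - unit_exp j, snd ab) (of_nat (lookup (fst ab) j) * c)"])
     (simp_all add: single_add algebra_simps)

lemma weyl_d_single: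
  "weyl_d j (single (a, b) c) =
     single (a, b + unit_exp j) c + single (a - unit_exp j, b) (of_nat (lookup a j) * c)"
  unfolding weyl_d_def case_prod_unfold prod.collapse
  by (subst sum_keys_single[where h = "\<lambda>ab c. single (fst ab, snd ab + unit_exp j) c +
      single (fst ab - unit_exp j, snd ab) (of_nat (lookup (fst ab) j) * c)"]) simp_all

lemma additive_weyl_eqI:
  fixes F G :: "'n weyl \<Rightarrow> 'b::ab_group_add"
  assumes "\<And>p q. F (p + q) = F p + F q" "\<And>p q. G (p + q) = G p + G q"
    and "\<And>a b c. F (single (a, b) c) = G (single (a, b) c)"
  shows "F P = G P"
  by (rule additive_eqI[of F G]) (use assms in auto)

lemma weyl_x_cscale: "weyl_x j (cscale c P) = cscale c (weyl_x j P)"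
  by (rule additive_weyl_eqI[where P = P])
     (simp_all add: weyl_x_add cvs.scale_right_distrib cscale_single weyl_x_single)

lemma weyl_d_cscale: "weyl_d j (cscale c P) = cscale c (weyl_d j P)"
  by (rule additive_weyl_eqI[where P = P])
     (simp_all add: weyl_d_add cvs.scale_right_distrib cscale_single weyl_d_single ac_simps)

lemma commuting_weyl_x: "commuting weyl_x"
  unfolding commuting_def
proof (intro allI)
  fix i j :: 'a and P
  show "weyl_x i (weyl_x j P) = weyl_x j (weyl_x i P)"
    by (rule additive_weyl_eqI[where P = P]) (simp_all add: weyl_x_add weyl_x_single ac_simps)
qed

lemma commuting_weyl_d: "commuting weyl_d"
  unfolding commuting_def
proof (intro allI)
  fix i j :: 'a and P
  show "weyl_d i (weyl_d j P) = weyl_d j (weyl_d i P)"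
  proof (rule additive_weyl_eqI[where P = P])
    fix a b :: "'a exps" and c
    have "a - unit_exp j - unit_exp i = a - unit_exp i - unit_exp j"
      by (rule poly_mapping_eqI) (simp add: lookup_minus)
    then show "weyl_d i (weyl_d j (single (a, b) c)) = weyl_d j (weyl_d i (single (a, b) c))"
      by (cases "i = j") (simp_all add: weyl_d_add weyl_d_single lookup_minus lookup_single ac_simps)
  qed (simp_all add: weyl_d_add)
qed

lemma weyl_d_weyl_x: "weyl_d i (weyl_x j P) = weyl_x j (weyl_d i P) + (if i = j then P else 0)"
proof (rule additive_weyl_eqI[where P = P])
  fix a b :: "'a exps" and c
  show "weyl_d i (weyl_x j (single (a, b) c)) =
      weyl_x j (weyl_d i (single (a, b) c)) + (if i = j then single (a, b) c else 0)"
  proof (cases "lookup a i = 0")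
    case True
    then show ?thesis
      by (auto simp: weyl_d_single weyl_x_single weyl_x_add lookup_add lookup_single when_def ac_simps)
  next
    case False
    have 2: "a - unit_exp i + unit_exp j = a + unit_exp j - unit_exp i"
      by (rule poly_mapping_eqI) (use False in \<open>auto simp: lookup_add lookup_minus lookup_single when_def\<close>)
    show ?thesis
      by (auto simp: weyl_d_single weyl_x_single weyl_x_add lookup_add lookup_single when_def 2
          distrib_right single_add)
  qed
qed (simp_all add: weyl_x_add weyl_d_add)

lemma weyl_mult_add_left: "weyl_mult (P + Q) R = weyl_mult P R + weyl_mult Q R"
  unfolding weyl_mult_def case_prod_unfold prod.collapse
  by (rule sum_keys_add[where h = "\<lambda>ab c. cscale c (op_monom weyl_x (fst ab) (op_monom weyl_d (snd ab) R))"])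
     (simp_all add: cvs.scale_left_distrib)

lemma weyl_mult_single:
  "weyl_mult (single (a, b) c) R = cscale c (op_monom weyl_x a (op_monom weyl_d b R))"
  unfolding weyl_mult_def case_prod_unfold prod.collapse
  by (subst sum_keys_single[where h = "\<lambda>ab c. cscale c (op_monom weyl_x (fst ab) (op_monom weyl_d (snd ab) R))"])
     simp_all

lemma weyl_mult_one_left: "weyl_mult weyl_one P = P"
  by (simp add: weyl_one_def weyl_mult_single op_monom_0[OF commuting_weyl_x] op_monom_0[OF commuting_weyl_d])

lemma op_monom_weyl_x_single: "op_monom weyl_x a (single (b, b') c) = single (a + b, b') c"
  by (induction a rule: exps_induct)
     (simp_all add: op_monom_0[OF commuting_weyl_x] op_monom_unit_exp_add[OF commuting_weyl_x] weyl_x_single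
       add.assoc add.commute[of _ "unit_exp _"])

lemma weyl_theta_eq: "weyl_theta j = single (unit_exp j, unit_exp j) 1"
  by (simp add: weyl_theta_def weyl_mult_single op_monom_0[OF commuting_weyl_d] op_monom_weyl_x_single)

lemma weyl_mult_theta: "weyl_mult (weyl_theta j) P = weyl_x j (weyl_d j P)"
  by (simp only: weyl_theta_eq weyl_mult_single op_monom_unit_exp[OF commuting_weyl_x]
      op_monom_unit_exp[OF commuting_weyl_d]) simp

text \<open>For distinct indices all four operators involved commute. This legitimises the fold
  inside \<open>of_theta_poly\<close>.\<close>

lemma commuting_weyl_theta: "commuting (\<lambda>j. weyl_mult (weyl_theta j))"
  unfolding commuting_def
proof (intro allI)
  fix i j :: 'a and P
  have "weyl_x i (weyl_x j Q) = weyl_x j (weyl_x i Q)" "weyl_d i (weyl_d j Q) = weyl_d j (weyl_d i Q)" for Q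
    by (rule commuting_weyl_x[unfolded commuting_def, rule_format]
        commuting_weyl_d[unfolded commuting_def, rule_format])+
  then show "weyl_mult (weyl_theta i) (weyl_mult (weyl_theta j) P) = weyl_mult (weyl_theta j) (weyl_mult (weyl_theta i) P)"
    by (cases "i = j") (simp_all add: weyl_mult_theta weyl_d_weyl_x)
qed

lemma of_theta_poly_add: "of_theta_poly (p + q) = of_theta_poly p + of_theta_poly q"
  by (simp add: of_theta_poly_def op_poly_add)

lemma of_theta_poly_const: "of_theta_poly (const c) = cscale c weyl_one"
  by (simp add: of_theta_poly_def op_poly_const)

lemma of_theta_poly_mult:
  "of_theta_poly (p * q) = op_poly (\<lambda>j. weyl_mult (weyl_theta j)) p (of_theta_poly q)"
  unfolding of_theta_poly_def
  by (rule op_poly_mult[OF commuting_weyl_theta])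
     (simp_all add: weyl_mult_theta weyl_x_add weyl_d_add weyl_x_cscale weyl_d_cscale)

lemma of_theta_poly_var_mult: "of_theta_poly (var j * p) = weyl_x j (weyl_d j (of_theta_poly p))"
  unfolding of_theta_poly_mult
  by (subst op_poly_var[OF commuting_weyl_theta])
     (simp_all add: weyl_mult_theta weyl_x_add weyl_d_add weyl_x_cscale weyl_d_cscale)

lemma of_theta_poly_const_mult: "of_theta_poly (const c * p) = cscale c (of_theta_poly p)"
  unfolding of_theta_poly_mult by (simp add: op_poly_const)

lemma of_theta_poly_0 [simp]: "of_theta_poly 0 = 0"
  by (simp add: of_theta_poly_def op_poly_def)

lemma of_theta_poly_sum: "of_theta_poly (\<Sum>x\<in>S. f x) = (\<Sum>x\<in>S. of_theta_poly (f x))"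
  by (induction S rule: infinite_finite_induct) (simp_all add: of_theta_poly_add)

text \<open>The identity expressing \<open>x^a \<partial>^a\<close> as a product of falling
  factorials of the operators \<open>x_j \<partial>_j\<close>.\<close>

lemma of_theta_poly_falling:
  fixes v :: "complex^'n"
  shows "\<exists>p. of_theta_poly p = single (a, a) 1 \<and>
     poly_eval (($) v) p = (\<Prod>j\<in>UNIV. \<Prod>l<lookup a j. v $ j - of_nat l)"
proof (induction a rule: exps_induct)
  case zero
  show ?case by (intro exI[of _ 1]) (use of_theta_poly_const[of 1] in \<open>simp add: weyl_one_def\<close>)
next
  case (add j a)
  then obtain p where p: "of_theta_poly p = single (a, a) 1"
    "poly_eval (($) v) p = (\<Prod>j\<in>UNIV. \<Prod>l<lookup a j. v $ j - of_nat l)" by blast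
  \<comment> \<open>One more falling factor, the theta operator of \<open>j\<close> minus
    \<open>a_j\<close>; the subtracted term cancels the lower-order part that \<open>weyl_d\<close>
    creates on \<open>x^a\<close>.\<close>
  define q where "q = var j * p + const (- of_nat (lookup a j)) * p"
  have "weyl_x j (weyl_d j (single (a, a) 1)) =
      single (unit_exp j + a, unit_exp j + a) 1 + single (a, a) (of_nat (lookup a j))"
  proof (cases "lookup a j = 0")
    case False
    have "a - unit_exp j + unit_exp j = a"
      by (rule poly_mapping_eqI) (use False in \<open>auto simp: lookup_add lookup_minus lookup_single when_def\<close>)
    then show ?thesis by (simp add: weyl_d_single weyl_x_add weyl_x_single ac_simps)
  qed (simp add: weyl_d_single weyl_x_add weyl_x_single ac_simps)
  hence "of_theta_poly q = single (unit_exp j + a, unit_exp j + a) 1"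
    by (simp add: q_def of_theta_poly_add of_theta_poly_var_mult of_theta_poly_const_mult p cscale_single)
       (simp add: cscale_single single_uminus flip: cvs.scale_minus_left)
  moreover have "poly_eval (($) v) q =
      (\<Prod>i\<in>UNIV. \<Prod>l<lookup (unit_exp j + a) i. v $ i - of_nat l)"
  proof -
    have "(\<Prod>i\<in>UNIV. \<Prod>l<lookup (unit_exp j + a) i. v $ i - of_nat l) =
        (\<Prod>l<1 + lookup a j. v $ j - of_nat l) * (\<Prod>i\<in>UNIV - {j}. \<Prod>l<lookup a i. v $ i - of_nat l)"
      by (subst prod.remove[of _ j]) (auto simp: lookup_add lookup_single intro!: prod.cong)
    also have "\<dots> = (v $ j - of_nat (lookup a j)) * (\<Prod>i\<in>UNIV. \<Prod>l<lookup a i. v $ i - of_nat l)"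
      by (subst (2) prod.remove[of _ j]) (simp_all flip: Suc_eq_plus1_left)
    finally show ?thesis
      by (simp add: q_def poly_eval_add poly_eval_mult p left_diff_distrib)
  qed
  ultimately show ?case by blast
qed

lemma weyl_left_ideal_mult: "Q \<in> S \<Longrightarrow> weyl_mult P Q \<in> weyl_left_ideal S"
  unfolding weyl_left_ideal_def by (rule CollectI, rule exI[of _ "{Q}"], rule exI[of _ "\<lambda>_. P"]) simp

lemma of_del_poly_single: "of_del_poly (single b c) = single (0, b) c"
  unfolding of_del_poly_def by (rule sum_keys_single) simp

lemma fake_exponent_euler:
  assumes "fake_exponent A \<beta> w v"
  shows "(\<Sum>j\<in>UNIV. of_int (A $ i $ j) * v $ j) = \<beta> $ i"
proof -
  let ?q = "lin_form (A $ i) - const (\<beta> $ i)"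
  have "of_theta_poly 0 \<in> weyl_left_ideal (of_del_poly ` init_ideal w (toric_ideal A))"
    unfolding weyl_left_ideal_def by (rule CollectI, rule exI[of _ "{}"]) simp
  moreover have "?q \<in> ideal_gen (euler_polys A \<beta>)"
    by (rule ideal_in_superset) (auto simp: euler_polys_def)
  ultimately have "0 + ?q \<in> fake_indicial_ideal A \<beta> w"
    unfolding fake_indicial_ideal_def by blast
  hence "poly_eval (($) v) (0 + ?q) = 0" using assms unfolding fake_exponent_def by blast
  then show ?thesis by (simp add: poly_eval_diff lin_form_def poly_eval_sum poly_eval_mult)
qed

text \<open>\<open>x^a \<partial>^a\<close> lies in the left ideal of the initial ideal and is a
  polynomial in the theta operators, so its product of falling factorials must vanish at
  \<open>v\<close>.\<close>

lemma fake_exponent_initial: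
  assumes "fake_exponent A \<beta> w v" "monom a \<in> init_ideal w (toric_ideal A)"
  shows "\<exists>j l. l < lookup a j \<and> v $ j = of_nat l"
proof -
  obtain p where p: "of_theta_poly p = single (a, a) 1"
     "poly_eval (($) v) p = (\<Prod>j\<in>UNIV. \<Prod>l<lookup a j. v $ j - of_nat l)"
    using of_theta_poly_falling by blast
  have "of_theta_poly p = weyl_mult (single (a, 0) 1) (of_del_poly (monom a))"
    by (simp add: p monom_def of_del_poly_single weyl_mult_single op_monom_0[OF commuting_weyl_d]
        op_monom_weyl_x_single)
  hence "of_theta_poly p \<in> weyl_left_ideal (of_del_poly ` init_ideal w (toric_ideal A))"
    using assms(2) by (simp add: weyl_left_ideal_mult)
  moreover have "0 \<in> ideal_gen (euler_polys A \<beta>)"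
    unfolding ideal_in_def by (rule CollectI, rule exI[of _ "{}"]) simp
  ultimately have "p + 0 \<in> fake_indicial_ideal A \<beta> w"
    unfolding fake_indicial_ideal_def by blast
  hence "poly_eval (($) v) (p + 0) = 0" using assms(1) unfolding fake_exponent_def by blast
  then show ?thesis by (auto simp: p)
qed

section \<open>Solutions of the hypergeometric system\<close>

lemma weyl_series_act_add: "weyl_series_act (P + Q) \<phi> e = weyl_series_act P \<phi> e + weyl_series_act Q \<phi> e"
  unfolding weyl_series_act_def case_prod_unfold prod.collapse
  by (rule sum_keys_add[where h = "\<lambda>ab c. series_scale c (op_monom series_x (fst ab) (op_monom series_d (snd ab) \<phi>)) e"])
     (simp_all add: series_scale_def cvs.scale_left_distrib)

lemma weyl_series_act_single:
  "weyl_series_act (single (a, b) c) \<phi> e = cscale c (op_monom series_x a (op_monom series_d b \<phi>) e)"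
  unfolding weyl_series_act_def case_prod_unfold prod.collapse
  by (subst sum_keys_single[where h = "\<lambda>ab c. series_scale c (op_monom series_x (fst ab) (op_monom series_d (snd ab) \<phi>)) e"])
     (simp_all add: series_scale_def)

lemma weyl_series_act_0 [simp]: "weyl_series_act 0 \<phi> e = 0"
  by (simp add: weyl_series_act_def)

lemma weyl_series_act_sum: "weyl_series_act (\<Sum>x\<in>S. f x) \<phi> e = (\<Sum>x\<in>S. weyl_series_act (f x) \<phi> e)"
  by (induction S rule: infinite_finite_induct) (simp_all add: weyl_series_act_add)

lemma weyl_series_act_cscale: "weyl_series_act (cscale c P) \<phi> e = cscale c (weyl_series_act P \<phi> e)"
  by (rule additive_weyl_eqI[where P = P])
     (simp_all add: weyl_series_act_add cvs.scale_right_distrib cscale_single weyl_series_act_single)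

lemma weyl_series_act_weyl_x: "weyl_series_act (weyl_x j P) \<phi> = series_x j (weyl_series_act P \<phi>)"
proof
  fix e
  show "weyl_series_act (weyl_x j P) \<phi> e = series_x j (weyl_series_act P \<phi>) e"
  proof (rule additive_weyl_eqI[where P = P])
    fix a b c
    have "op_monom series_x (a + unit_exp j) \<psi> = series_x j (op_monom series_x a \<psi>)" for \<psi> :: "'a log_series"
      by (simp only: add.commute[of a] op_monom_unit_exp_add[OF commuting_series_x])
    then show "weyl_series_act (weyl_x j (single (a, b) c)) \<phi> e = series_x j (weyl_series_act (single (a, b) c) \<phi>) e"
      by (simp add: weyl_x_single weyl_series_act_single) (simp add: series_x_def weyl_series_act_single)
  qed (simp_all add: weyl_x_add weyl_series_act_add series_x_def)
qed

lemma weyl_series_act_weyl_d: "weyl_series_act (weyl_d j P) \<phi> = series_d j (weyl_series_act P \<phi>)"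
proof
  fix e
  show "weyl_series_act (weyl_d j P) \<phi> e = series_d j (weyl_series_act P \<phi>) e"
  proof (rule additive_weyl_eqI[where P = P])
    fix a b c
    have b: "op_monom series_d (b + unit_exp j) \<phi> = series_d j (op_monom series_d b \<phi>)"
      by (simp only: add.commute[of b] op_monom_unit_exp_add[OF commuting_series_d])
    have "series_d j (weyl_series_act (single (a, b) c) \<phi>) e =
        cscale c (series_d j (op_monom series_x a (op_monom series_d b \<phi>)) e)"
      by (simp add: series_d_def weyl_series_act_single poly_diff_cscale cvs.scale_right_distrib ac_simps)
    then show "weyl_series_act (weyl_d j (single (a, b) c)) \<phi> e = series_d j (weyl_series_act (single (a, b) c) \<phi>) e"
      by (simp add: weyl_d_single weyl_series_act_add weyl_series_act_single series_d_op_monom_series_x b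
          cvs.scale_right_distrib ac_simps)
  qed (simp_all add: weyl_d_add weyl_series_act_add series_d_def poly_diff_add cvs.scale_right_distrib)
qed

text \<open>Products act by composition; therefore a series killed by the generators is killed by
  the whole left ideal.\<close>

lemma weyl_series_act_weyl_mult:
  "weyl_series_act (weyl_mult P Q) \<phi> = weyl_series_act P (weyl_series_act Q \<phi>)"
proof
  fix e
  show "weyl_series_act (weyl_mult P Q) \<phi> e = weyl_series_act P (weyl_series_act Q \<phi>) e"
  proof (rule additive_weyl_eqI[where P = P])
    fix a b :: "'a exps" and c
    have x: "weyl_series_act (op_monom weyl_x a R) \<phi> = op_monom series_x a (weyl_series_act R \<phi>)" for R
      by (induction a rule: exps_induct)
         (simp_all add: op_monom_0[OF commuting_weyl_x] op_monom_unit_exp_add[OF commuting_weyl_x]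
           op_monom_0[OF commuting_series_x] op_monom_unit_exp_add[OF commuting_series_x] weyl_series_act_weyl_x)
    have d: "weyl_series_act (op_monom weyl_d b R) \<phi> = op_monom series_d b (weyl_series_act R \<phi>)" for R
      by (induction b rule: exps_induct)
         (simp_all add: op_monom_0[OF commuting_weyl_d] op_monom_unit_exp_add[OF commuting_weyl_d]
           op_monom_0[OF commuting_series_d] op_monom_unit_exp_add[OF commuting_series_d] weyl_series_act_weyl_d)
    show "weyl_series_act (weyl_mult (single (a, b) c) Q) \<phi> e =
        weyl_series_act (single (a, b) c) (weyl_series_act Q \<phi>) e"
      by (simp add: weyl_mult_single weyl_series_act_cscale weyl_series_act_single x d)
  qed (simp_all add: weyl_mult_add_left weyl_series_act_add)
qed

lemma weyl_series_act_zero: "weyl_series_act P (\<lambda>e. 0) = (\<lambda>e. 0)"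
proof
  fix e
  show "weyl_series_act P (\<lambda>e. 0) e = 0"
    by (rule additive_weyl_eqI[where P = P and G = "\<lambda>_. 0"])
       (simp_all add: weyl_series_act_add weyl_series_act_single op_monom_series_x op_monom_series_d)
qed

lemma hypergeometric_solution_iff:
  "hypergeometric_solution A \<beta> \<phi> \<longleftrightarrow>
     (\<forall>P \<in> of_del_poly ` toric_ideal A \<union> of_theta_poly ` euler_polys A \<beta>. \<forall>e. weyl_series_act P \<phi> e = 0)"
    (is "?l \<longleftrightarrow> (\<forall>P\<in>?S. _)")
proof
  assume ?l
  show "\<forall>P\<in>?S. \<forall>e. weyl_series_act P \<phi> e = 0"
  proof (intro ballI allI)
    fix P e assume "P \<in> ?S"
    hence "weyl_mult weyl_one P \<in> hypergeometric_ideal A \<beta>"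
      unfolding hypergeometric_ideal_def by (rule weyl_left_ideal_mult)
    with \<open>?l\<close> have "weyl_series_act P \<phi> = (\<lambda>e. 0)"
      unfolding hypergeometric_solution_def weyl_mult_one_left by blast
    then show "weyl_series_act P \<phi> e = 0" by simp
  qed
next
  assume r: "\<forall>P\<in>?S. \<forall>e. weyl_series_act P \<phi> e = 0"
  show ?l
    unfolding hypergeometric_solution_def
  proof
    fix P assume "P \<in> hypergeometric_ideal A \<beta>"
    then obtain F R where P: "P = (\<Sum>Q\<in>F. weyl_mult (R Q) Q)" "F \<subseteq> ?S"
      unfolding hypergeometric_ideal_def weyl_left_ideal_def by blast
    have "weyl_series_act (weyl_mult (R Q) Q) \<phi> e = 0" if "Q \<in> F" for Q e
    proof -
      have "weyl_series_act Q \<phi> = (\<lambda>e. 0)" using r P(2) that by blast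
      then show ?thesis by (simp add: weyl_series_act_weyl_mult weyl_series_act_zero)
    qed
    then show "weyl_series_act P \<phi> = (\<lambda>e. 0)"
      by (simp add: fun_eq_iff P(1) weyl_series_act_sum)
  qed
qed

lemma weyl_series_act_of_del_poly:
  "weyl_series_act (of_del_poly p) \<phi> e = (\<Sum>b\<in>keys p. cscale (lookup p b) (op_monom series_d b \<phi> e))"
  by (simp add: of_del_poly_def weyl_series_act_sum weyl_series_act_single op_monom_0[OF commuting_series_x])

lemma weyl_series_act_euler:
  "weyl_series_act (of_theta_poly (lin_form a - const c)) \<phi> e =
     cscale ((\<Sum>j\<in>UNIV. of_int (a $ j) * e $ j) - c) (\<phi> e) + diff_act (lin_form a) (\<phi> e)"
proof -
  have one: "weyl_series_act weyl_one \<phi> = \<phi>"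
    by (rule ext) (simp add: weyl_one_def weyl_series_act_single op_monom_0[OF commuting_series_x] op_monom_0[OF commuting_series_d])
  have "of_theta_poly (var j) = weyl_x j (weyl_d j weyl_one)" for j :: 'a
    using of_theta_poly_var_mult[of j 1] of_theta_poly_const[of 1, where 'a = 'a]
    by (simp only: const_1 mult_1_right cvs.scale_one)
  hence var: "weyl_series_act (of_theta_poly (var j)) \<phi> e = cscale (e $ j) (\<phi> e) + poly_diff j (\<phi> e)" for j
    by (simp add: weyl_series_act_weyl_x weyl_series_act_weyl_d one series_x_def series_d_def axis_def)
  have "lin_form a - const c = lin_form a + const (- c)" by (simp add: const_uminus)
  hence "weyl_series_act (of_theta_poly (lin_form a - const c)) \<phi> e =
      (\<Sum>j\<in>UNIV. cscale (of_int (a $ j)) (cscale (e $ j) (\<phi> e) + poly_diff j (\<phi> e))) + cscale (- c) (\<phi> e)"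
    by (simp only: of_theta_poly_add of_theta_poly_const weyl_series_act_add weyl_series_act_cscale one lin_form_def
        of_theta_poly_sum of_theta_poly_const_mult weyl_series_act_sum var)
  also have "\<dots> = cscale ((\<Sum>j\<in>UNIV. of_int (a $ j) * e $ j) - c) (\<phi> e) + diff_act (lin_form a) (\<phi> e)"
    by (simp add: diff_act_lin_form cvs.scale_right_distrib sum.distrib cvs.scale_left_diff_distrib
        cvs.scale_sum_left flip: cscale_eq_const_mult)
  finally show ?thesis .
qed

section \<open>Groebner bases of toric ideals\<close>

lemma keys_ideal_gen_monom:
  assumes "p \<in> ideal_gen (monom ` E)" "a \<in> keys p"
  shows "\<exists>e\<in>E. \<exists>c. a = e + c"
proof -
  obtain F r where F: "finite F" "F \<subseteq> monom ` E" "p = (\<Sum>q\<in>F. r q * q)"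
    using assms(1) by (auto simp: ideal_in_def)
  obtain q where q: "q \<in> F" "a \<in> keys (r q * q)"
    using assms(2) keys_sum[of "\<lambda>q. r q * q" F] unfolding F(3) by blast
  obtain e where e: "e \<in> E" "q = monom e" using q(1) F(2) by blast
  obtain c where "a = c + e" using q(2) keys_mult[of "r q" q] unfolding e(2) by auto
  then show ?thesis using e(1) add.commute by blast
qed

lemma monom_in_ideal_gen_monom: "monom a \<in> ideal_gen (monom ` E) \<longleftrightarrow> (\<exists>e\<in>E. \<exists>c. a = e + c)"
proof
  assume "\<exists>e\<in>E. \<exists>c. a = e + c"
  then obtain e c where "e \<in> E" "monom a = monom c * monom e"
    by (auto simp: monom_mult add.commute)
  then show "monom a \<in> ideal_gen (monom ` E)" by (auto intro: ideal_in_mult)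
qed (use keys_ideal_gen_monom[of "monom a" E a] in simp)

lemma lookup_init_form:
  "lookup (init_form w p) a =
     (if \<forall>b\<in>keys p. exp_weight w b \<le> exp_weight w a then lookup p a else 0)"
proof -
  have "lookup (init_form w p) a =
      (\<Sum>b\<in>{b \<in> keys p. \<forall>c\<in>keys p. exp_weight w c \<le> exp_weight w b}. if b = a then lookup p b else 0)"
    by (simp add: init_form_def lookup_sum lookup_single when_def)
  also have "\<dots> = (if \<forall>b\<in>keys p. exp_weight w b \<le> exp_weight w a then lookup p a else 0)"
    by (subst sum.delta) (auto simp: in_keys_iff)
  finally show ?thesis .
qed

lemma keys_binomial: "a \<noteq> b \<Longrightarrow> keys (monom a - monom b) = {a, b}"
  by (auto simp: in_keys_iff lookup_minus lookup_monom split: if_splits)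

lemma init_form_binomial:
  assumes "exp_weight w b < exp_weight w a"
  shows "init_form w (monom a - monom b) = monom a"
proof (rule poly_mapping_eqI)
  fix c
  have "a \<noteq> b" using assms by auto
  then show "lookup (init_form w (monom a - monom b)) c = lookup (monom a) c"
    using assms by (auto simp: lookup_init_form keys_binomial lookup_minus lookup_monom)
qed

lemma exp_weight_add: "exp_weight w (a + b) = exp_weight w a + exp_weight w b"
  by (simp add: exp_weight_def exp_vec_add int_vec_add inner_right_distrib)

text \<open>A linear map constant on the fibres of \<open>A\<close> kills every monomial multiple of
  a binomial generator. It is used with the indicator of a fibre and with the derivatives of a
  series.\<close>

lemma toric_ideal_sum_fiber:
  assumes p: "p \<in> toric_ideal A"
    and H: "\<And>a b. A *v exp_vec a = A *v exp_vec b \<Longrightarrow> H a = H b"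
  shows "(\<Sum>a\<in>keys p. cscale (lookup p a) (H a)) = 0"
proof -
  define L where "L p = (\<Sum>a\<in>keys p. cscale (lookup p a) (H a))" for p
  have add: "L (p + q) = L p + L q" for p q
    unfolding L_def by (rule sum_keys_add) (simp_all add: cvs.scale_left_distrib)
  have single: "L (single a c) = cscale c (H a)" for a c
    unfolding L_def by (rule sum_keys_single) simp
  have diff: "L (p - q) = L p - L q" for p q
    using add[of "p - q" q] by simp
  have sum: "L (\<Sum>x\<in>S. f x) = (\<Sum>x\<in>S. L (f x))" for S :: "'a cpoly set" and f
  proof (induction S rule: infinite_finite_induct)
    case (insert x F)
    then show ?case by (simp add: add)
  qed (simp_all add: L_def)
  have "L (r * (monom a - monom b)) = 0" if ab: "A *v exp_vec a = A *v exp_vec b" for r a b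
  proof (rule additive_eqI[where p = r and G = "\<lambda>_. 0"])
    fix c k
    have "H (c + a) = H (c + b)"
      by (rule H) (simp add: exp_vec_add matrix_vector_right_distrib ab)
    then show "L (single c k * (monom a - monom b)) = 0"
      by (simp add: right_diff_distrib monom_def mult_single diff single)
  qed (simp_all add: add distrib_right)
  moreover obtain F r where F: "p = (\<Sum>q\<in>F. r q * q)"
      "F \<subseteq> {monom a - monom b |a b. A *v exp_vec a = A *v exp_vec b}"
    using p by (auto simp: toric_ideal_def ideal_in_def)
  ultimately have "L p = 0" by (fastforce simp: F(1) sum intro: sum.neutral)
  then show ?thesis by (simp add: L_def)
qed

lemma toric_ideal_binomial:
  "A *v exp_vec a = A *v exp_vec b \<Longrightarrow> monom a - monom b \<in> toric_ideal A"
  unfolding toric_ideal_def by (rule ideal_in_superset) auto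

lemma toric_ideal_binomialD:
  assumes "monom a - monom b \<in> toric_ideal A" "a \<noteq> b"
  shows "A *v exp_vec a = A *v exp_vec b"
proof (rule ccontr)
  assume neq: "A *v exp_vec a \<noteq> A *v exp_vec b"
  \<comment> \<open>The indicator of the fibre of \<open>a\<close>; if \<open>b\<close> were in
    another fibre, it would take the value 1 on the binomial.\<close>
  define H :: "'a exps \<Rightarrow> 'a cpoly" where "H c = (if A *v exp_vec c = A *v exp_vec a then 1 else 0)" for c
  have "(\<Sum>c\<in>{a, b}. cscale (lookup (monom a - monom b) c) (H c)) = 0"
    using toric_ideal_sum_fiber[OF assms(1), of H] by (simp add: keys_binomial[OF assms(2)] H_def)
  then show False using assms(2) neq by (auto simp: lookup_minus lookup_monom H_def)
qed

lemma finite_exp_deg_eq: "finite {a :: ('n::finite) exps. exp_deg a = n}"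
proof -
  have "lookup ` {a :: 'n exps. exp_deg a = n} \<subseteq> PiE UNIV (\<lambda>_. {..n})"
    by (auto simp: exp_deg_superset[of UNIV] intro: member_le_sum)
  moreover have "finite (PiE UNIV (\<lambda>_. {..n}) :: ('n \<Rightarrow> nat) set)"
    by (rule finite_PiE) auto
  ultimately have "finite (lookup ` {a :: 'n exps. exp_deg a = n})" by (rule finite_subset)
  then show ?thesis by (rule finite_imageD) (simp add: inj_on_def poly_mapping.lookup_inject)
qed

locale toric_groebner =
  fixes A :: "int^'n^'d" and w :: "real^'n" and m :: nat and gp gm :: "nat \<Rightarrow> 'n exps"
    and g :: "nat \<Rightarrow> int^'n"
  assumes hyperplane: "\<exists>(c :: rat^'d) b. c \<noteq> 0 \<and> b \<noteq> 0 \<and>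
          (\<forall>j. (\<Sum>i\<in>UNIV. c $ i * of_int (A $ i $ j)) = b)"
    and groebner: "reduced_groebner_basis w (toric_ideal A)
          ((\<lambda>i. monom (gp i) - monom (gm i)) ` {1..m})"
    and g_def: "\<And>i. i \<in> {1..m} \<Longrightarrow> g i = exp_vec (gp i) - exp_vec (gm i)"
begin

text \<open>The initial form of a basis element is a monomial with coefficient 1; were
  \<open>gm i\<close> of maximal weight, its coefficient -1 would survive in it.\<close>

lemma exp_weight_gm_less:
  assumes "i \<in> {1..m}"
  shows "exp_weight w (gm i) < exp_weight w (gp i)"
proof (rule ccontr)
  assume le: "\<not> exp_weight w (gm i) < exp_weight w (gp i)"
  obtain a where a: "init_form w (monom (gp i) - monom (gm i)) = monom a"
    using groebner assms unfolding reduced_groebner_basis_def by blast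
  show False
  proof (cases "gp i = gm i")
    case True
    then show False
      using arg_cong[OF a, of "\<lambda>p. lookup p a"] by (simp add: init_form_def lookup_monom)
  next
    case False
    have "lookup (monom a) (gm i) = -1"
      unfolding a[symmetric] using le False
      by (simp add: lookup_init_form keys_binomial lookup_minus lookup_monom)
    then show False by (simp add: lookup_monom split: if_splits)
  qed
qed

lemma init_form_gp: "i \<in> {1..m} \<Longrightarrow> init_form w (monom (gp i) - monom (gm i)) = monom (gp i)"
  by (rule init_form_binomial) (rule exp_weight_gm_less)

lemma init_ideal_eq: "init_ideal w (toric_ideal A) = ideal_gen (monom ` gp ` {1..m})"
proof -
  have "init_form w ` (\<lambda>i. monom (gp i) - monom (gm i)) ` {1..m} = monom ` gp ` {1..m}"
    unfolding image_image using init_form_gp by (intro image_cong) auto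
  then show ?thesis using groebner unfolding reduced_groebner_basis_def by metis
qed

lemma monom_in_init_ideal: "monom a \<in> init_ideal w (toric_ideal A) \<longleftrightarrow> (\<exists>i\<in>{1..m}. \<exists>c. a = gp i + c)"
  by (auto simp: init_ideal_eq monom_in_ideal_gen_monom)

lemma A_gp_eq_A_gm:
  assumes "i \<in> {1..m}"
  shows "A *v exp_vec (gp i) = A *v exp_vec (gm i)"
proof (rule toric_ideal_binomialD)
  have "monom (gp i) - monom (gm i) \<in> ideal_gen ((\<lambda>i. monom (gp i) - monom (gm i)) ` {1..m})"
    using assms by (intro ideal_in_superset) auto
  then show "monom (gp i) - monom (gm i) \<in> toric_ideal A"
    using groebner unfolding reduced_groebner_basis_def by simp
  show "gp i \<noteq> gm i" using exp_weight_gm_less[OF assms] by auto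
qed

text \<open>Dividing a basis element by a common variable would give a smaller initial monomial.\<close>

lemma gp_gm_disjoint:
  assumes i: "i \<in> {1..m}"
  shows "lookup (gp i) j = 0 \<or> lookup (gm i) j = 0"
proof (rule ccontr)
  assume nz: "\<not> ?thesis"
  define a b where "a = gp i - unit_exp j" and "b = gm i - unit_exp j"
  have a: "gp i = a + unit_exp j" and b: "gm i = b + unit_exp j"
    using nz by (auto intro!: poly_mapping_eqI simp: a_def b_def lookup_add lookup_minus lookup_single when_def)
  have "A *v exp_vec a = A *v exp_vec b"
    using A_gp_eq_A_gm[OF i] by (simp add: a b exp_vec_add matrix_vector_right_distrib)
  hence T: "monom a - monom b \<in> toric_ideal A" by (rule toric_ideal_binomial)
  have "exp_weight w b < exp_weight w a"
    using exp_weight_gm_less[OF i] by (simp add: a b exp_weight_add)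
  hence "monom a \<in> init_form w ` toric_ideal A" using T init_form_binomial by (metis imageI)
  hence "monom a \<in> init_ideal w (toric_ideal A)"
    unfolding init_ideal_def by (intro ideal_in_superset) auto
  then obtain k c where k: "k \<in> {1..m}" "a = gp k + c" by (auto simp: monom_in_init_ideal)
  let ?p = "\<lambda>i. monom (gp i) - monom (gm i)"
  show False
  \<comment> \<open>Polynomials are compared rather than indices, since the family may repeat an
    element. Equality contradicts degrees, and inequality contradicts reducedness.\<close>
  proof (cases "?p k = ?p i")
    case True
    hence "monom (gp k) = monom (gp i)" using init_form_gp[OF i] init_form_gp[OF k(1)] by simp
    hence "keys (monom (gp k)) = keys (monom (gp i))" by (rule arg_cong)
    hence "gp k = gp i" by simp
    hence "exp_deg (gp i) = exp_deg (gp i) + exp_deg c + 1"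
      using a k(2) by (metis exp_deg_add exp_deg_unit_exp)
    then show False by simp
  next
    case False
    let ?G = "?p ` {1..m}"
    have "monom (gp i) = monom (c + unit_exp j) * init_form w (?p k)"
      using a k(2) by (simp add: init_form_gp[OF k(1)] monom_mult ac_simps)
    also have "\<dots> \<in> ideal_gen (init_form w ` (?G - {?p i}))"
      using k(1) False by (intro ideal_in_mult) auto
    finally have "monom (gp i) \<in> ideal_gen (init_form w ` (?G - {?p i}))" .
    moreover have "gp i \<in> keys (?p i)"
      using exp_weight_gm_less[OF i] by (subst keys_binomial) auto
    ultimately show False using groebner i unfolding reduced_groebner_basis_def by blast
  qed
qed

section \<open>Fibres, normal forms and negative supports\<close>

lemma weight_g_pos: "i \<in> {1..m} \<Longrightarrow> w \<bullet> int_vec (g i) > 0"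
  using exp_weight_gm_less[of i] by (simp add: g_def exp_weight_def int_vec_diff inner_diff_right)

lemma C_monoid_add_g:
  assumes "u \<in> C_monoid m g" "i \<in> {1..m}"
  shows "u + g i \<in> C_monoid m g"
proof -
  obtain c where c: "u = (\<Sum>i=1..m. int (c i) *s g i)" using assms(1) by (auto simp: C_monoid_def)
  have "(\<Sum>k=1..m. int ((c(i := Suc (c i))) k) *s g k) =
      (\<Sum>k=1..m. int (c k) *s g k + (if k = i then g k else 0))"
    by (intro sum.cong) (auto simp: algebra_simps vec_eq_iff)
  also have "\<dots> = u + g i" using assms(2) by (simp add: sum.distrib c)
  finally show ?thesis unfolding C_monoid_def by (intro CollectI exI[of _ "c(i := Suc (c i))"]) simp
qed

lemma C_monoid_0: "0 \<in> C_monoid m g"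
  unfolding C_monoid_def by (intro CollectI exI[of _ "\<lambda>_. 0"]) (simp add: vec_eq_iff)

text \<open>The functional that is constant on the columns of \<open>A\<close> computes the degree
  up to a nonzero factor. Hence fibres are finite.\<close>

lemma exp_deg_fiber:
  assumes "A *v exp_vec a = A *v exp_vec b"
  shows "exp_deg a = exp_deg b"
proof -
  obtain c :: "rat^'d" and r where r: "r \<noteq> 0" "\<And>j. (\<Sum>i\<in>UNIV. c $ i * of_int (A $ i $ j)) = r"
    using hyperplane by blast
  have "(\<Sum>i\<in>UNIV. c $ i * of_int ((A *v exp_vec a) $ i)) = r * of_nat (exp_deg a)" for a
  proof -
    have "(\<Sum>i\<in>UNIV. c $ i * of_int ((A *v exp_vec a) $ i)) =
        (\<Sum>i\<in>UNIV. \<Sum>j\<in>UNIV. c $ i * of_int (A $ i $ j) * of_nat (lookup a j))"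
      by (simp add: matrix_vector_mult_def exp_vec_nth sum_distrib_left mult.assoc)
    also have "\<dots> = (\<Sum>j\<in>UNIV. (\<Sum>i\<in>UNIV. c $ i * of_int (A $ i $ j)) * of_nat (lookup a j))"
      by (subst sum.swap) (simp add: sum_distrib_right)
    also have "\<dots> = r * of_nat (exp_deg a)"
      by (simp add: r exp_deg_superset[of UNIV] sum_distrib_left)
    finally show ?thesis .
  qed
  from this[of a] this[of b] show ?thesis using assms r(1) by simp
qed

text \<open>Division with remainder, phrased as minimisation of the weight. As \<open>w\<close> may
  have negative entries, the minimum exists because fibres are finite; each reduction by basis
  element \<open>i\<close> adds \<open>g i\<close> to the difference of exponents.\<close>

lemma ex_standard_monomial:
  "\<exists>c. A *v exp_vec c = A *v exp_vec a \<and> exp_vec a - exp_vec c \<in> C_monoid m g \<and>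
       monom c \<notin> init_ideal w (toric_ideal A)"
proof -
  define S where "S = {c. A *v exp_vec c = A *v exp_vec a \<and> exp_vec a - exp_vec c \<in> C_monoid m g}"
  have "S \<subseteq> {c. exp_deg c = exp_deg a}" unfolding S_def using exp_deg_fiber by blast
  hence "finite S" using finite_exp_deg_eq finite_subset by blast
  moreover have "a \<in> S" by (simp add: S_def C_monoid_0)
  ultimately obtain c where c: "c \<in> S" "\<And>c'. c' \<in> S \<Longrightarrow> exp_weight w c \<le> exp_weight w c'"
    using arg_min_if_finite(1)[of S "exp_weight w"] arg_min_least[of S _ "exp_weight w"] by blast
  have "monom c \<notin> init_ideal w (toric_ideal A)"
  proof
    assume "monom c \<in> init_ideal w (toric_ideal A)"
    then obtain i d where i: "i \<in> {1..m}" "c = gp i + d" by (auto simp: monom_in_init_ideal)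
    have diff: "exp_vec a - exp_vec (gm i + d) = (exp_vec a - exp_vec c) + g i"
      by (simp add: i(2) g_def[OF i(1)] exp_vec_add)
    have "A *v exp_vec (gm i + d) = A *v exp_vec c"
      by (simp add: i(2) exp_vec_add matrix_vector_right_distrib A_gp_eq_A_gm[OF i(1)])
    moreover have "exp_vec a - exp_vec (gm i + d) \<in> C_monoid m g"
      unfolding diff by (rule C_monoid_add_g[OF _ i(1)]) (use c(1) in \<open>simp add: S_def\<close>)
    ultimately have "gm i + d \<in> S" using c(1) by (simp add: S_def)
    from c(2)[OF this] show False
      using exp_weight_gm_less[OF i(1)] by (simp add: i(2) exp_weight_add)
  qed
  then show ?thesis using c(1) by (auto simp: S_def)
qed

text \<open>The initial form of the difference contains at least one of the two monomials, and a
  monomial ideal contains every term of its members.\<close>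

lemma standard_monomial_unique:
  assumes "A *v exp_vec a = A *v exp_vec b"
    and "monom a \<notin> init_ideal w (toric_ideal A)" "monom b \<notin> init_ideal w (toric_ideal A)"
  shows "a = b"
proof (rule ccontr)
  assume ne: "a \<noteq> b"
  let ?p = "monom a - monom b"
  have "init_form w ?p \<in> ideal_gen (monom ` gp ` {1..m})"
    unfolding init_ideal_eq[symmetric] init_ideal_def
    using toric_ideal_binomial[OF assms(1)] by (intro ideal_in_superset) auto
  hence "monom c \<in> init_ideal w (toric_ideal A)" if "c \<in> keys (init_form w ?p)" for c
    using keys_ideal_gen_monom[OF _ that] by (force simp: monom_in_init_ideal)
  moreover have "a \<in> keys (init_form w ?p) \<or> b \<in> keys (init_form w ?p)"
    using ne by (auto simp: in_keys_iff lookup_init_form keys_binomial lookup_minus lookup_monom)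
  ultimately show False using assms by blast
qed

text \<open>Identifies \<open>G^(i)\<close> with the variables whose falling factorial for
  \<open>gp i\<close> vanishes at \<open>v\<close>. Disjointness of \<open>gp i\<close> and
  \<open>gm i\<close> matters: where \<open>gp i\<close> is positive, \<open>g i\<close> equals
  it.\<close>

lemma new_nsupp_g:
  assumes "i \<in> {1..m}"
  shows "new_nsupp v (g i) = {j. \<exists>l<lookup (gp i) j. v $ j = of_nat l}"
proof (intro equalityI subsetI)
  fix j assume "j \<in> new_nsupp v (g i)"
  then obtain k :: int where k: "k < 0" "v $ j - of_int (g i $ j) = of_int k"
    and n: "\<not> (\<exists>k::int. k < 0 \<and> v $ j = of_int k)"
    by (auto simp: new_nsupp_def nsupp_shift_def nsupp_def int_vec_nth)
  have vj: "v $ j = of_int (k + g i $ j)" using k(2) by (simp add: algebra_simps)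
  hence nn: "k + g i $ j \<ge> 0" using n by (meson not_le)
  hence "v $ j = of_nat (nat (k + g i $ j))" using vj by simp
  moreover have "nat (k + g i $ j) < lookup (gp i) j"
    using nn k(1) g_def[OF assms] by (simp add: exp_vec_nth)
  ultimately show "j \<in> {j. \<exists>l<lookup (gp i) j. v $ j = of_nat l}" by blast
next
  fix j assume "j \<in> {j. \<exists>l<lookup (gp i) j. v $ j = of_nat l}"
  then obtain l where l: "l < lookup (gp i) j" "v $ j = of_nat l" by blast
  have gj: "g i $ j = int (lookup (gp i) j)"
    using gp_gm_disjoint[OF assms, of j] l(1) by (simp add: g_def[OF assms] exp_vec_nth)
  have "v $ j - of_int (g i $ j) = of_int (int l - int (lookup (gp i) j))" by (simp add: gj l(2))
  moreover have "int l - int (lookup (gp i) j) < 0" using l(1) by simp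
  ultimately have "\<exists>k::int. k < 0 \<and> v $ j - of_int (g i $ j) = of_int k" by blast
  moreover have "\<not> (k < 0 \<and> v $ j = of_int k)" for k :: int
  proof
    assume k: "k < 0 \<and> v $ j = of_int k"
    hence "(of_int (int l) :: complex) = of_int k" using l(2) by simp
    hence "int l = k" by (simp only: of_int_eq_iff)
    then show False using k by simp
  qed
  ultimately show "j \<in> new_nsupp v (g i)"
    by (auto simp: new_nsupp_def nsupp_shift_def nsupp_def int_vec_nth)
qed

text \<open>If \<open>u\<close> does not change the negative support, then \<open>\<partial>^(u\<^sub>-)\<close> is standard, hence the normal form of
  \<open>\<partial>^(u\<^sub>+)\<close>.\<close>

lemma nsupp_in_NS:
  assumes "fake_exponent A \<beta> w v"
  shows "nsupp_shift v 0 \<in> NS A v m g"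
proof -
  have "u \<in> C_monoid m g" if u: "u \<in> int_ker A" "nsupp_shift v u = nsupp_shift v 0" for u
  proof -
    define a b :: "'n exps" where "a = Abs_poly_mapping (\<lambda>j. nat (u $ j))"
      and "b = Abs_poly_mapping (\<lambda>j. nat (- u $ j))"
    have la: "lookup a j = nat (u $ j)" and lb: "lookup b j = nat (- u $ j)" for j
      by (simp_all add: a_def b_def)
    have ab: "exp_vec a - exp_vec b = u" by (auto simp: vec_eq_iff exp_vec_nth la lb)
    hence "A *v exp_vec a - A *v exp_vec b = 0"
      using u(1) by (simp add: int_ker_def flip: matrix_vector_mult_diff_distrib)
    hence Aab: "A *v exp_vec a = A *v exp_vec b" by simp
    \<comment> \<open>Otherwise \<open>v $ j\<close> is a natural number below \<open>b_j\<close>.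
      Adding \<open>u $ j = - b_j\<close> makes it negative, so \<open>j\<close> enters the negative
      support of \<open>v + u\<close> without being in that of \<open>v\<close>.\<close>
    have "monom b \<notin> init_ideal w (toric_ideal A)"
    proof
      assume "monom b \<in> init_ideal w (toric_ideal A)"
      then obtain j l where l: "l < lookup b j" "v $ j = of_nat l"
        using fake_exponent_initial[OF assms] by blast
      have "v $ j + of_int (u $ j) = of_int (int l + u $ j)" "int l + u $ j < 0" using l by (simp_all add: lb)
      hence "j \<in> nsupp_shift v u" by (auto simp: nsupp_shift_def nsupp_def int_vec_nth)
      hence "j \<in> nsupp_shift v 0" using u(2) by simp
      then obtain k :: int where "k < 0" "v $ j = of_int k" by (auto simp: nsupp_shift_def nsupp_def)
      hence "(of_int (int l) :: complex) = of_int k" using l(2) by simp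
      hence "int l = k" by (simp only: of_int_eq_iff)
      then show False using \<open>k < 0\<close> by simp
    qed
    moreover obtain c where c: "A *v exp_vec c = A *v exp_vec a" "exp_vec a - exp_vec c \<in> C_monoid m g"
       "monom c \<notin> init_ideal w (toric_ideal A)" using ex_standard_monomial by blast
    ultimately have "c = b" using Aab by (intro standard_monomial_unique) auto
    then show ?thesis using c(2) ab by simp
  qed
  then show ?thesis
    unfolding NS_def by (intro CollectI exI[of _ 0]) (simp add: int_ker_def)
qed

end

section \<open>Leading coefficients lie in the orthogonal complement\<close>

definition act_inj :: "'v cpoly \<Rightarrow> bool" where
  "act_inj p \<longleftrightarrow> (\<forall>f. diff_act p f = 0 \<longrightarrow> f = 0)"

lemma act_inj_mult: "act_inj p \<Longrightarrow> act_inj q \<Longrightarrow> act_inj (p * q)"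
  unfolding act_inj_def diff_act_mult by blast

lemma act_inj_1: "act_inj 1"
  by (simp add: act_inj_def)

lemma act_inj_prod: "(\<And>x. x \<in> S \<Longrightarrow> act_inj (f x)) \<Longrightarrow> act_inj (\<Prod>x\<in>S. f x)"
  by (induction S rule: infinite_finite_induct) (auto intro: act_inj_mult act_inj_1)

lemma act_inj_const_add_var: "c \<noteq> 0 \<Longrightarrow> act_inj (const c + var j)"
  unfolding act_inj_def by (intro allI impI) (rule diff_act_const_add_var_inj)

text \<open>The constants \<open>x - k + 1, ..., x\<close> of the factors are distinct, so at most
  one vanishes, and one does exactly if \<open>x\<close> is among \<open>0, ..., k - 1\<close>. The
  other factors act injectively.\<close>

lemma rising_factor:
  "\<exists>U. act_inj U \<and> rising j (x - of_nat k) k = (if \<exists>l<k. x = of_nat l then var j else 1) * U"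
proof -
  define c where "c l = x - of_nat k + of_nat (Suc l)" for l
  define Z where "Z = {l \<in> {..<k}. c l = 0}"
  define U where "U = (\<Prod>l\<in>{..<k} - Z. const (c l) + var j)"
  have "rising j (x - of_nat k) k = (\<Prod>l<k. const (c l) + var j)"
    by (simp add: rising_def c_def)
  also have "\<dots> = (\<Prod>l\<in>Z. const (c l) + var j) * U"
    unfolding U_def by (subst prod.subset_diff[of Z]) (auto simp: Z_def mult.commute)
  also have "(\<Prod>l\<in>Z. const (c l) + var j) = (\<Prod>l\<in>Z. var j)"
    by (rule prod.cong) (auto simp: Z_def)
  also have "\<dots> = (if \<exists>l<k. x = of_nat l then var j else 1)"
  proof (cases "\<exists>l<k. x = of_nat l")
    case True
    then obtain l0 where l0: "l0 < k" "x = of_nat l0" by blast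
    have "c l = 0 \<longleftrightarrow> l = k - Suc l0" if "l < k" for l
    proof -
      have "c l = of_int (int l0 - int k + int (Suc l))" by (simp add: c_def l0)
      hence "c l = 0 \<longleftrightarrow> int l0 - int k + int (Suc l) = 0" by (metis of_int_eq_0_iff)
      then show ?thesis using l0(1) that by auto
    qed
    hence "Z = {k - Suc l0}" using l0(1) by (auto simp: Z_def)
    then show ?thesis by (simp add: if_P[OF True])
  next
    case False
    have "c l \<noteq> 0" if "l < k" for l
    proof
      assume "c l = 0"
      hence "x = of_nat (k - Suc l)" using that by (simp add: c_def of_nat_diff algebra_simps)
      moreover have "k - Suc l < k" using that by simp
      ultimately show False using False by blast
    qed
    hence "Z = {}" by (auto simp: Z_def)
    then show ?thesis by (simp only: if_not_P[OF False] prod.empty)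
  qed
  finally show ?thesis
    by (intro exI[of _ U]) (auto simp: U_def Z_def intro!: act_inj_prod act_inj_const_add_var)
qed

lemma shift_poly_factor:
  fixes v :: "complex^'n"
  shows "\<exists>U. act_inj U \<and> shift_poly (v - int_vec (exp_vec a)) a =
     (\<Prod>j\<in>{j. \<exists>l<lookup a j. v $ j = of_nat l}. var j) * U"
proof -
  have "\<forall>j. \<exists>U. act_inj U \<and> rising j (v $ j - of_nat (lookup a j)) (lookup a j) =
      (if \<exists>l<lookup a j. v $ j = of_nat l then var j else 1) * U"
    using rising_factor by (intro allI)
  from choice[OF this] obtain U where U: "\<And>j. act_inj (U j)"
      "\<And>j. rising j (v $ j - of_nat (lookup a j)) (lookup a j) =
      (if \<exists>l<lookup a j. v $ j = of_nat l then var j else 1) * U j" by auto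
  have "shift_poly (v - int_vec (exp_vec a)) a =
      (\<Prod>j\<in>UNIV. if \<exists>l<lookup a j. v $ j = of_nat l then var j else 1) * (\<Prod>j\<in>UNIV. U j)"
    by (simp add: shift_poly_def int_vec_nth exp_vec_nth U prod.distrib)
  also have "(\<Prod>j\<in>UNIV. if \<exists>l<lookup a j. v $ j = of_nat l then var j else 1) =
      (\<Prod>j\<in>{j. \<exists>l<lookup a j. v $ j = of_nat l}. var j)"
    by (simp add: prod.If_cases)
  finally show ?thesis using U(1) by (blast intro: act_inj_prod)
qed

context toric_groebner
begin

lemma leading_coeff_in_perp:
  assumes fake: "fake_exponent A \<beta> w v"
    and dir: "series_in_direction A w v \<phi>"
    and sol: "hypergeometric_solution A \<beta> \<phi>"
  shows "\<phi> v \<in> diff_perp (local_fake_indicial_ideal A v m g)"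
  unfolding local_fake_indicial_perp_iff
proof (intro conjI allI ballI)
  fix i
  have "weyl_series_act (of_theta_poly (lin_form (A $ i) - const (\<beta> $ i))) \<phi> v = 0"
    using sol unfolding hypergeometric_solution_iff euler_polys_def by blast
  then show "diff_act (lin_form (A $ i)) (\<phi> v) = 0"
    by (simp add: weyl_series_act_euler fake_exponent_euler[OF fake])
next
  fix i assume i: "i \<in> {1..m}"
  define e where "e = v - int_vec (exp_vec (gp i))"
  have ne: "gp i \<noteq> gm i" using exp_weight_gm_less[OF i] by auto
  have "monom (gp i) - monom (gm i) \<in> toric_ideal A"
    by (rule toric_ideal_binomial) (rule A_gp_eq_A_gm[OF i])
  hence "weyl_series_act (of_del_poly (monom (gp i) - monom (gm i))) \<phi> e = 0"
    using sol unfolding hypergeometric_solution_iff by blast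
  hence "op_monom series_d (gp i) \<phi> e = op_monom series_d (gm i) \<phi> e"
    using ne by (simp add: weyl_series_act_of_del_poly keys_binomial lookup_minus lookup_monom)
  \<comment> \<open>The exponent is \<open>v - g i\<close>, whose shift has negative weight, whereas
    the support of the series allows only positive weights apart from the shift 0.\<close>
  moreover have "\<phi> (e + int_vec (exp_vec (gm i))) = 0"
  proof (rule ccontr)
    assume nz: "\<phi> (e + int_vec (exp_vec (gm i))) \<noteq> 0"
    obtain \<sigma> where \<sigma>: "\<forall>u\<in>\<sigma>. u \<noteq> 0 \<longrightarrow> w \<bullet> u > 0"
      "\<forall>e. \<phi> e \<noteq> 0 \<longrightarrow> (\<exists>u\<in>int_ker A. e = v + int_vec u \<and> int_vec u \<in> \<sigma>)"
      using dir unfolding series_in_direction_def by blast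
    obtain u where u: "e + int_vec (exp_vec (gm i)) = v + int_vec u" "int_vec u \<in> \<sigma>"
      using \<sigma>(2) nz by blast
    have "u = - g i"
    proof -
      have "(of_int (u $ j) :: complex) = of_int (- g i $ j)" for j
        using arg_cong[OF u(1), of "\<lambda>x. x $ j"]
        by (simp add: e_def int_vec_nth g_def[OF i] algebra_simps)
      hence "u $ j = - g i $ j" for j by (simp only: of_int_eq_iff)
      then show ?thesis by (simp add: vec_eq_iff)
    qed
    then show False using \<sigma>(1) u(2) weight_g_pos[OF i] by (force simp: int_vec_uminus)
  qed
  ultimately have "diff_act (shift_poly e (gp i)) (\<phi> v) = 0"
    by (simp add: op_monom_series_d e_def)
  moreover obtain U where "act_inj U" "shift_poly e (gp i) = (\<Prod>j\<in>new_nsupp v (g i). var j) * U"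
    using shift_poly_factor[of v "gp i"] unfolding e_def new_nsupp_g[OF i] by blast
  ultimately show "diff_act (\<Prod>j\<in>new_nsupp v (g i). var j) (\<phi> v) = 0"
    unfolding act_inj_def by (simp only: mult.commute[of _ U] diff_act_mult)
qed

end

section \<open>The Frobenius method\<close>

text \<open>Congruence modulo the annihilator of \<open>f\<close>; inverses of
  \<open>c + \<theta>_j\<close> exist only in this sense.\<close>

definition act_eq :: "'v cpoly \<Rightarrow> 'v cpoly \<Rightarrow> 'v cpoly \<Rightarrow> bool" where
  "act_eq f p q \<longleftrightarrow> diff_act p f = diff_act q f"

lemma act_eq_refl: "act_eq f p p"
  by (simp add: act_eq_def)

lemma act_eq_trans: "act_eq f p q \<Longrightarrow> act_eq f q r \<Longrightarrow> act_eq f p r"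
  by (simp add: act_eq_def)

lemma act_eq_mult_left: "act_eq f p q \<Longrightarrow> act_eq f (r * p) (r * q)"
  by (simp add: act_eq_def diff_act_mult)

lemma act_eq_mult:
  assumes "act_eq f p q" "act_eq f p' q'"
  shows "act_eq f (p * p') (q * q')"
  using act_eq_trans[OF act_eq_mult_left[OF assms(2), of p] act_eq_mult_left[OF assms(1), of q', unfolded mult.commute[of q']]] .

lemma act_eq_prod: "(\<And>x. x \<in> S \<Longrightarrow> act_eq f (p x) (q x)) \<Longrightarrow> act_eq f (\<Prod>x\<in>S. p x) (\<Prod>x\<in>S. q x)"
  by (induction S rule: infinite_finite_induct) (auto intro: act_eq_mult act_eq_refl)

text \<open>For \<open>c = 0\<close> the factor \<theta>_j is not invertible and is replaced by 1;
  \<open>frob_factor\<close> accounts for it separately.\<close>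

definition unit_factor :: "'v \<Rightarrow> complex \<Rightarrow> 'v cpoly" where
  "unit_factor j c = (if c = 0 then 1 else const c + var j)"

lemma unit_factor_inverse: "\<exists>Y. act_eq f (unit_factor j c * Y) 1"
proof (cases "c = 0")
  case False
  obtain N where N: "deg_le N f" using ex_deg_le by blast
  obtain Y R where "(const c + var j) * Y = 1 + R * var j ^ Suc N"
    using const_add_var_inverse[OF False] by metis
  hence "act_eq f ((const c + var j) * Y) 1"
    by (simp only: act_eq_def diff_act_add diff_act_mult[of R] diff_act_var_power_eq_0[OF N]) simp
  then show ?thesis using False by (auto simp: unit_factor_def)
qed (auto simp: unit_factor_def act_eq_def intro!: exI[of _ 1])

text \<open>\<open>W k\<close> plays the role of \<open>1 / \<Gamma>(c + k + 1 + \<theta>\<^sub>j)\<close>, normalised by \<open>W 0 = 1\<close> and with its possible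
  zero at \<open>\<theta>\<^sub>j = 0\<close> removed.\<close>

lemma ex_gamma_units:
  "\<exists>W :: int \<Rightarrow> 'v cpoly. W 0 = 1 \<and>
     (\<forall>k. act_eq f (unit_factor j (c + of_int k) * W k) (W (k - 1)))"
proof -
  obtain Y where Y: "\<And>c. act_eq f (unit_factor j c * Y c) 1"
    using unit_factor_inverse[of f j] by metis
  \<comment> \<open>The two-sided recursion starts at \<open>W 0 = 1\<close>: going up means
    dividing by a unit factor, going down means multiplying by one.\<close>
  define up where "up = rec_nat (1 :: 'v cpoly) (\<lambda>n p. Y (c + of_nat (Suc n)) * p)"
  define down where "down = rec_nat (1 :: 'v cpoly) (\<lambda>n p. unit_factor j (c - of_nat n) * p)"
  have up: "up 0 = 1" "\<And>n. up (Suc n) = Y (c + of_nat (Suc n)) * up n" by (simp_all add: up_def)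
  have down: "down 0 = 1" "\<And>n. down (Suc n) = unit_factor j (c - of_nat n) * down n"
    by (simp_all add: down_def)
  define W where "W k = (if k \<ge> 0 then up (nat k) else down (nat (- k)))" for k :: int
  have "act_eq f (unit_factor j (c + of_int k) * W k) (W (k - 1))" for k
  proof (cases "k > 0")
    case True
    define n where "n = nat (k - 1)"
    have k: "k = int (Suc n)" using True by (simp add: n_def)
    have "W k = Y (c + of_int k) * up n" "W (k - 1) = up n"
      by (simp_all add: W_def k nat_add_distrib up(2) flip: of_nat_Suc) (simp add: up(2))
    then show ?thesis
      using act_eq_mult_left[OF Y[of "c + of_int k"], of "up n"] by (simp add: ac_simps)
  next
    case False
    define n where "n = nat (- k)"
    have k: "k = - int n" using False by (simp add: n_def)
    have "W k = down n" by (cases "n = 0") (simp_all add: W_def k up down)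
    moreover have "W (k - 1) = down (Suc n)"
    proof -
      have "nat (- (k - 1)) = Suc n" "\<not> k - 1 \<ge> 0" by (simp_all add: k)
      then show ?thesis by (simp only: W_def if_False)
    qed
    ultimately show ?thesis by (simp add: k down act_eq_refl)
  qed
  moreover have "W 0 = 1" by (simp add: W_def up)
  ultimately show ?thesis by blast
qed

definition neg_int :: "complex \<Rightarrow> bool" where
  "neg_int c \<longleftrightarrow> (\<exists>k::int. k < 0 \<and> c = of_int k)"

lemma nsupp_iff: "j \<in> nsupp z \<longleftrightarrow> neg_int (z $ j)"
  by (simp add: nsupp_def neg_int_def)

lemma neg_int_diff_nat: "neg_int c \<Longrightarrow> neg_int (c - of_nat n)"
proof -
  assume "neg_int c"
  then obtain k :: int where "k < 0" "c = of_int k" by (auto simp: neg_int_def)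
  then show ?thesis unfolding neg_int_def by (intro exI[of _ "k - int n"]) simp
qed

lemma neg_int_nonzero: "neg_int c \<Longrightarrow> c \<noteq> 0"
  by (auto simp: neg_int_def)

text \<open>Lowering an exponent by 1 changes the negative support only at the step from 0 to
  -1.\<close>

lemma neg_int_minus_1_iff: "c \<noteq> 0 \<Longrightarrow> neg_int (c - 1) \<longleftrightarrow> neg_int c"
proof
  assume c: "c \<noteq> 0" "neg_int (c - 1)"
  then obtain k :: int where k: "k < 0" "c - 1 = of_int k" by (auto simp: neg_int_def)
  have "c = of_int (k + 1)" using k(2) by (simp add: algebra_simps)
  moreover have "k + 1 \<noteq> 0" using c(1) calculation of_int_0 by metis
  ultimately show "neg_int c" unfolding neg_int_def using k(1) by (intro exI[of _ "k + 1"]) auto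
qed (use neg_int_diff_nat[of c 1] in simp)

section \<open>Coefficients of the Frobenius series\<close>

context
  fixes f :: "'n::finite cpoly" and v :: "complex^'n" and K :: "'n set" and W :: "'n \<Rightarrow> int \<Rightarrow> 'n cpoly"
  assumes W0: "\<And>j. W j 0 = 1"
    and W: "\<And>j k. act_eq f (unit_factor j (v $ j + of_int k) * W j k) (W j (k - 1))"
begin

text \<open>The zero of the reciprocal Gamma function at negative integers is restored as a factor
  \<theta>_j, except for \<open>j \<in> K\<close>, where it is common to all coefficients that are
  kept and is divided out.\<close>

definition frob_factor :: "'n \<Rightarrow> int \<Rightarrow> 'n cpoly" where
  "frob_factor j k = (if j \<notin> K \<and> neg_int (v $ j + of_int k) then var j else 1) * W j k"

text \<open>At the step from 0 to -1 the left side contributes \<theta>_j, which is precisely the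
  factor that the right side gains. For \<open>j \<in> K\<close> no such factor is gained, so that
  step is excluded.\<close>

lemma frob_factor_step:
  assumes "j \<in> K \<longrightarrow> v $ j + of_int k \<noteq> 0"
  shows "act_eq f ((const (v $ j + of_int k) + var j) * frob_factor j k) (frob_factor j (k - 1))"
proof (cases "v $ j + of_int k = 0")
  case True
  have "v $ j + of_int (k - 1) = of_int (-1)" using True by (simp add: algebra_simps)
  hence "neg_int (v $ j + of_int (k - 1))" unfolding neg_int_def by (intro exI[of _ "-1"]) simp
  moreover have "\<not> neg_int (v $ j + of_int k)" using True neg_int_nonzero by blast
  ultimately show ?thesis
    using assms True act_eq_mult_left[OF W[of j k], of "var j"]
    by (simp add: frob_factor_def unit_factor_def)
next
  case False
  have eq: "v $ j + of_int (k - 1) = v $ j + of_int k - 1" by simp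
  let ?s = "if j \<notin> K \<and> neg_int (v $ j + of_int k) then var j else 1"
  have "frob_factor j (k - 1) = ?s * W j (k - 1)"
    by (simp only: frob_factor_def eq neg_int_minus_1_iff[OF False])
  moreover have "act_eq f (?s * ((const (v $ j + of_int k) + var j) * W j k)) (?s * W j (k - 1))"
    using act_eq_mult_left[OF W[of j k], of ?s] False by (simp only: unit_factor_def if_False)
  ultimately show ?thesis by (simp only: frob_factor_def mult.left_commute[of ?s])
qed

text \<open>For \<open>j \<in> K\<close> a negative integer at the top stays negative on the way
  down, so the forbidden step through 0 never occurs.\<close>

lemma frob_factor_rising:
  assumes "j \<in> K \<longrightarrow> neg_int (v $ j + of_int (k + int p))"
  shows "act_eq f (rising j (v $ j + of_int k) p * frob_factor j (k + int p)) (frob_factor j k)"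
  using assms
proof (induction p arbitrary: k)
  case 0
  then show ?case by (simp add: rising_def act_eq_refl)
next
  case (Suc p)
  have shift: "k + int (Suc p) = k + 1 + int p" "v $ j + of_int k + 1 = v $ j + of_int (k + 1)" by simp_all
  have "act_eq f (rising j (v $ j + of_int (k + 1)) p * frob_factor j (k + 1 + int p)) (frob_factor j (k + 1))"
    using Suc.prems unfolding shift by (rule Suc.IH)
  hence "act_eq f ((const (v $ j + of_int (k + 1)) + var j) *
        (rising j (v $ j + of_int (k + 1)) p * frob_factor j (k + 1 + int p)))
      ((const (v $ j + of_int (k + 1)) + var j) * frob_factor j (k + 1))"
    by (rule act_eq_mult_left)
  moreover have "act_eq f ((const (v $ j + of_int (k + 1)) + var j) * frob_factor j (k + 1)) (frob_factor j k)"
  proof -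
    have "j \<in> K \<longrightarrow> v $ j + of_int (k + 1) \<noteq> 0"
    proof
      assume "j \<in> K"
      hence "neg_int (v $ j + of_int (k + 1 + int p) - of_nat p)"
        using Suc.prems unfolding shift by (intro neg_int_diff_nat) simp
      then show "v $ j + of_int (k + 1) \<noteq> 0" using neg_int_nonzero by force
    qed
    from frob_factor_step[OF this] show ?thesis by simp
  qed
  ultimately show ?case
    unfolding shift(1) rising_Suc shift(2) mult.assoc by (rule act_eq_trans)
qed

definition frob_coeff :: "int^'n \<Rightarrow> 'n cpoly" where
  "frob_coeff u = (\<Prod>j\<in>UNIV. frob_factor j (u $ j))"

text \<open>The result depends on \<open>u - exp_vec a\<close> alone. Hence the two sides of a box
  equation reach the same \<open>frob_coeff\<close> from different starting points.\<close>

lemma frob_coeff_shift: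
  assumes "K \<subseteq> nsupp_shift v u"
  shows "act_eq f (shift_poly (v + int_vec (u - exp_vec a)) a * frob_coeff u) (frob_coeff (u - exp_vec a))"
proof -
  have "act_eq f (rising j (v $ j + of_int ((u - exp_vec a) $ j)) (lookup a j) * frob_factor j (u $ j))
      (frob_factor j ((u - exp_vec a) $ j))" for j
  proof -
    have u: "u $ j = (u - exp_vec a) $ j + int (lookup a j)" by (simp add: exp_vec_nth)
    have "j \<in> K \<longrightarrow> neg_int (v $ j + of_int (u $ j))"
      using assms by (auto simp: nsupp_shift_def nsupp_iff int_vec_nth)
    from frob_factor_rising[OF this[unfolded u]] show ?thesis unfolding u[symmetric] .
  qed
  hence "act_eq f (\<Prod>j\<in>UNIV. rising j (v $ j + of_int ((u - exp_vec a) $ j)) (lookup a j) * frob_factor j (u $ j))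
      (\<Prod>j\<in>UNIV. frob_factor j ((u - exp_vec a) $ j))" by (intro act_eq_prod)
  then show ?thesis
    by (simp only: frob_coeff_def shift_poly_def prod.distrib vector_add_component int_vec_nth)
qed

lemma frob_coeff_eq:
  "frob_coeff u = (\<Prod>j\<in>nsupp_shift v u - K. var j) * (\<Prod>j\<in>UNIV. W j (u $ j))"
proof -
  have "{j. j \<notin> K \<and> neg_int (v $ j + of_int (u $ j))} = nsupp_shift v u - K"
    by (auto simp: nsupp_shift_def nsupp_iff int_vec_nth)
  then show ?thesis by (simp add: frob_coeff_def frob_factor_def prod.distrib prod.If_cases)
qed

lemma frob_coeff_0: "frob_coeff 0 = (\<Prod>j\<in>nsupp_shift v 0 - K. var j)"
  by (simp add: frob_coeff_eq W0)

text \<open>A larger negative support only adds factors \<theta>_j. It is applied with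
  \<open>S\<close> the union of a support in \<open>NS\<close> and one in
  \<open>NS_compl\<close>.\<close>

lemma frob_coeff_vanish:
  assumes "S \<subseteq> nsupp_shift v u" "diff_act (\<Prod>j\<in>S - K. var j) f = 0"
  shows "diff_act (frob_coeff u) f = 0"
proof -
  let ?T = "nsupp_shift v u - K"
  have "(\<Prod>j\<in>?T. var j) = (\<Prod>j\<in>?T - (S - K). var j) * (\<Prod>j\<in>S - K. var j :: 'n cpoly)"
    using assms(1) by (intro prod.subset_diff) auto
  hence "frob_coeff u = ((\<Prod>j\<in>UNIV. W j (u $ j)) * (\<Prod>j\<in>?T - (S - K). var j)) * (\<Prod>j\<in>S - K. var j)"
    by (simp only: frob_coeff_eq ac_simps)
  then show ?thesis using assms(2) by (simp add: diff_act_mult)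
qed

end

section \<open>The Frobenius series as a solution in the direction \<open>w\<close>\<close>

lemma int_vec_inj: "int_vec u = (int_vec u' :: complex^'n) \<longleftrightarrow> u = u'"
  by (auto simp: vec_eq_iff int_vec_nth)

lemma nsupp_shift_diff_exp_vec: "nsupp_shift v u \<subseteq> nsupp_shift v (u - exp_vec a)"
proof
  fix j assume "j \<in> nsupp_shift v u"
  hence "neg_int (v $ j + of_int (u $ j) - of_nat (lookup a j))"
    by (intro neg_int_diff_nat) (simp add: nsupp_shift_def nsupp_iff int_vec_nth)
  then show "j \<in> nsupp_shift v (u - exp_vec a)"
    by (simp add: nsupp_shift_def nsupp_iff int_vec_nth exp_vec_nth algebra_simps)
qed

context toric_groebner
begin

lemma NS_subset_C_monoid: "u \<in> int_ker A \<Longrightarrow> nsupp_shift v u \<in> NS A v m g \<Longrightarrow> u \<in> C_monoid m g"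
  unfolding NS_def by auto

text \<open>The cone spanned by the \<open>g i\<close>. Their weights are positive, so the cone lies
  in the convex cone formed by 0 and the vectors of positive weight, which makes it pointed.\<close>

lemma C_monoid_cone:
  obtains \<sigma> :: "(real^'n) set" where "rational_cone \<sigma>" "pointed_cone \<sigma>"
    "\<And>u. u \<in> \<sigma> \<Longrightarrow> u \<noteq> 0 \<Longrightarrow> w \<bullet> u > 0" "\<And>u. u \<in> C_monoid m g \<Longrightarrow> int_vec u \<in> \<sigma>"
proof
  define \<sigma> where "\<sigma> = convex_cone hull ((\<lambda>i. int_vec (g i) :: real^'n) ` {1..m})"
  define S where "S = (\<lambda>i. (\<chi> j. of_int (g i $ j)) :: rat^'n) ` {1..m}"
  have "(\<lambda>r. \<chi> j. of_rat (r $ j)) ` S = (\<lambda>i. int_vec (g i) :: real^'n) ` {1..m}"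
    unfolding S_def image_image by (intro image_cong) (simp_all add: int_vec_def)
  then show "rational_cone \<sigma>" unfolding rational_cone_def
    by (intro exI[of _ S]) (simp add: \<sigma>_def S_def)
  have "convex_cone {u. u = 0 \<or> w \<bullet> u > 0}"
    unfolding convex_cone_iff by (auto simp: inner_right_distrib le_less intro: add_pos_pos)
  hence "\<sigma> \<subseteq> {u. u = 0 \<or> w \<bullet> u > 0}"
    unfolding \<sigma>_def by (intro hull_minimal) (use weight_g_pos in auto)
  then show pos: "w \<bullet> u > 0" if "u \<in> \<sigma>" "u \<noteq> 0" for u using that by blast
  have zero: "0 \<in> \<sigma>" unfolding \<sigma>_def by (rule convex_cone_hull_contains_0)
  show "pointed_cone \<sigma>" unfolding pointed_cone_def
  proof (intro equalityI subsetI)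
    fix u assume u: "u \<in> \<sigma> \<inter> uminus ` \<sigma>"
    show "u \<in> {0}"
    proof (rule ccontr)
      assume "u \<notin> {0}"
      hence "w \<bullet> u > 0" "w \<bullet> (- u) > 0" using u pos[of u] pos[of "- u"] by auto
      then show False by simp
    qed
  qed (use zero in auto)
  show "int_vec u \<in> \<sigma>" if u: "u \<in> C_monoid m g" for u
  proof -
    obtain c where c: "u = (\<Sum>i=1..m. int (c i) *s g i)" using u by (auto simp: C_monoid_def)
    have eq: "int_vec u = (\<Sum>i=1..m. real (c i) *\<^sub>R (int_vec (g i) :: real^'n))"
      by (simp add: c vec_eq_iff int_vec_nth)
    have "(\<Sum>i\<in>I. real (c i) *\<^sub>R (int_vec (g i) :: real^'n)) \<in> \<sigma>" if "finite I" "I \<subseteq> {1..m}" for I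
      using that
    proof (induction I rule: finite_induct)
      case (insert i I)
      have "int_vec (g i) \<in> \<sigma>" unfolding \<sigma>_def by (rule hull_inc) (use insert.prems in auto)
      hence "real (c i) *\<^sub>R int_vec (g i) \<in> \<sigma>"
        unfolding \<sigma>_def by (intro convex_cone_hull_mul) simp_all
      moreover have "(\<Sum>i\<in>I. real (c i) *\<^sub>R int_vec (g i)) \<in> \<sigma>" using insert by simp
      ultimately show ?case
        unfolding sum.insert[OF insert.hyps] \<sigma>_def by (rule convex_cone_hull_add)
    qed (simp add: zero)
    then show ?thesis unfolding eq by blast
  qed
qed

lemma frobenius_solution:
  assumes fake: "fake_exponent A \<beta> w v"
    and ker: "\<And>i. diff_act (lin_form (A $ i)) f = 0"
    and boundary: "\<And>I J. I \<in> NS A v m g \<Longrightarrow> J \<in> NS_compl A v m g \<Longrightarrow>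
      diff_act (\<Prod>j\<in>(I \<union> J) - K_set A v m g. var j) f = 0"
  shows "\<exists>\<phi>. series_in_direction A w v \<phi> \<and> hypergeometric_solution A \<beta> \<phi> \<and>
     \<phi> v = diff_act (\<Prod>j\<in>nsupp_shift v 0 - K_set A v m g. var j) f"
proof -
  let ?K = "K_set A v m g" and ?NS = "NS A v m g" and ?L = "int_ker A"
  have "\<forall>j. \<exists>W :: int \<Rightarrow> 'n cpoly. W 0 = 1 \<and>
     (\<forall>k. act_eq f (unit_factor j (v $ j + of_int k) * W k) (W (k - 1)))"
    by (intro allI ex_gamma_units)
  from choice[OF this] obtain W where W: "\<And>j. W j 0 = 1"
    "\<And>j k. act_eq f (unit_factor j (v $ j + of_int k) * W j k) (W j (k - 1))" by blast
  define M where "M = frob_coeff v ?K W"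
  have shift: "act_eq f (shift_poly (v + int_vec (u - exp_vec a)) a * M u) (M (u - exp_vec a))"
    if "?K \<subseteq> nsupp_shift v u" for u a
    unfolding M_def by (rule frob_coeff_shift[OF W that])
  have vanish: "diff_act (M u) f = 0"
    if "S \<subseteq> nsupp_shift v u" "diff_act (\<Prod>j\<in>S - ?K. var j) f = 0" for S u
    unfolding M_def by (rule frob_coeff_vanish[OF W that])
  \<comment> \<open>The cut-off confines the support to \<open>C_monoid m g\<close>; its price is a
    defect where a box equation links a kept coefficient to a dropped one.\<close>
  define \<psi> where "\<psi> u = (if u \<in> ?L \<and> nsupp_shift v u \<in> ?NS then diff_act (M u) f else 0)" for u
  define \<phi> where "\<phi> e = (if \<exists>u. e = v + int_vec u then \<psi> (THE u. e = v + int_vec u) else 0)" for e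
  have \<phi>: "\<phi> (v + int_vec u) = \<psi> u" for u
  proof -
    have "(THE u'. v + int_vec u = v + int_vec u') = u"
      by (rule the_equality) (simp_all add: int_vec_inj)
    then show ?thesis by (auto simp: \<phi>_def)
  qed
  have \<phi>_nz: "\<exists>u\<in>?L. e = v + int_vec u \<and> nsupp_shift v u \<in> ?NS \<and> \<phi> e = diff_act (M u) f" if "\<phi> e \<noteq> 0" for e
  proof -
    have "\<exists>u. e = v + int_vec u"
    proof (rule ccontr)
      assume "\<not> (\<exists>u. e = v + int_vec u)"
      then show False using that by (simp add: \<phi>_def)
    qed
    then obtain u where u: "e = v + int_vec u" by blast
    then show ?thesis using that by (auto simp: \<phi> \<psi>_def split: if_splits)
  qed
  have d: "op_monom series_d a \<phi> e =
      (if u \<in> ?L \<and> nsupp_shift v u \<in> ?NS then diff_act (M (u - exp_vec a)) f else 0)"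
    if e: "e + int_vec (exp_vec a) = v + int_vec u" for a e u
  proof -
    have e': "e = v + int_vec (u - exp_vec a)" using e by (simp add: int_vec_diff algebra_simps)
    have "op_monom series_d a \<phi> e = diff_act (shift_poly e a) (\<psi> u)"
      by (simp add: op_monom_series_d e \<phi>)
    moreover have "diff_act (shift_poly e a) (diff_act (M u) f) = diff_act (M (u - exp_vec a)) f"
      if "nsupp_shift v u \<in> ?NS"
    proof -
      have "?K \<subseteq> nsupp_shift v u" using that by (auto simp: K_set_def)
      from shift[OF this, of a] show ?thesis by (simp add: act_eq_def e' diff_act_mult)
    qed
    ultimately show ?thesis by (auto simp: \<psi>_def)
  qed
  have box: "op_monom series_d a \<phi> e = op_monom series_d b \<phi> e"
    if ab: "A *v exp_vec a = A *v exp_vec b" for a b e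
  proof (cases "\<exists>u. e + int_vec (exp_vec a) = v + int_vec u")
    case True
    then obtain u where u: "e + int_vec (exp_vec a) = v + int_vec u" by blast
    define u' where "u' = u - exp_vec a + exp_vec b"
    have u': "e + int_vec (exp_vec b) = v + int_vec u'"
      using u by (simp add: u'_def int_vec_add int_vec_diff algebra_simps)
    have L: "u' \<in> ?L \<longleftrightarrow> u \<in> ?L"
      by (simp add: u'_def int_ker_def matrix_vector_right_distrib matrix_vector_mult_diff_distrib ab)
    define t where "t = u - exp_vec a"
    have t: "u' - exp_vec b = t" by (simp add: t_def u'_def)
    have sub: "nsupp_shift v u \<union> nsupp_shift v u' \<subseteq> nsupp_shift v t"
      using nsupp_shift_diff_exp_vec[of v u a] nsupp_shift_diff_exp_vec[of v u' b] by (simp add: t t_def)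
    \<comment> \<open>Both sides of the box equation are \<open>M t\<close> on \<open>f\<close> or
      0. They can differ only if exactly one of \<open>u\<close>, \<open>u'\<close> is kept; as
      \<open>t\<close> lies below both, its negative support contains both supports and the boundary
      condition applies.\<close>
    have zero: "diff_act (M t) f = 0" if "u \<in> ?L" "(nsupp_shift v u \<in> ?NS) \<noteq> (nsupp_shift v u' \<in> ?NS)"
    proof (cases "nsupp_shift v u \<in> ?NS")
      case True
      hence "nsupp_shift v u' \<in> NS_compl A v m g" using that L by (auto simp: NS_compl_def)
      from boundary[OF True this] show ?thesis by (rule vanish[OF sub])
    next
      case False
      hence "nsupp_shift v u' \<in> ?NS" "nsupp_shift v u \<in> NS_compl A v m g" using that by (auto simp: NS_compl_def)
      from boundary[OF this] show ?thesis using sub by (intro vanish[of "nsupp_shift v u' \<union> nsupp_shift v u"]) auto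
    qed
    show ?thesis using zero by (auto simp: d[OF u] d[OF u'] L t t_def[symmetric])
  next
    case False
    have "\<not> (\<exists>u. e + int_vec (exp_vec b) = v + int_vec u)"
    proof
      assume "\<exists>u. e + int_vec (exp_vec b) = v + int_vec u"
      then obtain u where "e + int_vec (exp_vec b) = v + int_vec u" by blast
      hence "e + int_vec (exp_vec a) = v + int_vec (u - exp_vec b + exp_vec a)"
        by (simp add: int_vec_add int_vec_diff algebra_simps)
      then show False using False by blast
    qed
    with False have "\<phi> (e + int_vec (exp_vec a)) = 0" "\<phi> (e + int_vec (exp_vec b)) = 0"
      by (simp_all add: \<phi>_def)
    then show ?thesis by (simp add: op_monom_series_d)
  qed
  have "hypergeometric_solution A \<beta> \<phi>"
    unfolding hypergeometric_solution_iff
  proof (intro ballI allI)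
    fix P e assume "P \<in> of_del_poly ` toric_ideal A \<union> of_theta_poly ` euler_polys A \<beta>"
    then show "weyl_series_act P \<phi> e = 0"
    proof
      assume "P \<in> of_del_poly ` toric_ideal A"
      then obtain p where p: "p \<in> toric_ideal A" "P = of_del_poly p" by blast
      show ?thesis unfolding p(2) weyl_series_act_of_del_poly
        by (rule toric_ideal_sum_fiber[OF p(1)]) (rule box)
    next
      assume "P \<in> of_theta_poly ` euler_polys A \<beta>"
      then obtain i where P: "P = of_theta_poly (lin_form (A $ i) - const (\<beta> $ i))"
        by (auto simp: euler_polys_def)
      show ?thesis
      proof (cases "\<phi> e = 0")
        case False
        then obtain u where u: "u \<in> ?L" "e = v + int_vec u" "\<phi> e = diff_act (M u) f" using \<phi>_nz by blast
        have "(\<Sum>j\<in>UNIV. of_int (A $ i $ j) * e $ j) =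
            (\<Sum>j\<in>UNIV. of_int (A $ i $ j) * v $ j) + of_int (\<Sum>j\<in>UNIV. A $ i $ j * u $ j)"
          by (simp add: u(2) int_vec_nth distrib_left sum.distrib)
        also have "(\<Sum>j\<in>UNIV. A $ i $ j * u $ j) = 0"
          using u(1) by (simp add: int_ker_def vec_eq_iff matrix_vector_mult_def)
        finally have "(\<Sum>j\<in>UNIV. of_int (A $ i $ j) * e $ j) = \<beta> $ i"
          by (simp add: fake_exponent_euler[OF fake])
        moreover have "diff_act (lin_form (A $ i)) (\<phi> e) = 0"
          unfolding u(3) using ker[of i] by (subst diff_act_commute) simp
        ultimately show ?thesis by (simp add: P weyl_series_act_euler)
      qed (simp add: P weyl_series_act_euler)
    qed
  qed
  moreover have "series_in_direction A w v \<phi>"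
    unfolding series_in_direction_def
  proof
    obtain \<sigma> :: "(real^'n) set" where \<sigma>: "rational_cone \<sigma>" "pointed_cone \<sigma>"
      "\<And>u. u \<in> \<sigma> \<Longrightarrow> u \<noteq> 0 \<Longrightarrow> w \<bullet> u > 0" "\<And>u. u \<in> C_monoid m g \<Longrightarrow> int_vec u \<in> \<sigma>"
      using C_monoid_cone by blast
    have "\<exists>u\<in>?L. e = v + int_vec u \<and> int_vec u \<in> \<sigma>" if "\<phi> e \<noteq> 0" for e
      using \<phi>_nz[OF that] NS_subset_C_monoid \<sigma>(4) by blast
    then show "\<exists>\<sigma>. rational_cone \<sigma> \<and> pointed_cone \<sigma> \<and> (\<forall>u\<in>\<sigma>. u \<noteq> 0 \<longrightarrow> w \<bullet> u > 0) \<and>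
        (\<forall>e. \<phi> e \<noteq> 0 \<longrightarrow> (\<exists>u\<in>int_ker A. e = v + int_vec u \<and> int_vec u \<in> \<sigma>))"
      using \<sigma>(1-3) by (intro exI[of _ \<sigma>]) blast
    \<comment> \<open>Differential operators do not raise degrees, so a bound for \<open>f\<close>
      bounds all coefficients uniformly.\<close>
    obtain N where N: "deg_le N f" using ex_deg_le by blast
    have "deg_le N (\<phi> e)" for e
    proof (cases "\<phi> e = 0")
      case False
      then show ?thesis using \<phi>_nz[of e] deg_le_diff_act[OF N] by metis
    qed (simp add: deg_le_def)
    then show "\<exists>N. \<forall>e. \<forall>a\<in>keys (\<phi> e). exp_deg a \<le> N" unfolding deg_le_iff by blast
  qed
  moreover have "\<phi> v = diff_act (\<Prod>j\<in>nsupp_shift v 0 - ?K. var j) f"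
  proof -
    have "\<phi> v = \<psi> 0" using \<phi>[of 0] by simp
    also have "\<dots> = diff_act (M 0) f" using nsupp_in_NS[OF fake] by (simp add: \<psi>_def int_ker_def)
    also have "M 0 = (\<Prod>j\<in>nsupp_shift v 0 - ?K. var j)" unfolding M_def by (rule frob_coeff_0[OF W])
    finally show ?thesis .
  qed
  ultimately show ?thesis by blast
qed

end

text \<open>If row \<open>j\<close> of \<open>B\<close> were zero, all of \<open>v + L\<close> would
  share its coordinate \<open>j\<close>, so \<open>j\<close> would lie in every negative support and
  hence in \<open>K\<close>. This makes \<open>m_poly\<close> a product of nonzero forms.\<close>

lemma Bs_nonzero_outside_K:
  assumes B: "int_basis B (int_ker A)" and j: "j \<in> nsupp_shift v 0 - K_set A v m g"
  shows "\<exists>k<length B. B ! k $ j \<noteq> 0"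
proof (rule ccontr)
  assume "\<not> ?thesis"
  hence Bj: "\<And>k. k < length B \<Longrightarrow> B ! k $ j = 0" by blast
  have "u $ j = 0" if "u \<in> int_ker A" for u
  proof -
    obtain c where "u = (\<Sum>k<length B. c k *s B ! k)"
      using B \<open>u \<in> int_ker A\<close> unfolding int_basis_def by blast
    then show ?thesis by (simp add: Bj)
  qed
  hence "j \<in> nsupp_shift v u" if "u \<in> int_ker A" for u
    using j that by (simp add: nsupp_shift_def nsupp_def int_vec_nth)
  hence "j \<in> K_set A v m g" by (auto simp: K_set_def NS_def)
  then show False using j by blast
qed

theorem theorem3p5:
  fixes A :: "int^'n^'d" and \<beta> :: "complex^'d" and w :: "real^'n" and v :: "complex^'n"
    and m :: nat and gp gm :: "nat \<Rightarrow> 'n exps" and g :: "nat \<Rightarrow> int^'n"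
    and B :: "(int^'n) list"
  assumes rank_A: "rank (map_matrix of_int A :: rat^'n^'d) = CARD('d)"
    and hyperplane: "\<exists>(c :: rat^'d) b. c \<noteq> 0 \<and> b \<noteq> 0 \<and>
          (\<forall>j. (\<Sum>i\<in>UNIV. c $ i * of_int (A $ i $ j)) = b)"
    and w_generic: "monomial_ideal (init_ideal w (toric_ideal A))"
    and groebner: "reduced_groebner_basis w (toric_ideal A)
          ((\<lambda>i. monom (gp i) - monom (gm i)) ` {1..m})"
    and gp_initial: "\<And>i. i \<in> {1..m} \<Longrightarrow> monom (gp i) \<in> init_ideal w (toric_ideal A)"
    and g_def: "\<And>i. i \<in> {1..m} \<Longrightarrow> g i = exp_vec (gp i) - exp_vec (gm i)"
    and fake_v: "fake_exponent A \<beta> w v"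
    and B_basis: "int_basis B (int_ker A)"
    and P_eq: "P_ideal A v m g B = (\<lambda>p. m_poly A v m g B * p) ` PB_ideal v m g B"
  shows "exponent_in_direction A \<beta> w v \<and>
    leading_coeffs A \<beta> w v = lambda_B B ` PB_perp v m g B \<and>
    (\<forall>q. hom_part (leading_coeffs A \<beta> w v) q = lambda_B B ` hom_part (PB_perp v m g B) q) \<and>
    graded_isomorphic (lambda_B B ` PB_perp v m g B)
      (diff_perp (local_fake_indicial_ideal A v m g)) \<and>
    (\<forall>q. cvs.dim (hom_part (leading_coeffs A \<beta> w v) q) =
         cvs.dim (hom_part (diff_perp (local_fake_indicial_ideal A v m g)) q))"
proof -
  interpret toric_groebner A w m gp gm g
    by unfold_locales (fact hyperplane groebner g_def)+
  let ?K = "K_set A v m g" and ?Q = "diff_perp (local_fake_indicial_ideal A v m g)"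
  have Q: "lambda_B B ` PB_perp v m g B = ?Q" by (rule lambda_B_PB_perp[OF rank_A B_basis])
  have sub1: "leading_coeffs A \<beta> w v \<subseteq> ?Q"
    using leading_coeff_in_perp[OF fake_v]
    by (auto simp: leading_coeffs_def series_solution_with_exponent_def local_fake_indicial_perp_iff)
  have sub2: "lambda_B B q\<^sub>0 \<in> leading_coeffs A \<beta> w v" if q0: "q\<^sub>0 \<in> PB_perp v m g B" for q\<^sub>0
  proof -
    obtain q where q: "q \<in> s_ring B" "diff_act (m_poly A v m g B) q = q\<^sub>0"
      unfolding m_poly_def
      using diff_act_Bs_prod_surj[of "nsupp_shift v 0 - ?K" B q\<^sub>0] Bs_nonzero_outside_K[OF B_basis] q0
      by (auto simp: PB_perp_iff)
    have "\<exists>\<phi>. series_in_direction A w v \<phi> \<and> hypergeometric_solution A \<beta> \<phi> \<and>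
       \<phi> v = diff_act (\<Prod>j\<in>nsupp_shift v 0 - ?K. var j) (lambda_B B q)"
    proof (rule frobenius_solution[OF fake_v])
      show "diff_act (lin_form (A $ i)) (lambda_B B q) = 0" for i
        by (simp add: diff_act_lambda_B[OF q(1)] poly_subst_Bs_lin_form[OF B_basis] lambda_B_simps)
    next
      fix I J assume "I \<in> NS A v m g" "J \<in> NS_compl A v m g"
      hence "Bs_prod B ((I \<union> J) - ?K) \<in> P_ideal A v m g B"
        unfolding P_ideal_def by (intro ideal_in_superset) (auto simp: s_ring_def)
      \<comment> \<open>The hypothesis on \<open>P\<close> splits each boundary product: the factor
        \<open>m_poly\<close> turns \<open>q\<close> into \<open>q\<^sub>0\<close>, and the factor
        in \<open>PB_ideal\<close> annihilates \<open>q\<^sub>0\<close>.\<close>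
      then obtain p where p: "p \<in> PB_ideal v m g B" "Bs_prod B ((I \<union> J) - ?K) = m_poly A v m g B * p"
        unfolding P_eq by blast
      have "diff_act (Bs_prod B ((I \<union> J) - ?K)) q = diff_act p (diff_act (m_poly A v m g B) q)"
        by (simp add: p(2) mult.commute[of _ p] diff_act_mult)
      also have "\<dots> = 0" unfolding q(2) by (rule diff_act_PB_ideal_perp[OF q0 p(1)])
      finally show "diff_act (\<Prod>j\<in>(I \<union> J) - ?K. var j) (lambda_B B q) = 0"
        by (simp add: diff_act_lambda_B[OF q(1)] poly_subst_Bs_prod lambda_B_simps)
    qed
    moreover have "diff_act (\<Prod>j\<in>nsupp_shift v 0 - ?K. var j) (lambda_B B q) = lambda_B B q\<^sub>0"
      using q by (simp add: diff_act_lambda_B poly_subst_Bs_prod m_poly_def)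
    ultimately obtain \<phi> where \<phi>: "series_in_direction A w v \<phi>" "hypergeometric_solution A \<beta> \<phi>"
      "\<phi> v = lambda_B B q\<^sub>0" by auto
    show ?thesis
    \<comment> \<open>A series with zero coefficient at \<open>v\<close> is no solution with
      exponent \<open>v\<close>; the zero leading coefficient is supplied by the
      \<open>insert 0\<close> in \<open>leading_coeffs\<close>.\<close>
    proof (cases "lambda_B B q\<^sub>0 = 0")
      case False
      hence "series_solution_with_exponent A \<beta> w v \<phi>"
        using \<phi> by (simp add: series_solution_with_exponent_def)
      then show ?thesis unfolding leading_coeffs_def using \<phi>(3) by (metis (mono_tags, lifting) insertCI mem_Collect_eq)
    qed (simp add: leading_coeffs_def)
  qed
  have C: "leading_coeffs A \<beta> w v = lambda_B B ` PB_perp v m g B"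
    using sub1 sub2 unfolding Q[symmetric] by blast
  \<comment> \<open>A nonzero leading coefficient is needed for \<open>v\<close> to be an exponent.
    The constant 1 serves, because each \<open>new_nsupp v (g i)\<close> is nonempty by the fake
    exponent condition.\<close>
  have "1 \<in> ?Q"
    unfolding local_fake_indicial_perp_iff
  proof (intro conjI allI ballI)
    show "diff_act (lin_form (A $ i)) 1 = 0" for i by (simp add: diff_act_lin_form)
  next
    fix i assume i: "i \<in> {1..m}"
    let ?G = "new_nsupp v (g i)"
    obtain j where j: "j \<in> ?G"
      using fake_exponent_initial[OF fake_v gp_initial[OF i]] unfolding new_nsupp_g[OF i] by blast
    have "(\<Prod>j\<in>?G. var j) = (\<Prod>j\<in>?G - {j}. var j) * (var j :: 'n cpoly)"
      by (subst prod.remove[OF _ j]) (simp_all add: mult.commute)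
    then show "diff_act (\<Prod>j\<in>?G. var j) 1 = 0" by (simp add: diff_act_mult diff_act_var)
  qed
  hence "1 \<in> leading_coeffs A \<beta> w v" unfolding C Q .
  hence "exponent_in_direction A \<beta> w v"
    by (auto simp: leading_coeffs_def exponent_in_direction_def)
  moreover have "graded_isomorphic (lambda_B B ` PB_perp v m g B) ?Q"
    using graded_isomorphic_refl[OF graded_subspace_lambda_B_PB_perp] Q by metis
  ultimately show ?thesis unfolding C hom_part_lambda_B_PB_perp by (simp flip: Q hom_part_lambda_B_PB_perp)
qed

end
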